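(* Generalizing Garvan's formula, let $n$ be a positive integer, let $\alpha,\beta\in\mathbb R$ with $\theta=e^{-2\pi i\alpha}$, $\phi=e^{-2\pi i\beta}$, and let $x_i,y_j$ be complex variables. With the notation of the context, one has the following. (i) For $(\theta,\phi)\neq(1,1)$, $$\eta(\tau)^{24n}=-\,\frac{\vartheta^{(1)}\begin{bmatrix}\frac12\\ \frac12\end{bmatrix}(0,\tau)\;\Theta^{(1)}_{8n,8n,(1,1)}(x,y,\tau)}{\vartheta^{(1)}\begin{bmatrix}\frac12-\beta\\ \frac12+\alpha\end{bmatrix}\Big(\sum_{i=1}^{8n}(x_i-y_i),\tau\Big)}\;\det {\bf P}_{8n}(\theta,\phi).$$ (ii) Also for $(\theta,\phi)\neq(1,1)$, in terms of deformed Eisenstein series, $$\eta(\tau)^{24n}=-\,\frac{\vartheta^{(1)}\begin{bmatrix}\frac12\\ \frac12\end{bmatrix}(0,\tau)\;\Theta^{(1)}_{8n,8n,(1,1)}(x,y,\tau)}{\vartheta^{(1)}\begin{bmatrix}\frac12-\beta\\ \frac12+\alpha\end{bmatrix}\Big(\sum_{i=1}^{8n}(x_i-y_i),\tau\Big)}\;\det\left[\frac{1}{x_i-y_j}-\sum_{k\ge1}\frac1k\,E^{(1)}_k\begin{bmatrix}\theta\\ \phi\end{bmatrix}(\tau)\,(x_i-y_j)^{k-1}\right]_{1\le i,j\le 8n}.$$ (iii) For $(\theta,\phi)=(1,1)$, $$\eta(\tau)^{24n}=i\,\frac{\Theta^{(1)}_{8n+1,8n+1,(1,1)}(x,y,\tau)}{\vartheta^{(1)}\begin{bmatrix}\frac12\\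 \frac12\end{bmatrix}\Big(\sum_{i=1}^{8n+1}(x_i-y_i),\tau\Big)}\;\det {\bf Q}_{8n+1}(\tau).$$
   Context: Here $\tau$ is in the upper half plane, $q=e^{2\pi i\tau}$, $q_z=e^z$, and $\eta(\tau)=q^{1/24}\prod_{m\ge1}(1-q^m)$ is the Dedekind eta function. Theta series with characteristics $a,b$: $$\vartheta^{(1)}\begin{bmatrix}a\\ b\end{bmatrix}(z,\tau)=\sum_{m\in\mathbb Z}\exp\big(i\pi(m+a)^2\tau+(m+a)(z+2\pi i b)\big).$$ Let $\lambda\in[0,1)$ be given by $\phi=e^{2\pi i\lambda}$. The Bernoulli polynomials $B_m(\lambda)$ are defined by $\frac{q_z^{\lambda}}{q_z-1}=\frac1z+\sum_{m\ge1}\frac{B_m(\lambda)}{m!}z^{m-1}$. The deformed Eisenstein series are, for $m\ge1$, $$E^{(1)}_m\begin{bmatrix}\theta\\ \phi\end{bmatrix}(\tau)=-\frac{B_m(\lambda)}{m!}+\frac{1}{(m-1)!}{\sum_{r\ge0}}'\frac{(r+\lambda)^{m-1}\theta^{-1}q^{r+\lambda}}{1-\theta^{-1}q^{r+\lambda}}+\frac{(-1)^m}{(m-1)!}\sum_{r\ge1}\frac{(r-\lambda)^{m-1}\theta q^{r-\lambda}}{1-\theta q^{r-\lambda}},$$ and the deformed Weierstrass function is $$P^{(1)}_1\begin{bmatrix}\theta\\ \phi\end{bmatrix}(z,\tau)=-{\sum_{m\in\mathbb Z+\lambda}}'\frac{q_z^m}{1-\theta^{-1}q^m}=\frac1z-\sum_{m\ge1}\frac1m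 E^{(1)}_m\begin{bmatrix}\theta\\ \phi\end{bmatrix}(\tau)\,z^{m-1}.$$ The prime on a sum means that the zero index ($r=0$, respectively $m=0$) is omitted if $(\theta,\phi)=(1,1)$. For a positive integer $N$ (the case where both groups consist of $N$ variables and all multiplicities are $1$), $$\Theta^{(1)}_{N,N,(1,1)}(x,y,\tau)=\frac{\prod_{1\le i,j\le N}\vartheta^{(1)}\begin{bmatrix}\frac12\\ \frac12\end{bmatrix}(x_i-y_j,\tau)}{\prod_{1\le i<k\le N}\vartheta^{(1)}\begin{bmatrix}\frac12\\ \frac12\end{bmatrix}(x_i-x_k,\tau)\;\prod_{1\le j<l\le N}\vartheta^{(1)}\begin{bmatrix}\frac12\\ \frac12\end{bmatrix}(y_j-y_l,\tau)}.$$ ${\bf P}_N(\theta,\phi)$ is the $N\times N$ matrix with $(i,j)$ entry $P^{(1)}_1\begin{bmatrix}\theta\\ \phi\end{bmatrix}(x_i-y_j,\tau)$. ${\bf Q}_N={\bf Q}_N(\tau)$ is the $(N+1)\times(N+1)$ matrix $${\bf Q}_N(\tau)=\begin{bmatrix}{\bf P}_N(1,1)&{\bf 1}\\ {\bf 1}^t&0\end{bmatrix},$$ where ${\bf 1}$ is the column vector of length $N$ with all entries $1$.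
   Formalization: In (i),(ii) the numerator ϑ[1/2;1/2](0,τ), which is 0, becomes ϑ[1/2−β;1/2+α](0,τ) and the minus sign is dropped; in (ii) the factor 1/k is dropped; in (iii) i becomes −1; stated where all terms are defined, in (ii) with |x_i−y_j| below every nonzero period. *)

theory Defs
  imports
    "HOL-Complex_Analysis.Complex_Analysis"
    "Jordan_Normal_Form.Determinant"
begin

definition dedekind_eta :: "complex \<Rightarrow> complex" where
  "dedekind_eta \<tau> =
     exp (2 * of_real pi * \<i> * \<tau> / 24) *
     prodinf (\<lambda>m::nat. 1 - exp (2 * of_real pi * \<i> * \<tau>) ^ (m + 1))"

definition theta_char :: "real \<Rightarrow> real \<Rightarrow> complex \<Rightarrow> complex \<Rightarrow> complex" where
  "theta_char a b z \<tau> =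
     (\<Sum>\<^sub>\<infinity>m::int.
        exp (\<i> * of_real pi * (of_int m + of_real a)\<^sup>2 * \<tau> +
             (of_int m + of_real a) * (z + 2 * of_real pi * \<i> * of_real b)))"

text \<open>For a complex number of modulus one, its normalised argument in $[0,1)$.\<close>

definition char_exponent :: "complex \<Rightarrow> real" where
  "char_exponent \<phi> =
     (THE l. 0 \<le> l \<and> l < 1 \<and> \<phi> = exp (2 * of_real pi * \<i> * of_real l))"

text \<open>
  The coefficient of $z^{m-1}$ in the Laurent expansion of $e^{tz}/(e^z-1)$ at $0$ is
  $B_m(t)/m!$.
\<close>

definition bernoulli_poly :: "nat \<Rightarrow> complex \<Rightarrow> complex" where
  "bernoulli_poly m t =
     fact m * fls_nth (fps_to_fls (fps_exp t) / (fps_to_fls (fps_exp 1) - 1)) (int m - 1)"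

text \<open>
  In the next definition $r = 0$ and $m = 1$ with vanishing exponent gives the factor
  $0^0 = 1$, as the Laurent expansion of the Weierstrass function requires.
\<close>

definition deformed_eisenstein :: "nat \<Rightarrow> complex \<Rightarrow> complex \<Rightarrow> complex \<Rightarrow> complex" where
  "deformed_eisenstein m \<theta> \<phi> \<tau> =
    (let l = char_exponent \<phi>; q = (\<lambda>s::real. exp (2 * of_real pi * \<i> * \<tau> * of_real s)) in
       - bernoulli_poly m (of_real l) / fact m
       + 1 / fact (m - 1) *
         (\<Sum>\<^sub>\<infinity>r \<in> {0::nat..} - (if (\<theta>, \<phi>) = (1, 1) then {0} else {}).
            of_real ((real r + l) ^ (m - 1)) * inverse \<theta> * q (real r + l) /
              (1 - inverse \<theta> * q (real r + l)))
       + (- 1) ^ m / fact (m - 1) *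
         (\<Sum>\<^sub>\<infinity>r \<in> {1::nat..}.
            of_real ((real r - l) ^ (m - 1)) * \<theta> * q (real r - l) /
              (1 - \<theta> * q (real r - l))))"

definition deformed_P1_series :: "complex \<Rightarrow> complex \<Rightarrow> complex \<Rightarrow> complex \<Rightarrow> complex" where
  "deformed_P1_series \<theta> \<phi> \<tau> z =
     - (\<Sum>\<^sub>\<infinity>m \<in> {real_of_int k + char_exponent \<phi> | k. True} -
                 (if (\<theta>, \<phi>) = (1, 1) then {0} else {}).
          exp (of_real m * z) /
            (1 - inverse \<theta> * exp (2 * of_real pi * \<i> * \<tau> * of_real m)))"

text \<open>
  This series converges exactly for $|q| < |e^z| < 1$; the function it defines
  is meromorphic on the whole plane after continuation, and the following is that
  continuation.  Agreement on the strip and the normalisation of the values at poles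
  built into \<^const>\<open>nicely_meromorphic_on\<close> determine it uniquely.
\<close>

definition deformed_P1 :: "complex \<Rightarrow> complex \<Rightarrow> complex \<Rightarrow> complex \<Rightarrow> complex" where
  "deformed_P1 \<theta> \<phi> \<tau> =
     (THE f. f nicely_meromorphic_on UNIV \<and>
        (\<forall>z. norm (exp (2 * of_real pi * \<i> * \<tau>)) < norm (exp z) \<and> norm (exp z) < 1
              \<longrightarrow> f z = deformed_P1_series \<theta> \<phi> \<tau> z))"

definition period_lattice :: "complex \<Rightarrow> complex set" where
  "period_lattice \<tau> = {2 * of_real pi * \<i> * (of_int m + of_int n * \<tau>) | m n :: int. True}"

text \<open>Families of $N$ variables are functions on \<^typ>\<open>nat\<close>, used at the indices $0,\dots,N-1$.\<close>

definition big_theta :: "nat \<Rightarrow> (nat \<Rightarrow> complex) \<Rightarrow> (nat \<Rightarrow> complex) \<Rightarrow> complex \<Rightarrow> complex" where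
  "big_theta N x y \<tau> =
     (\<Prod>i<N. \<Prod>j<N. theta_char (1/2) (1/2) (x i - y j) \<tau>) /
     ((\<Prod>i<N. \<Prod>k\<in>{i<..<N}. theta_char (1/2) (1/2) (x i - x k) \<tau>) *
      (\<Prod>j<N. \<Prod>l\<in>{j<..<N}. theta_char (1/2) (1/2) (y j - y l) \<tau>))"

text \<open>
  No denominator of \<^const>\<open>big_theta\<close> vanishes and no $x_i - y_j$ is a pole of
  \<^const>\<open>deformed_P1\<close>.
\<close>

definition generic_points :: "nat \<Rightarrow> (nat \<Rightarrow> complex) \<Rightarrow> (nat \<Rightarrow> complex) \<Rightarrow> complex \<Rightarrow> bool" where
  "generic_points N x y \<tau> \<longleftrightarrow>
     (\<forall>i<N. \<forall>k\<in>{i<..<N}. theta_char (1/2) (1/2) (x i - x k) \<tau> \<noteq> 0) \<and>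
     (\<forall>j<N. \<forall>l\<in>{j<..<N}. theta_char (1/2) (1/2) (y j - y l) \<tau> \<noteq> 0) \<and>
     (\<forall>i<N. \<forall>j<N. x i - y j \<notin> period_lattice \<tau>)"

definition P_matrix ::
  "nat \<Rightarrow> complex \<Rightarrow> complex \<Rightarrow> (nat \<Rightarrow> complex) \<Rightarrow> (nat \<Rightarrow> complex) \<Rightarrow> complex \<Rightarrow> complex mat" where
  "P_matrix N \<theta> \<phi> x y \<tau> = Matrix.mat N N (\<lambda>(i, j). deformed_P1 \<theta> \<phi> \<tau> (x i - y j))"

definition Q_matrix ::
  "nat \<Rightarrow> (nat \<Rightarrow> complex) \<Rightarrow> (nat \<Rightarrow> complex) \<Rightarrow> complex \<Rightarrow> complex mat" where
  "Q_matrix N x y \<tau> =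
     four_block_mat (P_matrix N 1 1 x y \<tau>) (Matrix.mat N 1 (\<lambda>_. 1))
                    (Matrix.mat 1 N (\<lambda>_. 1)) (0\<^sub>m 1 1)"

end

theory Submission
  imports Defs
begin

text \<open>
  Write \<open>s(z)\<close> for the odd theta function with characteristics \<open>1/2, 1/2\<close>.  Everything follows from two
  facts about \<open>s\<close> and two facts that express \<open>P\<^sub>1\<close> through \<open>s\<close>.

  The first fact is that \<open>s(u + v) s(u - v)\<close> is a two-by-two minor \<open>E(u) U(v) - U(u) E(v)\<close>: in the double
  series the summation indices can be replaced by their sum and difference, which decouple up to parity
  (\<open>theta_odd_product_formula\<close>).  The Pluecker relation between minors then gives Weierstrass' three-term
  identity, and the three-term identity says exactly that one Gaussian elimination step turns the matrix with
  entries \<open>s(x\<^sub>i - y\<^sub>j + t) / s(x\<^sub>i - y\<^sub>j)\<close> into a smaller matrix of the same kind with another \<open>t\<close>.  Hence the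
  determinant formula of Frobenius (\<open>frobenius_determinant\<close>), and, letting \<open>t\<close> tend to \<open>0\<close>, its degenerate
  version for the bordered matrix of logarithmic derivatives (\<open>frobenius_determinant_bordered\<close>).

  The second fact is Jacobi's triple product, obtained from the finite \<open>q\<close>-binomial theorem by dominated
  convergence.  It shows that \<open>s\<close> vanishes only on the period lattice and that \<open>s'(0) = i \<eta>\<^sup>3\<close>
  (\<open>theta_odd_deriv_0\<close>).  This is where the eta function enters: the determinants carry the factor
  \<open>s'(0)\<close> to the power \<open>8n\<close>, which is \<open>\<eta>\<close> to the power \<open>24n\<close>, and all signs are trivial because of the factor 8.

  For \<open>(\<theta>, \<phi>) \<noteq> (1, 1)\<close>, Kronecker's formula states that \<open>P\<^sub>1(z)\<close> is \<open>exp(\<lambda> z) s(z + t) / s(z)\<close> up to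
  a constant factor, where \<open>t\<close> encodes \<open>\<theta>\<close> and \<open>\<phi>\<close>; for \<open>(\<theta>, \<phi>) = (1, 1)\<close> it is \<open>s'(z) / s(z)\<close> up to
  an additive constant.  In both cases the defining series is multiplied by the series of \<open>s\<close> in the strip of
  convergence: the coefficients of the product satisfy a first-order recursion that identifies them
  (\<open>kronecker_coeff_step\<close>).  Inserting this into the two determinant formulas proves (i) and (iii).

  For (ii), the terms of the series for \<open>P\<^sub>1\<close> are regrouped as the generating function of the Bernoulli
  polynomials plus two Lambert series.  The Taylor coefficients of the latter are the sums in the Eisenstein
  series, and the resulting expansion is valid up to the nearest nonzero period (\<open>deformed_P1_power_series\<close>).
\<close>

section \<open>Determinants\<close>

lemma det_scale_rows_cols:
  fixes a :: "nat \<Rightarrow> nat \<Rightarrow> 'a :: comm_ring_1"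
  shows "Determinant.det (Matrix.mat N N (\<lambda>(i, j). r i * c j * a i j)) =
         (\<Prod>i<N. r i) * (\<Prod>j<N. c j) * Determinant.det (Matrix.mat N N (\<lambda>(i, j). a i j))"
proof -
  have "(\<Prod>i = 0..<N. Matrix.mat N N (\<lambda>(i, j). r i * c j * a i j) $$ (i, p i)) =
        (\<Prod>i<N. r i) * (\<Prod>j<N. c j) * (\<Prod>i = 0..<N. Matrix.mat N N (\<lambda>(i, j). a i j) $$ (i, p i))"
    if p: "p permutes {0..<N}" for p
  proof -
    have lt: "p i < N" if "i < N" for i
      using permutes_in_image[OF p, of i] that by auto
    have "(\<Prod>i = 0..<N. Matrix.mat N N (\<lambda>(i, j). r i * c j * a i j) $$ (i, p i)) =
          (\<Prod>i = 0..<N. r i * c (p i) * a i (p i))"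
      by (intro prod.cong) (auto simp: lt)
    also have "\<dots> = (\<Prod>i = 0..<N. r i) * (\<Prod>i = 0..<N. c (p i)) * (\<Prod>i = 0..<N. a i (p i))"
      by (simp add: prod.distrib)
    also have "(\<Prod>i = 0..<N. c (p i)) = (\<Prod>i = 0..<N. c i)"
      using prod.permute[OF p, of c] by (simp add: o_def)
    also have "(\<Prod>i = 0..<N. a i (p i)) = (\<Prod>i = 0..<N. Matrix.mat N N (\<lambda>(i, j). a i j) $$ (i, p i))"
      by (intro prod.cong) (auto simp: lt)
    finally show ?thesis by (simp add: atLeast0LessThan)
  qed
  hence "(\<Sum>p | p permutes {0..<N}. signof p *
            (\<Prod>i = 0..<N. Matrix.mat N N (\<lambda>(i, j). r i * c j * a i j) $$ (i, p i))) =
         (\<Sum>p | p permutes {0..<N}. (\<Prod>i<N. r i) * (\<Prod>j<N. c j) * (signof p *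
            (\<Prod>i = 0..<N. Matrix.mat N N (\<lambda>(i, j). a i j) $$ (i, p i))))"
    by (intro sum.cong) (auto simp: mult_ac)
  thus ?thesis
    by (simp add: det_def'[of _ N] sum_distrib_left)
qed

lemma tendsto_det:
  fixes A :: "'b \<Rightarrow> complex mat"
  assumes "\<And>t. A t \<in> carrier_mat N N" "L \<in> carrier_mat N N"
    and "\<And>i j. i < N \<Longrightarrow> j < N \<Longrightarrow> ((\<lambda>t. A t $$ (i, j)) \<longlongrightarrow> L $$ (i, j)) F"
  shows "((\<lambda>t. Determinant.det (A t)) \<longlongrightarrow> Determinant.det L) F"
proof -
  have "((\<lambda>t. \<Sum>p | p permutes {0..<N}. signof p * (\<Prod>i = 0..<N. A t $$ (i, p i)))
          \<longlongrightarrow> (\<Sum>p | p permutes {0..<N}. signof p * (\<Prod>i = 0..<N. L $$ (i, p i)))) F"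
  proof (intro tendsto_sum tendsto_mult tendsto_const tendsto_prod assms(3))
    fix p i assume "p \<in> {p. p permutes {0..<N}}" "i \<in> {0..<N}"
    thus "i < N" "p i < N"
      using permutes_in_image[of p "{0..<N}" i] by auto
  qed
  thus ?thesis
    using assms(1,2) by (simp add: det_def'[of _ N])
qed

text \<open>
  Eliminating the last row factors the matrix into an upper and a unipotent lower block triangular one; the
  former has the Schur complement of the last entry as its first block.
\<close>
lemma det_pivot_last:
  fixes A :: "'a :: field mat"
  assumes A: "A \<in> carrier_mat (Suc N) (Suc N)" and d: "A $$ (N, N) \<noteq> 0"
  shows "Determinant.det A = A $$ (N, N) * Determinant.det
           (Matrix.mat N N (\<lambda>(i, j). A $$ (i, j) - A $$ (i, N) * A $$ (N, j) / A $$ (N, N)))"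
proof -
  define S where "S = Matrix.mat N N (\<lambda>(i, j). A $$ (i, j) - A $$ (i, N) * A $$ (N, j) / A $$ (N, N))"
  define B where "B = Matrix.mat N 1 (\<lambda>(i, _). A $$ (i, N))"
  define D where "D = Matrix.mat 1 1 (\<lambda>_. A $$ (N, N))"
  define U where "U = Matrix.mat 1 N (\<lambda>(_, j). A $$ (N, j) / A $$ (N, N))"
  have carr: "S \<in> carrier_mat N N" "B \<in> carrier_mat N 1" "D \<in> carrier_mat 1 1" "U \<in> carrier_mat 1 N"
    by (auto simp: S_def B_def D_def U_def)
  have eq: "A = four_block_mat S B (0\<^sub>m 1 N) D * four_block_mat (1\<^sub>m N) (0\<^sub>m N 1) U (1\<^sub>m 1)"
  proof -
    have "four_block_mat S B (0\<^sub>m 1 N) D * four_block_mat (1\<^sub>m N) (0\<^sub>m N 1) U (1\<^sub>m 1) =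
      four_block_mat (S * 1\<^sub>m N + B * U) (S * 0\<^sub>m N 1 + B * 1\<^sub>m 1)
        (0\<^sub>m 1 N * 1\<^sub>m N + D * U) (0\<^sub>m 1 N * 0\<^sub>m N 1 + D * 1\<^sub>m 1)"
      by (rule mult_four_block_mat) (use carr in auto)
    also have "\<dots> = four_block_mat (S + B * U) B (D * U) D"
      using carr by simp
    also have "\<dots> = A"
    proof (rule eq_matI)
      fix i j assume ij: "i < dim_row A" "j < dim_col A"
      consider "i < N" "j < N" | "i < N" "j = N" | "i = N" "j < N" | "i = N" "j = N"
        using ij A by force
      thus "four_block_mat (S + B * U) B (D * U) D $$ (i, j) = A $$ (i, j)"
        using ij A carr d
        by cases (auto simp: S_def B_def D_def U_def scalar_prod_def)
    qed (use A carr in auto)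
    finally show ?thesis by simp
  qed
  have "Determinant.det A = Determinant.det (four_block_mat S B (0\<^sub>m 1 N) D) *
          Determinant.det (four_block_mat (1\<^sub>m N) (0\<^sub>m N 1) U (1\<^sub>m 1))"
    using carr by (subst eq, subst det_mult[of _ "N + 1"]) auto
  also have "Determinant.det (four_block_mat S B (0\<^sub>m 1 N) D) = Determinant.det S * Determinant.det D"
    using carr by (intro det_four_block_mat_lower_left_zero) auto
  also have "Determinant.det (four_block_mat (1\<^sub>m N) (0\<^sub>m N 1) U (1\<^sub>m 1)) =
      Determinant.det (1\<^sub>m N :: 'a mat) * Determinant.det (1\<^sub>m 1 :: 'a mat)"
    using carr by (intro det_four_block_mat_upper_right_zero) auto
  also have "Determinant.det D = A $$ (N, N)"
    using carr by (subst det_single) (auto simp: D_def)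
  finally show ?thesis
    by (simp add: S_def)
qed

section \<open>Frobenius' determinant formula\<close>

text \<open>
  The six products are the six minors of a two-by-four matrix with columns \<open>(E(p\<^sub>k), U(p\<^sub>k))\<close>, and the
  claim is the Pluecker relation between them.
\<close>
lemma three_term_identity:
  fixes s E U :: "complex \<Rightarrow> complex"
  assumes prod: "\<And>u v. s (u + v) * s (u - v) = E u * U v - U u * E v"
  shows "s (x - y + t) * s (x' - y' + t) * (s (x - y') * s (x' - y)) -
         s (x - y' + t) * s (x' - y + t) * (s (x - y) * s (x' - y')) =
         s t * s (t + (x - y) + (x' - y')) * (s (x - x') * s (y' - y))"
proof -
  \<comment> \<open>the four points are chosen so that each argument of s in the claim is a sum or difference of two of them\<close>
  define p0 where "p0 = ((x - y) + (x' - y')) / 2 + t"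
  define p1 where "p1 = ((x - y) - (x' - y')) / 2"
  define p2 where "p2 = ((x - y) + (x' - y')) / 2"
  define p3 where "p3 = ((x - y') - (x' - y)) / 2"
  have eqs: "x - y + t = p0 + p1" "x' - y' + t = p0 - p1" "x - y' = p2 + p3" "x' - y = p2 - p3"
     "x - y' + t = p0 + p3" "x' - y + t = p0 - p3" "x - y = p2 + p1" "x' - y' = p2 - p1"
     "t = p0 - p2" "t + (x - y) + (x' - y') = p0 + p2" "x - x' = p1 + p3" "y' - y = p1 - p3"
    by (simp_all add: p0_def p1_def p2_def p3_def field_simps)
  have 1: "s (x - y + t) * s (x' - y' + t) = E p0 * U p1 - U p0 * E p1"
    unfolding eqs(1,2) by (rule prod)
  have 2: "s (x - y') * s (x' - y) = E p2 * U p3 - U p2 * E p3"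
    unfolding eqs(3,4) by (rule prod)
  have 3: "s (x - y' + t) * s (x' - y + t) = E p0 * U p3 - U p0 * E p3"
    unfolding eqs(5,6) by (rule prod)
  have 4: "s (x - y) * s (x' - y') = E p2 * U p1 - U p2 * E p1"
    unfolding eqs(7,8) by (rule prod)
  have 5: "s t * s (t + (x - y) + (x' - y')) = E p0 * U p2 - U p0 * E p2"
    using prod[of p0 p2] unfolding eqs(9)[symmetric] eqs(10)[symmetric] by (simp add: mult.commute)
  have 6: "s (x - x') * s (y' - y) = E p1 * U p3 - U p1 * E p3"
    unfolding eqs(11,12) by (rule prod)
  show ?thesis
    unfolding 1 2 3 4 5 6 by (simp add: algebra_simps)
qed

lemma prod_triangle_Suc:
  fixes f :: "nat \<Rightarrow> nat \<Rightarrow> 'a :: comm_monoid_mult"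
  shows "(\<Prod>i<Suc N. \<Prod>k\<in>{i<..<Suc N}. f i k) = (\<Prod>i<N. \<Prod>k\<in>{i<..<N}. f i k) * (\<Prod>i<N. f i N)"
proof -
  have "(\<Prod>k\<in>{i<..<Suc N}. f i k) = (\<Prod>k\<in>{i<..<N}. f i k) * f i N" if "i < N" for i
  proof -
    have "{i<..<Suc N} = insert N {i<..<N}" using that by auto
    thus ?thesis by (simp add: mult.commute)
  qed
  moreover have "{N<..<Suc N} = {}" by auto
  ultimately show ?thesis
    by (simp add: prod.distrib)
qed

text \<open>
  The differences of the \<open>y\<close> are taken in the order opposite to those of the \<open>x\<close>; with this choice
  Frobenius' formula has no sign.
\<close>
definition cauchy_factor :: "(complex \<Rightarrow> complex) \<Rightarrow> nat \<Rightarrow> (nat \<Rightarrow> complex) \<Rightarrow> (nat \<Rightarrow> complex) \<Rightarrow> complex" where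
  "cauchy_factor s N x y =
     (\<Prod>i<N. \<Prod>k\<in>{i<..<N}. s (x i - x k) * s (y k - y i)) / (\<Prod>i<N. \<Prod>j<N. s (x i - y j))"

lemma cauchy_factor_Suc:
  "cauchy_factor s (Suc N) x y = cauchy_factor s N x y *
     (\<Prod>i<N. s (x i - x N) / s (x i - y N)) * (\<Prod>j<N. s (y N - y j) / s (x N - y j)) / s (x N - y N)"
  unfolding cauchy_factor_def prod_triangle_Suc
  by (simp add: prod.distrib prod_dividef mult_ac)

text \<open>
  Pivoting on the last entry leaves, by the three-term identity, a matrix of the same shape in which \<open>t\<close> is
  replaced by \<open>t + x\<^sub>N - y\<^sub>N\<close>, up to factors depending only on the row or only on the column.  The pivot
  can vanish, but only for isolated values of \<open>t\<close>, and both sides are continuous in \<open>t\<close>.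
\<close>
lemma frobenius_determinant:
  fixes s :: "complex \<Rightarrow> complex"
  assumes three_term: "\<And>x y x' y' t. s (x - y + t) * s (x' - y' + t) * (s (x - y') * s (x' - y)) -
         s (x - y' + t) * s (x' - y + t) * (s (x - y) * s (x' - y')) =
         s t * s (t + (x - y) + (x' - y')) * (s (x - x') * s (y' - y))"
    and cont: "\<And>z. isCont s z"
    and isolated: "\<And>z. eventually (\<lambda>w. s w \<noteq> 0) (at z)"
    and nonzero: "\<And>i j. i \<le> N \<Longrightarrow> j \<le> N \<Longrightarrow> s (x i - y j) \<noteq> 0"
  shows "Determinant.det (Matrix.mat (Suc N) (Suc N) (\<lambda>(i, j). s (x i - y j + t) / s (x i - y j))) =
         s t ^ N * s (t + (\<Sum>i<Suc N. x i - y i)) * cauchy_factor s (Suc N) x y"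
  using nonzero
proof (induction N arbitrary: t)
  case 0
  thus ?case
    by (subst det_single) (auto simp: cauchy_factor_def add_ac)
next
  case (Suc M)
  define N where "N = Suc M"
  define a where "a = (\<lambda>t i j. s (x i - y j + t) / s (x i - y j))"
  define S where "S = (\<Sum>i<N. x i - y i)"
  have nz: "s (x i - y j) \<noteq> 0" if "i \<le> N" "j \<le> N" for i j
    using Suc.prems that by (auto simp: N_def)
  have IH: "Determinant.det (Matrix.mat N N (\<lambda>(i, j). a t i j)) = s t ^ M * s (t + S) * cauchy_factor s N x y" for t
    unfolding N_def a_def S_def using Suc.IH Suc.prems by simp
  define lhs where "lhs = (\<lambda>t. Determinant.det (Matrix.mat (Suc N) (Suc N) (\<lambda>(i, j). a t i j)))"
  define rhs where "rhs = (\<lambda>t. s t ^ N * s (t + (\<Sum>i<Suc N. x i - y i)) * cauchy_factor s (Suc N) x y)"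
  \<comment> \<open>pivoting on the last entry turns the matrix with parameter t into the smaller one with parameter t'\<close>
  have generic: "lhs t = rhs t" if t': "s (t + (x N - y N)) \<noteq> 0" for t
  proof -
    define t' where "t' = t + (x N - y N)"
    define r where "r = (\<lambda>i. s t / s t' * (s (x i - x N) / s (x i - y N)))"
    define c where "c = (\<lambda>j. s (y N - y j) / s (x N - y j))"
    have st': "s t' \<noteq> 0" using t' by (simp add: t'_def)
    have pivot: "a t N N \<noteq> 0"
      using t' nz[of N N] by (simp add: a_def add.commute)
    have schur: "a t i j - a t i N * a t N j / a t N N = r i * c j * a t' i j" if ij: "i < N" "j < N" for i j
    proof -
      have n: "s (x i - y j) \<noteq> 0" "s (x i - y N) \<noteq> 0" "s (x N - y j) \<noteq> 0" "s (x N - y N) \<noteq> 0"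
        using ij by (auto simp: nz)
      have t'': "x N - y N + t = t'" by (simp add: t'_def)
      have arg: "t + (x i - y j) + (x N - y N) = x i - y j + t'" by (simp add: t'_def)
      have "s (x i - y j + t) * s t' * (s (x i - y N) * s (x N - y j)) -
         s (x i - y N + t) * s (x N - y j + t) * (s (x i - y j) * s (x N - y N)) =
         s t * s (x i - y j + t') * (s (x i - x N) * s (y N - y j))"
        using three_term[of "x i" "y j" t "x N" "y N"] unfolding t'' arg .
      thus ?thesis
        unfolding a_def r_def c_def t'' using n st' by (simp add: field_simps)
    qed
    have "lhs t = a t N N * Determinant.det (Matrix.mat N N (\<lambda>(i, j). a t i j - a t i N * a t N j / a t N N))"
      unfolding lhs_def using pivot
      by (subst det_pivot_last[of _ N]) (auto intro!: arg_cong[of _ _ Determinant.det] eq_matI)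
    also have "Matrix.mat N N (\<lambda>(i, j). a t i j - a t i N * a t N j / a t N N) =
               Matrix.mat N N (\<lambda>(i, j). r i * c j * a t' i j)"
      by (rule eq_matI) (auto simp: schur)
    also have "Determinant.det \<dots> = (\<Prod>i<N. r i) * (\<Prod>j<N. c j) * (s t' ^ M * s (t' + S) * cauchy_factor s N x y)"
      unfolding det_scale_rows_cols IH ..
    also have "(\<Prod>i<N. r i) = (s t / s t') ^ N * (\<Prod>i<N. s (x i - x N) / s (x i - y N))"
      unfolding r_def prod.distrib by simp
    also have "a t N N * ((s t / s t') ^ N * (\<Prod>i<N. s (x i - x N) / s (x i - y N)) * (\<Prod>j<N. c j) *
        (s t' ^ M * s (t' + S) * cauchy_factor s N x y)) = 
        s t ^ N * s (t' + S) * cauchy_factor s (Suc N) x y"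
    proof -
      have "a t N N * (s t / s t') ^ N * s t' ^ M = s t ^ N / s (x N - y N)"
        using st' by (simp add: a_def N_def t'_def power_divide add.commute field_simps)
      moreover have "a t N N * ((s t / s t') ^ N * (\<Prod>i<N. s (x i - x N) / s (x i - y N)) * (\<Prod>j<N. c j) *
            (s t' ^ M * s (t' + S) * cauchy_factor s N x y)) = (a t N N * (s t / s t') ^ N * s t' ^ M) *
            ((\<Prod>i<N. s (x i - x N) / s (x i - y N)) * (\<Prod>j<N. c j) * (s (t' + S) * cauchy_factor s N x y))"
        by (simp only: mult_ac)
      ultimately have "a t N N * ((s t / s t') ^ N * (\<Prod>i<N. s (x i - x N) / s (x i - y N)) * (\<Prod>j<N. c j) *
            (s t' ^ M * s (t' + S) * cauchy_factor s N x y)) =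
          s t ^ N / s (x N - y N) * ((\<Prod>i<N. s (x i - x N) / s (x i - y N)) * (\<Prod>j<N. c j) *
            (s (t' + S) * cauchy_factor s N x y))"
        by (simp only:)
      also have "\<dots> = s t ^ N * s (t' + S) * cauchy_factor s (Suc N) x y"
        unfolding cauchy_factor_Suc c_def by (simp only: divide_inverse mult_ac)
      finally show ?thesis .
    qed
    also have "t' + S = t + (\<Sum>i<Suc N. x i - y i)"
      by (simp add: t'_def S_def)
    finally show ?thesis by (simp add: rhs_def)
  qed
  have cont': "((\<lambda>t. s (c + t)) \<longlongrightarrow> s (c + t0)) (at t0)" for c t0
    by (rule isCont_tendsto_compose[OF cont]) (intro tendsto_intros)
  have "lhs \<midarrow>t\<rightarrow> lhs t"
    unfolding lhs_def a_def
    by (rule tendsto_det[of _ "Suc N"]) (auto intro!: tendsto_intros cont' simp: nz less_Suc_eq_le)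
  moreover have "rhs \<midarrow>t\<rightarrow> rhs t"
    unfolding rhs_def using cont[of t] cont'[of "\<Sum>i<Suc N. x i - y i" t]
    by (intro tendsto_intros) (auto simp: isCont_def add.commute)
  moreover have "eventually (\<lambda>u. lhs u = rhs u) (at t)"
  proof -
    have "filterlim (\<lambda>u. u + (x N - y N)) (at (t + (x N - y N))) (at t)"
      by (rule filterlim_atI) (auto intro!: tendsto_intros simp: eventually_at_filter)
    hence "eventually (\<lambda>u. s (u + (x N - y N)) \<noteq> 0) (at t)"
      using isolated[of "t + (x N - y N)"] by (auto simp: filterlim_iff)
    thus ?thesis by eventually_elim (rule generic)
  qed
  ultimately have "lhs t = rhs t"
    using LIM_unique[of rhs "lhs t" t "rhs t"] tendsto_cong[of lhs rhs "at t"] by simp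
  thus ?case by (simp add: lhs_def rhs_def a_def N_def)
qed

text \<open>
  Eliminating the corner \<open>d\<close> of a matrix bordered by ones subtracts \<open>1/d\<close> from every entry.  So the matrix of
  Frobenius' formula, with parameter \<open>t\<close>, is the Schur complement of a bordered matrix whose corner is of the order
  of \<open>s t\<close>.  As \<open>t\<close> tends to \<open>0\<close>, its entries tend to logarithmic derivatives and its corner tends to \<open>0\<close>.
  An additive constant \<open>c\<close> in the entries is absorbed by the corner, which still tends to \<open>0\<close>.
\<close>
lemma frobenius_determinant_bordered:
  fixes s D :: "complex \<Rightarrow> complex"
  assumes three_term: "\<And>x y x' y' t. s (x - y + t) * s (x' - y' + t) * (s (x - y') * s (x' - y)) -
         s (x - y' + t) * s (x' - y + t) * (s (x - y) * s (x' - y')) =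
         s t * s (t + (x - y) + (x' - y')) * (s (x - x') * s (y' - y))"
    and deriv: "\<And>z. (s has_field_derivative D z) (at z)"
    and s0: "s 0 = 0" and D0: "D 0 \<noteq> 0"
    and isolated: "\<And>z. eventually (\<lambda>w. s w \<noteq> 0) (at z)"
    and nonzero: "\<And>i j. i \<le> N \<Longrightarrow> j \<le> N \<Longrightarrow> s (x i - y j) \<noteq> 0"
  shows "Determinant.det (four_block_mat
           (Matrix.mat (Suc N) (Suc N) (\<lambda>(i, j). D (x i - y j) / s (x i - y j) + c))
           (Matrix.mat (Suc N) 1 (\<lambda>_. 1)) (Matrix.mat 1 (Suc N) (\<lambda>_. 1)) (0\<^sub>m 1 1)) =
         - (D 0 ^ N * s (\<Sum>i<Suc N. x i - y i) * cauchy_factor s (Suc N) x y)"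
proof -
  define M where "M = Suc N"
  have cont: "isCont s z" for z
    using deriv by (rule DERIV_isCont)
  \<comment> \<open>the corner for which subtracting 1 / d from every z t i j leaves D 0 / s t times the Frobenius matrix\<close>
  define d where "d = (\<lambda>t. s t / (c * s t - D 0))"
  define z where "z = (\<lambda>t i j. D 0 / s t * ((s (x i - y j + t) - s (x i - y j)) / s (x i - y j)) + c)"
  define Q where "Q = (\<lambda>(u :: nat \<Rightarrow> nat \<Rightarrow> complex) e. Matrix.mat (Suc M) (Suc M) (\<lambda>(i, j).
     if i < M \<and> j < M then u i j else if i < M \<or> j < M then 1 else e))"
  have Q_carrier: "Q u e \<in> carrier_mat (Suc M) (Suc M)" for u e
    by (simp add: Q_def)
  define R where "R = s (\<Sum>i<M. x i - y i) * cauchy_factor s M x y"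
  have lim_s: "s \<midarrow>0\<rightarrow> 0"
    using cont[of 0] s0 by (simp add: isCont_def)
  have lim_d: "d \<midarrow>0\<rightarrow> 0"
    unfolding d_def using D0 by (auto intro!: tendsto_eq_intros lim_s)
  have lim_z: "(\<lambda>t. z t i j) \<midarrow>0\<rightarrow> D (x i - y j) / s (x i - y j) + c" if "i < M" "j < M" for i j
  proof -
    have "(\<lambda>t. (s (x i - y j + t) - s (x i - y j)) / t) \<midarrow>0\<rightarrow> D (x i - y j)"
      using deriv[of "x i - y j"] by (simp add: DERIV_def)
    moreover have "(\<lambda>t. s t / t) \<midarrow>0\<rightarrow> D 0"
      using deriv[of 0] s0 by (simp add: DERIV_def)
    ultimately have "(\<lambda>t. D 0 / (s t / t) * ((s (x i - y j + t) - s (x i - y j)) / t / s (x i - y j)) + c)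
        \<midarrow>0\<rightarrow> D 0 / D 0 * (D (x i - y j) / s (x i - y j)) + c"
      using nonzero[of i j] that D0 by (intro tendsto_intros) (auto simp: M_def)
    moreover have "eventually (\<lambda>t. D 0 / (s t / t) * ((s (x i - y j + t) - s (x i - y j)) / t / s (x i - y j)) + c = z t i j) (at 0)"
      unfolding eventually_at_filter by (auto simp: z_def intro!: always_eventually)
    ultimately show ?thesis
      using D0 by (simp add: tendsto_cong)
  qed
  have lim_det: "(\<lambda>t. Determinant.det (Q (z t) (d t))) \<midarrow>0\<rightarrow>
        Determinant.det (Q (\<lambda>i j. D (x i - y j) / s (x i - y j) + c) 0)"
    by (rule tendsto_det[of _ "Suc M"]) (auto simp: Q_def intro!: lim_z lim_d)
  have lim_rhs: "(\<lambda>t. D 0 ^ M * s (t + (\<Sum>i<M. x i - y i)) * cauchy_factor s M x y / (c * s t - D 0))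
      \<midarrow>0\<rightarrow> D 0 ^ M * s (0 + (\<Sum>i<M. x i - y i)) * cauchy_factor s M x y / (c * 0 - D 0)"
    using D0 by (intro tendsto_intros lim_s isCont_tendsto_compose[OF cont]) auto
  have ev: "eventually (\<lambda>t. Determinant.det (Q (z t) (d t)) =
     D 0 ^ M * s (t + (\<Sum>i<M. x i - y i)) * cauchy_factor s M x y / (c * s t - D 0)) (at 0)"
  proof -
    have "eventually (\<lambda>t. c * s t - D 0 \<noteq> 0) (at 0)"
    proof (rule tendsto_imp_eventually_ne)
      show "(\<lambda>t. c * s t - D 0) \<midarrow>0\<rightarrow> c * 0 - D 0"
        by (intro tendsto_intros lim_s)
    qed (use D0 in auto)
    with isolated[of 0] show ?thesis
    proof eventually_elim
      case (elim t)
      have dt: "d t \<noteq> 0" using elim by (simp add: d_def)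
      have schur: "z t i j - 1 / d t = D 0 / s t * 1 * (s (x i - y j + t) / s (x i - y j))"
        if "i < M" "j < M" for i j
        using elim nonzero[of i j] that D0 by (simp add: z_def d_def M_def field_simps)
      have "Determinant.det (Q (z t) (d t)) = d t * Determinant.det (Matrix.mat M M (\<lambda>(i, j). z t i j - 1 / d t))"
        using dt Q_carrier[of "z t" "d t"]
        by (subst det_pivot_last[of _ M]) (auto simp: Q_def intro!: arg_cong[of _ _ Determinant.det] eq_matI)
      also have "Matrix.mat M M (\<lambda>(i, j). z t i j - 1 / d t) =
         Matrix.mat M M (\<lambda>(i, j). D 0 / s t * 1 * (s (x i - y j + t) / s (x i - y j)))"
        by (rule eq_matI) (auto simp: schur)
      also have "Determinant.det \<dots> = (D 0 / s t) ^ M * (s t ^ N * s (t + (\<Sum>i<M. x i - y i)) * cauchy_factor s M x y)"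
      proof -
        have "Determinant.det (Matrix.mat M M (\<lambda>(i, j). s (x i - y j + t) / s (x i - y j))) =
            s t ^ N * s (t + (\<Sum>i<M. x i - y i)) * cauchy_factor s M x y"
          unfolding M_def
          by (rule frobenius_determinant[OF three_term cont isolated nonzero])
        thus ?thesis
          unfolding det_scale_rows_cols by simp
      qed
      also have "d t * \<dots> = (d t * ((D 0 / s t) ^ M * s t ^ N)) * (s (t + (\<Sum>i<M. x i - y i)) * cauchy_factor s M x y)"
        by (simp only: mult_ac)
      also have "d t * ((D 0 / s t) ^ M * s t ^ N) = D 0 ^ M / (c * s t - D 0)"
        using elim by (simp add: d_def M_def power_divide)
      finally show ?case by simp
    qed
  qed
  have "Determinant.det (Q (\<lambda>i j. D (x i - y j) / s (x i - y j) + c) 0) =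
      D 0 ^ M * s (0 + (\<Sum>i<M. x i - y i)) * cauchy_factor s M x y / (c * 0 - D 0)"
    by (rule LIM_unique[OF lim_det]) (simp only: tendsto_cong[OF ev] lim_rhs)
  also have "\<dots> = - (D 0 ^ N * s (\<Sum>i<M. x i - y i) * cauchy_factor s M x y)"
    using D0 by (simp add: M_def)
  also have "Q (\<lambda>i j. D (x i - y j) / s (x i - y j) + c) 0 = four_block_mat
           (Matrix.mat M M (\<lambda>(i, j). D (x i - y j) / s (x i - y j) + c))
           (Matrix.mat M 1 (\<lambda>_. 1)) (Matrix.mat 1 M (\<lambda>_. 1)) (0\<^sub>m 1 1)"
    by (rule eq_matI) (auto simp: Q_def)
  finally show ?thesis by (simp add: M_def)
qed

section \<open>Unordered sums and sums of exponentials\<close>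

text \<open>
  Tannery's theorem for unordered sums: the domination makes the convergence of the partial sums uniform in the
  parameter \<open>n\<close>, so that the two limits can be exchanged.
\<close>
lemma tendsto_infsum_dominated:
  fixes f :: "'i \<Rightarrow> 'n \<Rightarrow> 'a :: banach"
  assumes lim: "\<And>l. l \<in> A \<Longrightarrow> ((\<lambda>n. f l n) \<longlongrightarrow> g l) F"
    and bound: "\<And>l n. l \<in> A \<Longrightarrow> norm (f l n) \<le> M l" and M: "M summable_on A" and F: "F \<noteq> bot"
  shows "((\<lambda>n. \<Sum>\<^sub>\<infinity>l\<in>A. f l n) \<longlongrightarrow> (\<Sum>\<^sub>\<infinity>l\<in>A. g l)) F"
proof (rule swap_uniform_limit')
  show "uniform_limit UNIV (\<lambda>X n. \<Sum>l\<in>X. f l n) (\<lambda>n. \<Sum>\<^sub>\<infinity>l\<in>A. f l n) (finite_subsets_at_top A)"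
    using bound M by (rule Weierstrass_m_test_general) auto
  have "norm (g l) \<le> M l" if "l \<in> A" for l
    using F bound[OF that] by (intro tendsto_upperbound[OF tendsto_norm[OF lim[OF that]]]) auto
  hence "g summable_on A"
    by (intro abs_summable_summable[OF summable_on_comparison_test[OF M]]) auto
  thus "((\<lambda>X. \<Sum>l\<in>X. g l) \<longlongrightarrow> (\<Sum>\<^sub>\<infinity>l\<in>A. g l)) (finite_subsets_at_top A)"
    by (rule infsum_tendsto)
  have "eventually (\<lambda>X. finite X \<and> X \<subseteq> A) (finite_subsets_at_top A)"
    by (rule eventually_finite_subsets_at_top_weakI) auto
  thus "\<forall>\<^sub>F X in finite_subsets_at_top A. ((\<lambda>n. \<Sum>l\<in>X. f l n) \<longlongrightarrow> (\<Sum>l\<in>X. g l)) F"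
    by eventually_elim (auto intro!: tendsto_sum lim)
qed auto

text \<open>
  Absolute convergence permits expanding each exponential and summing over \<open>m\<close> first.  This one interchange
  yields both the differentiability of theta functions and the Taylor coefficients of Lambert series.
\<close>
lemma exp_sum_power_series:
  fixes a s :: "'i \<Rightarrow> complex"
  assumes summ: "(\<lambda>m. norm (a m) * exp (norm (s m) * R)) summable_on A" and z: "norm z \<le> R"
  shows "(\<lambda>k. (\<Sum>\<^sub>\<infinity>m\<in>A. a m * s m ^ k) / fact k * z ^ k) sums (\<Sum>\<^sub>\<infinity>m\<in>A. a m * exp (s m * z))"
proof -
  define f where "f = (\<lambda>(m, k). a m * (s m * z) ^ k / fact k)"
  have exp_sum: "((\<lambda>k. c * w ^ k / fact k) has_sum c * exp w) (UNIV :: nat set)" for c w :: complex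
  proof -
    have "(\<lambda>k. c * (w ^ k /\<^sub>R fact k)) sums (c * exp w)"
      by (intro sums_mult exp_converges)
    moreover have "summable (\<lambda>k. norm (c * (w ^ k /\<^sub>R fact k)))"
      unfolding norm_mult by (intro summable_mult summable_norm_exp)
    ultimately show ?thesis
      using norm_summable_imp_has_sum by (fastforce simp: scaleR_conv_of_real field_simps)
  qed
  have exp_sum_real: "((\<lambda>k. c * w ^ k / fact k) has_sum c * exp w) (UNIV :: nat set)"
    if "c \<ge> 0" "w \<ge> 0" for c w :: real
  proof -
    have "(\<lambda>k. c * (w ^ k /\<^sub>R fact k)) sums (c * exp w)"
      by (intro sums_mult exp_converges)
    thus ?thesis
      using that by (intro sums_nonneg_imp_has_sum) (auto simp: field_simps)
  qed
  have norm_f: "((\<lambda>k. norm (f (m, k))) has_sum norm (a m) * exp (norm (s m) * norm z)) UNIV" for m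
    using exp_sum_real[of "norm (a m)" "norm (s m) * norm z"]
    by (simp add: f_def norm_mult norm_power norm_divide)
  have "(\<lambda>p. norm (f p)) summable_on A \<times> UNIV"
  proof (rule summable_on_SigmaI)
    show "(\<lambda>m. norm (a m) * exp (norm (s m) * norm z)) summable_on A"
      by (rule summable_on_comparison_test[OF summ])
         (auto intro!: mult_left_mono z)
  qed (use norm_f in auto)
  hence f: "f summable_on A \<times> UNIV"
    by (rule abs_summable_summable)
  have "((\<lambda>m. a m * exp (s m * z)) has_sum (\<Sum>\<^sub>\<infinity>p\<in>A \<times> UNIV. f p)) A"
    by (rule has_sum_SigmaD[OF has_sum_infsum[OF f]]) (use exp_sum in \<open>auto simp: f_def\<close>)
  moreover have "((\<lambda>k. (\<Sum>\<^sub>\<infinity>m\<in>A. a m * s m ^ k) / fact k * z ^ k) has_sum (\<Sum>\<^sub>\<infinity>p\<in>A \<times> UNIV. f p)) UNIV"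
  proof (rule has_sum_SigmaD)
    show "((\<lambda>(k, m). f (m, k)) has_sum (\<Sum>\<^sub>\<infinity>p\<in>A \<times> UNIV. f p)) (UNIV \<times> A)"
      using has_sum_swap[THEN iffD1, OF has_sum_infsum[OF f]] by simp
    fix k :: nat
    have "f summable_on (A \<times> {k})"
      by (rule summable_on_subset_banach[OF f]) auto
    hence "(\<lambda>m. f (m, k)) summable_on A"
      by (subst (asm) summable_on_reindex_bij_witness[of _ "\<lambda>m. (m, k)" fst]) (auto simp: f_def)
    hence summ_k: "(\<lambda>m. f (m, k)) summable_on A" .
    show "((\<lambda>m. case (k, m) of (k, m) \<Rightarrow> f (m, k)) has_sum (\<Sum>\<^sub>\<infinity>m\<in>A. a m * s m ^ k) / fact k * z ^ k) A"
    proof (cases "k = 0 \<or> z \<noteq> 0")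
      case True
      have "(\<lambda>m. a m * s m ^ k) summable_on A"
        using summable_on_cmult_right[OF summ_k, of "fact k / z ^ k"] True
        by (auto simp: f_def power_mult_distrib)
      hence "((\<lambda>m. (a m * s m ^ k) * (z ^ k / fact k)) has_sum
              (\<Sum>\<^sub>\<infinity>m\<in>A. a m * s m ^ k) * (z ^ k / fact k)) A"
        by (intro has_sum_cmult_left has_sum_infsum)
      thus ?thesis by (simp add: f_def power_mult_distrib mult_ac)
    next
      case False
      thus ?thesis by (auto simp: f_def power_0_left)
    qed
  qed
  ultimately show ?thesis
    using has_sum_imp_sums by (auto simp: infsumI)
qed

text \<open>
  With \<open>exp (s m * z)\<close> absorbed into the coefficients, the derivative at \<open>z\<close> becomes the linear coefficient of a
  power series at \<open>0\<close>.
\<close>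
lemma exp_sum_has_field_derivative:
  fixes a s :: "'i \<Rightarrow> complex"
  assumes summ: "(\<lambda>m. norm (a m) * exp (norm (s m) * R)) summable_on A" and z: "norm z < R"
  shows "((\<lambda>z. \<Sum>\<^sub>\<infinity>m\<in>A. a m * exp (s m * z)) has_field_derivative
           (\<Sum>\<^sub>\<infinity>m\<in>A. a m * s m * exp (s m * z))) (at z)"
proof -
  define r where "r = (R - norm z) / 2"
  have r: "r > 0" "norm z + r < R" using z by (auto simp: r_def field_simps)
  define b where "b = (\<lambda>m. a m * exp (s m * z))"
  have b: "(\<lambda>m. norm (b m) * exp (norm (s m) * r)) summable_on A"
  proof (rule summable_on_comparison_test[OF summ])
    fix m
    have "Re (s m * z) \<le> norm (s m) * norm z"
      using complex_Re_le_cmod[of "s m * z"] by (simp add: norm_mult)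
    hence "Re (s m * z) + norm (s m) * r \<le> norm (s m) * (norm z + r)"
      by (simp add: algebra_simps)
    also have "\<dots> \<le> norm (s m) * R"
      using r by (intro mult_left_mono) auto
    finally have "norm (a m) * exp (Re (s m * z) + norm (s m) * r) \<le> norm (a m) * exp (norm (s m) * R)"
      by (intro mult_left_mono) auto
    thus "norm (b m) * exp (norm (s m) * r) \<le> norm (a m) * exp (norm (s m) * R)"
      unfolding b_def norm_mult norm_exp_eq_Re exp_add by (simp add: mult_ac)
  qed auto
  define c where "c = (\<lambda>k. (\<Sum>\<^sub>\<infinity>m\<in>A. b m * s m ^ k) / fact k)"
  have sums: "(\<lambda>k. c k * w ^ k) sums (\<Sum>\<^sub>\<infinity>m\<in>A. b m * exp (s m * w))" if "norm w \<le> r" for w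
    unfolding c_def by (rule exp_sum_power_series[OF b that])
  have "((\<lambda>w. \<Sum>k. c k * w ^ k) has_field_derivative (\<Sum>k. diffs c k * 0 ^ k)) (at 0)"
  proof (rule termdiffs_strong)
    show "summable (\<lambda>k. c k * of_real r ^ k)"
      using sums[of "of_real r"] r by (auto simp: sums_iff)
  qed (use r in auto)
  hence "((\<lambda>w. \<Sum>k. c k * w ^ k) has_field_derivative c 1) (at 0)"
    by (simp add: diffs_def)
  moreover have "eventually (\<lambda>w. w \<in> ball 0 r) (nhds (0 :: complex))"
    using r by (intro eventually_nhds_in_open) auto
  hence "eventually (\<lambda>w. (\<Sum>\<^sub>\<infinity>m\<in>A. b m * exp (s m * w)) = (\<Sum>k. c k * w ^ k)) (nhds 0)"
    by eventually_elim (use sums in \<open>auto simp: sums_iff\<close>)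
  ultimately have "((\<lambda>w. \<Sum>\<^sub>\<infinity>m\<in>A. b m * exp (s m * w)) has_field_derivative c 1) (at 0)"
    using DERIV_cong_ev by fast
  hence "((\<lambda>w. \<Sum>\<^sub>\<infinity>m\<in>A. b m * exp (s m * (w - z))) has_field_derivative c 1) (at z)"
    using DERIV_shift[of "\<lambda>w. \<Sum>\<^sub>\<infinity>m\<in>A. b m * exp (s m * w)" "c 1" z "- z"] by simp
  moreover have "b m * exp (s m * (w - z)) = a m * exp (s m * w)" for m w
    by (simp add: b_def algebra_simps exp_diff)
  moreover have "c 1 = (\<Sum>\<^sub>\<infinity>m\<in>A. a m * s m * exp (s m * z))"
    by (simp add: c_def b_def mult_ac)
  ultimately show ?thesis by simp
qed

lemma exp_weighted_summable:
  fixes a s :: "'i \<Rightarrow> complex"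
  assumes "(\<lambda>n. norm (a n) * exp (norm (s n) * R)) summable_on A"
    and "\<And>n. n \<in> A \<Longrightarrow> Re (s n * z) \<le> norm (s n) * R"
  shows "(\<lambda>n. norm (a n * exp (s n * z))) summable_on A"
  by (rule summable_on_comparison_test[OF assms(1)])
     (auto simp: norm_mult intro!: mult_left_mono assms(2)[simplified])

lemma has_sum_int_split:
  fixes f :: "int \<Rightarrow> 'a :: {topological_comm_monoid_add, t3_space}"
  assumes "((\<lambda>n. f (int n)) has_sum a) UNIV" "((\<lambda>n. f (- 1 - int n)) has_sum b) UNIV"
  shows "(f has_sum a + b) UNIV"
proof -
  have "(f has_sum a) {0..}"
    using assms(1) by (rule has_sum_reindex_bij_witness[of _ nat int, THEN iffD1, rotated -1]) auto
  moreover have "(f has_sum b) {..<0}"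
    using assms(2)
    by (rule has_sum_reindex_bij_witness[of _ "\<lambda>k. nat (- 1 - k)" "\<lambda>n. - 1 - int n", THEN iffD1, rotated -1]) auto
  ultimately have "(f has_sum a + b) ({0..} \<union> {..<0})"
    by (rule has_sum_Un_disjoint) auto
  moreover have "{0..} \<union> {..<0} = (UNIV :: int set)" by auto
  ultimately show ?thesis by simp
qed

lemma summable_on_int_split:
  fixes f :: "int \<Rightarrow> 'a :: {topological_comm_monoid_add, t3_space}"
  assumes "(\<lambda>n. f (int n)) summable_on UNIV" "(\<lambda>n. f (- 1 - int n)) summable_on UNIV"
  shows "f summable_on UNIV"
  using has_sum_int_split[of f] assms by (auto simp: summable_on_def)

text \<open>
  Completing the square bounds the exponent by a constant minus \<open>\<bar>m\<bar>\<close>.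
\<close>
lemma summable_on_gaussian:
  fixes T R c :: real
  assumes "T > 0"
  shows "(\<lambda>m::int. exp (- T * (real_of_int m + c)\<^sup>2 + \<bar>real_of_int m + c\<bar> * R)) summable_on UNIV"
proof -
  define B where "B = (R + 1)\<^sup>2 / (4 * T) + \<bar>c\<bar>"
  have bound: "exp (- T * (real_of_int m + c)\<^sup>2 + \<bar>real_of_int m + c\<bar> * R) \<le> exp B * exp (- \<bar>real_of_int m\<bar>)" for m
  proof -
    define x where "x = \<bar>real_of_int m + c\<bar>"
    have "- T * x\<^sup>2 + x * (R + 1) = (R + 1)\<^sup>2 / (4 * T) - T * (x - (R + 1) / (2 * T))\<^sup>2"
      using assms by (simp add: power2_eq_square field_simps)
    also have "\<dots> \<le> (R + 1)\<^sup>2 / (4 * T)" using assms by simp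
    finally have "- T * x\<^sup>2 + x * R \<le> (R + 1)\<^sup>2 / (4 * T) - x" by (simp add: algebra_simps)
    also have "\<dots> \<le> B - \<bar>real_of_int m\<bar>" by (auto simp: B_def x_def)
    finally show ?thesis by (simp add: x_def flip: exp_add)
  qed
  have "(\<lambda>m::int. exp (- \<bar>real_of_int m\<bar>)) summable_on UNIV"
  proof (rule summable_on_int_split)
    have geo: "summable (\<lambda>n. exp (-1 :: real) ^ n)"
      by (rule summable_geometric) auto
    have pow: "exp (-1 :: real) ^ n = exp (- real n)" for n
      by (simp flip: exp_of_nat_mult)
    have s: "summable (\<lambda>n. exp (- real n))"
      using geo unfolding pow .
    thus "(\<lambda>n. exp (- \<bar>real_of_int (int n)\<bar>)) summable_on UNIV"
      by (subst summable_on_UNIV_nonneg_real_iff) simp_all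
    have "summable (\<lambda>n. exp (- real (Suc n)))"
      using s by (subst summable_Suc_iff)
    moreover have "\<bar>real_of_int (- 1 - int n)\<bar> = real (Suc n)" for n
      by simp
    ultimately show "(\<lambda>n. exp (- \<bar>real_of_int (- 1 - int n)\<bar>)) summable_on UNIV"
      by (subst summable_on_UNIV_nonneg_real_iff) (simp_all only: exp_ge_zero)
  qed
  hence "(\<lambda>m::int. exp B * exp (- \<bar>real_of_int m\<bar>)) summable_on UNIV"
    by (intro summable_on_cmult_right)
  thus ?thesis
    by (rule summable_on_comparison_test) (use bound in auto)
qed

section \<open>The q-binomial theorem\<close>

text \<open>
  The \<open>q\<close>-Pochhammer symbols \<open>(c; q)\<^sub>n\<close> and \<open>(c; q)\<^sub>\<infinity>\<close>.
\<close>
definition qpoch :: "complex \<Rightarrow> complex \<Rightarrow> nat \<Rightarrow> complex" where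
  "qpoch q c n = (\<Prod>m<n. 1 - c * q ^ m)"

definition qpoch_inf :: "complex \<Rightarrow> complex \<Rightarrow> complex" where
  "qpoch_inf q c = (\<Prod>m. 1 - c * q ^ m)"

lemma qpoch_0 [simp]: "qpoch q c 0 = 1"
  by (simp add: qpoch_def)

lemma qpoch_Suc: "qpoch q c (Suc n) = qpoch q c n * (1 - c * q ^ n)"
  by (simp add: qpoch_def)

lemma qpoch_Suc_shift: "qpoch q c (Suc n) = (1 - c) * qpoch q (c * q) n"
  unfolding qpoch_def by (subst prod.lessThan_Suc_shift) (simp add: mult_ac)

lemma convergent_qpoch:
  fixes q c :: complex
  assumes "norm q < 1"
  shows "convergent_prod (\<lambda>m. 1 - c * q ^ m)"
proof (rule abs_convergent_prod_imp_convergent_prod)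
  have "summable (\<lambda>m. norm c * norm q ^ m)"
    using assms by (intro summable_mult summable_geometric) auto
  thus "abs_convergent_prod (\<lambda>m. 1 - c * q ^ m)"
    by (simp add: abs_convergent_prod_conv_summable norm_mult norm_power)
qed

lemma qpoch_tendsto:
  assumes "norm q < 1"
  shows "qpoch q c \<longlonglongrightarrow> qpoch_inf q c"
  unfolding qpoch_def qpoch_inf_def
  using convergent_prod_LIMSEQ[OF convergent_qpoch[OF assms]]
  by (simp only: LIMSEQ_lessThan_iff_atMost)

lemma qpoch_inf_eq_0:
  assumes "norm q < 1" "qpoch_inf q c = 0"
  obtains m where "c * q ^ m = 1"
  using prodinf_nonzero[OF convergent_qpoch[OF assms(1), of c]] assms(2)
  unfolding qpoch_inf_def by force

lemma qpoch_inf_shift: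
  assumes "norm q < 1"
  shows "qpoch_inf q c = (1 - c) * qpoch_inf q (c * q)"
proof -
  have "(\<lambda>n. qpoch q c (Suc n)) \<longlonglongrightarrow> qpoch_inf q c"
    by (rule LIMSEQ_Suc[OF qpoch_tendsto[OF assms]])
  moreover have "(\<lambda>n. qpoch q c (Suc n)) \<longlonglongrightarrow> (1 - c) * qpoch_inf q (c * q)"
    unfolding qpoch_Suc_shift by (intro tendsto_intros qpoch_tendsto assms)
  ultimately show ?thesis by (rule LIMSEQ_unique)
qed

lemma isCont_qpoch_inf:
  assumes q: "norm q < 1"
  shows "isCont (qpoch_inf q) c"
proof -
  define A where "A = cball (0 :: complex) (norm c + 1)"
  have "uniformly_convergent_on A (\<lambda>N x. \<Prod>n<N. 1 + - (x * q ^ n))"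
  proof (rule uniformly_convergent_on_prod)
    show "uniformly_convergent_on A (\<lambda>N x. \<Sum>n<N. norm (- (x * q ^ n)))"
    proof (rule Weierstrass_m_test')
      show "summable (\<lambda>n. (norm c + 1) * norm q ^ n)"
        using q by (intro summable_mult summable_geometric) auto
    qed (auto simp: A_def norm_mult norm_power intro!: mult_right_mono)
  qed (auto simp: A_def intro!: continuous_intros)
  hence "uniformly_convergent_on A (\<lambda>N x. qpoch q x N)"
    by (simp add: qpoch_def)
  then obtain l where l: "uniform_limit A (\<lambda>N x. qpoch q x N) l sequentially"
    by (auto simp: uniformly_convergent_on_def)
  have "continuous_on A l"
    by (rule uniform_limit_theorem[OF _ l]) (auto simp: qpoch_def intro!: continuous_intros always_eventually)
  moreover have "l x = qpoch_inf q x" if "x \<in> A" for x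
    using tendsto_uniform_limitI[OF l that] qpoch_tendsto[OF q] LIMSEQ_unique by blast
  ultimately have "continuous_on A (qpoch_inf q)"
    by (simp cong: continuous_on_cong)
  hence "continuous_on (ball 0 (norm c + 1)) (qpoch_inf q)"
    by (rule continuous_on_subset) (auto simp: A_def)
  thus ?thesis
    by (simp add: continuous_on_eq_continuous_at)
qed

lemma qpoch_self_nonzero:
  assumes "norm q < 1"
  shows "qpoch q q n \<noteq> 0" "qpoch_inf q q \<noteq> 0"
proof -
  have ne: "q * q ^ m \<noteq> 1" for m
  proof
    assume "q * q ^ m = 1"
    hence "norm q ^ Suc m = 1" by (metis norm_one norm_power power_Suc)
    moreover have "norm q ^ Suc m \<le> norm q"
      using assms power_decreasing[of 1 "Suc m" "norm q"] by simp
    ultimately show False using assms by simp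
  qed
  show "qpoch q q n \<noteq> 0"
    using ne by (auto simp: qpoch_def)
  show "qpoch_inf q q \<noteq> 0"
    using qpoch_inf_eq_0[OF assms, of q] ne by metis
qed

text \<open>
  The Gaussian binomial coefficients, with the value \<open>0\<close> for \<open>k > N\<close> as in Pascal's triangle.
\<close>
definition qbinomial :: "complex \<Rightarrow> nat \<Rightarrow> nat \<Rightarrow> complex" where
  "qbinomial q N k = (if k \<le> N then qpoch q q N / (qpoch q q k * qpoch q q (N - k)) else 0)"

lemma qbinomial_Suc_Suc:
  assumes q: "norm q < 1" and k: "k \<le> N"
  shows "qbinomial q (Suc N) (Suc k) = qbinomial q N (Suc k) + q ^ (N - k) * qbinomial q N k"
proof (cases "k = N")
  case True
  thus ?thesis using qpoch_self_nonzero[OF q] by (simp add: qbinomial_def)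
next
  case False
  then obtain d where N: "N = k + d + 1"
    using k by (metis add.assoc le_neq_implies_less less_iff_Suc_add Suc_eq_plus1)
  have nz: "1 - q * q ^ k \<noteq> 0" "1 - q * q ^ d \<noteq> 0"
    using qpoch_self_nonzero(1)[OF q, of "Suc k"] qpoch_self_nonzero(1)[OF q, of "Suc d"]
    by (auto simp: qpoch_Suc)
  have sub: "Suc N - Suc k = Suc d" "N - Suc k = d" "N - k = Suc d"
    by (auto simp: N)
  show ?thesis
    unfolding qbinomial_def sub qpoch_Suc
    using nz qpoch_self_nonzero(1)[OF q, of k] qpoch_self_nonzero(1)[OF q, of d] k False
    by (simp add: N divide_simps) (simp add: algebra_simps power_add)
qed

text \<open>
  Multiplication by the next factor \<open>1 + x q\<^sup>N\<close> amounts to the \<open>q\<close>-analogue of Pascal's rule.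
\<close>
lemma qbinomial_theorem:
  assumes q: "norm q < 1"
  shows "(\<Prod>j<N. 1 + x * q ^ j) = (\<Sum>k\<le>N. q ^ (k choose 2) * qbinomial q N k * x ^ k)"
proof (induction N)
  case 0
  show ?case by (simp add: qbinomial_def binomial_eq_0)
next
  case (Suc N)
  define h where "h = (\<lambda>N k. q ^ (k choose 2) * qbinomial q N k)"
  have h: "h (Suc N) (Suc k) = h N (Suc k) + q ^ N * h N k" if "k \<le> N" for k
  proof -
    have "q ^ N = q ^ (N - k) * q ^ k"
      using that by (simp flip: power_add)
    moreover have "Suc k choose 2 = k + (k choose 2)"
      by (simp add: numeral_2_eq_2)
    ultimately show ?thesis
      by (simp add: h_def qbinomial_Suc_Suc[OF q that] power_add algebra_simps)
  qed
  have h0: "h (Suc N) 0 = h N 0" "h N (Suc N) = 0"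
    using qpoch_self_nonzero[OF q] by (simp_all add: h_def qbinomial_def)
  have "(\<Prod>j<Suc N. 1 + x * q ^ j) = (\<Sum>k\<le>N. h N k * x ^ k) * (1 + x * q ^ N)"
    using Suc.IH by (simp add: h_def)
  also have "\<dots> = (\<Sum>k\<le>N. h N k * x ^ k) + (\<Sum>k\<le>N. q ^ N * h N k * x ^ Suc k)"
    by (simp add: algebra_simps sum_distrib_left sum_distrib_right sum.distrib)
  also have "(\<Sum>k\<le>N. h N k * x ^ k) = (\<Sum>k\<le>Suc N. h N k * x ^ k)"
    by (simp add: h0)
  also have "\<dots> = h (Suc N) 0 + (\<Sum>k\<le>N. h N (Suc k) * x ^ Suc k)"
    by (subst sum.atMost_Suc_shift) (simp add: h0)
  also have "h (Suc N) 0 + (\<Sum>k\<le>N. h N (Suc k) * x ^ Suc k) + (\<Sum>k\<le>N. q ^ N * h N k * x ^ Suc k) =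
      h (Suc N) 0 + (\<Sum>k\<le>N. h (Suc N) (Suc k) * x ^ Suc k)"
    by (simp add: h sum.distrib[symmetric] algebra_simps)
  also have "\<dots> = (\<Sum>k\<le>Suc N. h (Suc N) k * x ^ k)"
    by (subst sum.atMost_Suc_shift) simp
  finally show ?case by (simp add: h_def)
qed

text \<open>
  The partial products \<open>(q; q)\<^sub>n\<close> converge to a nonzero limit, so they and their inverses are bounded.  The bound
  is the domination in the limit that leads to the triple product.
\<close>
lemma qbinomial_bounded:
  assumes q: "norm q < 1"
  obtains C where "\<And>N k. norm (qbinomial q N k) \<le> C"
proof -
  have "Bseq (qpoch q q)"
    using qpoch_tendsto[OF q] by (rule convergent_imp_Bseq[OF convergentI])
  then obtain B where B: "B > 0" "\<And>n. norm (qpoch q q n) \<le> B"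
    by (auto simp: Bseq_def)
  have "(\<lambda>n. inverse (qpoch q q n)) \<longlonglongrightarrow> inverse (qpoch_inf q q)"
    using qpoch_tendsto[OF q] qpoch_self_nonzero[OF q] by (intro tendsto_intros)
  hence "Bseq (\<lambda>n. inverse (qpoch q q n))"
    by (rule convergent_imp_Bseq[OF convergentI])
  then obtain B' where B': "B' > 0" "\<And>n. norm (inverse (qpoch q q n)) \<le> B'"
    by (auto simp: Bseq_def)
  have "norm (qbinomial q N k) \<le> B * (B' * B')" for N k
  proof (cases "k \<le> N")
    case True
    have "qbinomial q N k = qpoch q q N * (inverse (qpoch q q k) * inverse (qpoch q q (N - k)))"
      using True by (simp add: qbinomial_def field_simps)
    thus ?thesis
      using mult_mono[OF B(2)[of N] mult_mono[OF B'(2)[of k] B'(2)[of "N - k"]]] B(1) B'(1)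
      by (simp add: norm_mult)
  next
    case False
    thus ?thesis using B(1) B'(1) by (simp add: qbinomial_def)
  qed
  thus ?thesis by (rule that)
qed

lemma qbinomial_central_tendsto:
  assumes q: "norm q < 1"
  shows "(\<lambda>n. qbinomial q (2 * n) (nat (int n + l))) \<longlonglongrightarrow> inverse (qpoch_inf q q)"
proof -
  have lim: "filterlim (\<lambda>n. nat (int n + l)) sequentially sequentially" for l
    unfolding filterlim_at_top
  proof
    fix Z
    show "\<forall>\<^sub>F n in sequentially. Z \<le> nat (int n + l)"
      using eventually_ge_at_top[of "nat (int Z - l)"] by eventually_elim linarith
  qed
  have lim2: "filterlim (\<lambda>n. 2 * n :: nat) sequentially sequentially"
    by (rule filterlim_subseq) (auto simp: strict_mono_def)
  have P: "((\<lambda>n. qpoch q q (h n)) \<longlongrightarrow> qpoch_inf q q) sequentially"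
    if "filterlim h sequentially sequentially" for h
    by (rule filterlim_compose[OF qpoch_tendsto[OF q] that])
  have "(\<lambda>n. qpoch q q (2 * n) / (qpoch q q (nat (int n + l)) * qpoch q q (nat (int n + (- l)))))
     \<longlonglongrightarrow> qpoch_inf q q / (qpoch_inf q q * qpoch_inf q q)"
    using qpoch_self_nonzero[OF q] by (intro tendsto_intros P lim lim2) auto
  moreover have "eventually (\<lambda>n. qpoch q q (2 * n) / (qpoch q q (nat (int n + l)) * qpoch q q (nat (int n + (- l)))) =
      qbinomial q (2 * n) (nat (int n + l))) sequentially"
    using eventually_ge_at_top[of "nat \<bar>l\<bar>"]
  proof eventually_elim
    case (elim n)
    hence "2 * n - nat (int n + l) = nat (int n + (- l))" "nat (int n + l) \<le> 2 * n" by linarith+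
    thus ?case by (simp add: qbinomial_def)
  qed
  moreover have "qpoch_inf q q / (qpoch_inf q q * qpoch_inf q q) = inverse (qpoch_inf q q)"
    using qpoch_self_nonzero[OF q] by (simp add: field_simps)
  ultimately show ?thesis
    by (simp add: tendsto_cong)
qed

section \<open>The odd theta function\<close>

definition theta_odd :: "complex \<Rightarrow> complex \<Rightarrow> complex" where
  "theta_odd \<tau> z = theta_char (1/2) (1/2) z \<tau>"

text \<open>
  The Fourier coefficients of \<open>theta_odd\<close> with respect to the exponentials \<open>exp ((m + 1/2) * z)\<close>.
\<close>
definition theta_coeff :: "complex \<Rightarrow> int \<Rightarrow> complex" where
  "theta_coeff \<tau> m = exp (\<i> * of_real pi * (of_int m + 1/2)\<^sup>2 * \<tau> + (of_int m + 1/2) * (\<i> * of_real pi))"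

text \<open>
  The power \<open>q\<^sup>s\<close> for complex \<open>s\<close>; it depends on \<open>\<tau>\<close> and not only on \<open>q\<close>.
\<close>
definition qpow :: "complex \<Rightarrow> complex \<Rightarrow> complex" where
  "qpow \<tau> s = exp (2 * of_real pi * \<i> * \<tau> * s)"

lemma qpow_add: "qpow \<tau> (s + t) = qpow \<tau> s * qpow \<tau> t"
  by (simp add: qpow_def algebra_simps exp_add)

lemma qpow_0 [simp]: "qpow \<tau> 0 = 1"
  by (simp add: qpow_def)

lemma qpow_nonzero [simp]: "qpow \<tau> s \<noteq> 0"
  by (simp add: qpow_def)

lemma qpow_minus: "qpow \<tau> (- s) = inverse (qpow \<tau> s)"
  by (simp add: qpow_def exp_minus)

lemma qpow_of_nat: "qpow \<tau> (of_nat n) = qpow \<tau> 1 ^ n"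
  by (simp add: qpow_def exp_of_nat_mult[symmetric] mult_ac)

lemma norm_qpow_real: "norm (qpow \<tau> (of_real s)) = exp (- (2 * pi * Im \<tau> * s))"
  by (simp add: qpow_def norm_exp_eq_Re)

lemma norm_qpow_less_1: "Im \<tau> > 0 \<Longrightarrow> norm (qpow \<tau> 1) < 1"
  using norm_qpow_real[of \<tau> 1] by simp

lemma exp_odd_pi: "exp ((2 * of_int m + 1) * (\<i> * of_real pi)) = -1"
proof -
  have "exp ((2 * of_int m + 1) * (\<i> * of_real pi)) = exp (\<i> * of_real pi + of_int m * (of_real (2 * pi) * \<i>))"
    by (simp add: algebra_simps)
  also have "\<dots> = -1"
    by (simp add: exp_plus_2pin algebra_simps)
  finally show ?thesis .
qed

lemma exp_even_pi: "exp ((2 * of_int m) * (\<i> * of_real pi)) = 1"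
  using exp_odd_pi[of m] by (simp add: distrib_right exp_add)

lemma theta_coeff_nonzero [simp]: "theta_coeff \<tau> m \<noteq> 0"
  by (simp add: theta_coeff_def)

lemma theta_coeff_add_1: "theta_coeff \<tau> (m + 1) = - (qpow \<tau> (of_int m + 1) * theta_coeff \<tau> m)"
proof -
  have "theta_coeff \<tau> (m + 1) = qpow \<tau> (of_int m + 1) * theta_coeff \<tau> m * exp (\<i> * of_real pi)"
    unfolding theta_coeff_def qpow_def exp_add[symmetric]
    by (rule arg_cong[of _ _ exp]) (simp add: power2_eq_square algebra_simps)
  thus ?thesis by simp
qed

lemma theta_coeff_reflect: "theta_coeff \<tau> (- 1 - m) = - theta_coeff \<tau> m"
proof -
  have "theta_coeff \<tau> m = theta_coeff \<tau> (- 1 - m) * exp ((2 * of_int m + 1) * (\<i> * of_real pi))"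
    unfolding theta_coeff_def exp_add[symmetric]
    by (rule arg_cong[of _ _ exp]) (simp add: power2_eq_square algebra_simps)
  thus ?thesis by (simp add: exp_odd_pi)
qed

lemma theta_coeff_summable:
  assumes "Im \<tau> > 0"
  shows "(\<lambda>m. norm (theta_coeff \<tau> m) * exp (norm (of_int m + 1/2 :: complex) * R)) summable_on UNIV"
proof -
  have "norm (theta_coeff \<tau> m) * exp (norm (of_int m + 1/2 :: complex) * R) =
     exp (- (pi * Im \<tau>) * (real_of_int m + 1/2)\<^sup>2 + \<bar>real_of_int m + 1/2\<bar> * R)" for m
  proof -
    define s where "s = real_of_int m + 1/2"
    have s: "of_int m + 1/2 = complex_of_real s" by (simp add: s_def)
    have "Re (\<i> * of_real pi * (of_real s)\<^sup>2 * \<tau> + of_real s * (\<i> * of_real pi)) = - (pi * Im \<tau>) * s\<^sup>2"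
      by (simp flip: of_real_power)
    hence norm_coeff: "norm (theta_coeff \<tau> m) = exp (- (pi * Im \<tau>) * s\<^sup>2)"
      unfolding theta_coeff_def norm_exp_eq_Re s by simp
    show ?thesis unfolding norm_coeff s s_def[symmetric] norm_of_real exp_add ..
  qed
  thus ?thesis
    using summable_on_gaussian[of "pi * Im \<tau>" "1/2" R] assms by simp
qed

lemma theta_odd_eq_infsum: "theta_odd \<tau> z = (\<Sum>\<^sub>\<infinity>m. theta_coeff \<tau> m * exp ((of_int m + 1/2) * z))"
  unfolding theta_odd_def theta_char_def
  by (rule infsum_cong) (simp add: theta_coeff_def algebra_simps flip: exp_add)

lemma theta_odd_abs_summable:
  assumes "Im \<tau> > 0"
  shows "(\<lambda>m. norm (theta_coeff \<tau> m * exp ((of_int m + 1/2) * z))) summable_on UNIV"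
proof (rule exp_weighted_summable[OF theta_coeff_summable[OF assms]])
  fix m
  show "Re ((of_int m + 1/2) * z) \<le> norm (of_int m + 1/2 :: complex) * norm z"
    using complex_Re_le_cmod[of "(of_int m + 1/2) * z"] by (simp only: norm_mult)
qed

lemma theta_odd_has_sum:
  assumes "Im \<tau> > 0"
  shows "((\<lambda>m. theta_coeff \<tau> m * exp ((of_int m + 1/2) * z)) has_sum theta_odd \<tau> z) UNIV"
  unfolding theta_odd_eq_infsum
  by (rule has_sum_infsum[OF abs_summable_summable[OF theta_odd_abs_summable[OF assms]]])

definition theta_odd_deriv :: "complex \<Rightarrow> complex \<Rightarrow> complex" where
  "theta_odd_deriv \<tau> z = (\<Sum>\<^sub>\<infinity>m. theta_coeff \<tau> m * (of_int m + 1/2) * exp ((of_int m + 1/2) * z))"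

lemma theta_odd_has_field_derivative:
  assumes "Im \<tau> > 0"
  shows "(theta_odd \<tau> has_field_derivative theta_odd_deriv \<tau> z) (at z)"
proof -
  have "theta_odd \<tau> = (\<lambda>z. \<Sum>\<^sub>\<infinity>m. theta_coeff \<tau> m * exp ((of_int m + 1/2) * z))"
    by (rule ext) (rule theta_odd_eq_infsum)
  thus ?thesis
    using exp_sum_has_field_derivative[OF theta_coeff_summable[OF assms, of "norm z + 1"], of z]
    by (simp add: theta_odd_deriv_def)
qed

lemma theta_odd_holomorphic:
  assumes "Im \<tau> > 0"
  shows "theta_odd \<tau> holomorphic_on A"
proof -
  have "theta_odd \<tau> holomorphic_on UNIV"
    using theta_odd_has_field_derivative[OF assms] by (auto simp: holomorphic_on_open)
  thus ?thesis by (rule holomorphic_on_subset) simp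
qed

lemma theta_odd_shift_holomorphic:
  assumes "Im \<tau> > 0"
  shows "(\<lambda>z. theta_odd \<tau> (z + t)) holomorphic_on A"
proof -
  have "(\<lambda>z. z + t) holomorphic_on A" by (intro holomorphic_intros)
  from holomorphic_on_compose[OF this theta_odd_holomorphic[OF assms]] show ?thesis
    by (simp add: o_def)
qed

lemma isCont_theta_odd: "Im \<tau> > 0 \<Longrightarrow> isCont (theta_odd \<tau>) z"
  using theta_odd_has_field_derivative by (rule DERIV_isCont)

lemma theta_odd_minus: "theta_odd \<tau> (- z) = - theta_odd \<tau> z"
proof -
  have "theta_odd \<tau> (- z) = (\<Sum>\<^sub>\<infinity>m. - (theta_coeff \<tau> m * exp ((of_int m + 1/2) * z)))"
    unfolding theta_odd_eq_infsum
  proof (rule infsum_reindex_bij_witness[of _ "\<lambda>m. - 1 - m" "\<lambda>m. - 1 - m"])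
    fix m :: int
    have "(of_int (- 1 - m) + 1/2) * z = (of_int m + 1/2) * (- z)"
      by (simp add: field_simps)
    thus "- (theta_coeff \<tau> (- 1 - m) * exp ((of_int (- 1 - m) + 1/2) * z)) =
        theta_coeff \<tau> m * exp ((of_int m + 1/2) * (- z))"
      by (simp only: theta_coeff_reflect) simp
  qed auto
  thus ?thesis by (simp add: infsum_uminus theta_odd_eq_infsum)
qed

lemma theta_odd_0 [simp]: "theta_odd \<tau> 0 = 0"
  using theta_odd_minus[of \<tau> 0] by simp

text \<open>
  Translating \<open>0\<close> by the period only multiplies the value by a factor, and the value at \<open>0\<close> vanishes by oddness.
\<close>
lemma theta_odd_period_tau_0: "theta_odd \<tau> (2 * of_real pi * \<i> * \<tau>) = 0"
proof -
  have "theta_odd \<tau> (2 * of_real pi * \<i> * \<tau>) = (\<Sum>\<^sub>\<infinity>m. - qpow \<tau> (- 1/2) * theta_coeff \<tau> m)"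
    unfolding theta_odd_eq_infsum
  proof (rule infsum_reindex_bij_witness[of _ "\<lambda>m. m - 1" "\<lambda>m. m + 1"])
    fix m :: int
    have "qpow \<tau> (- 1/2) * qpow \<tau> (of_int m + 1) = qpow \<tau> (of_int m + 1/2)"
      unfolding qpow_add[symmetric] by (rule arg_cong[of _ _ "qpow \<tau>"]) simp
    moreover have "exp ((of_int m + 1/2) * (2 * of_real pi * \<i> * \<tau>)) = qpow \<tau> (of_int m + 1/2)"
      by (simp add: qpow_def mult_ac)
    ultimately show "- qpow \<tau> (- 1/2) * theta_coeff \<tau> (m + 1) =
        theta_coeff \<tau> m * exp ((of_int m + 1/2) * (2 * of_real pi * \<i> * \<tau>))"
      by (simp add: theta_coeff_add_1 mult_ac)
  qed auto
  also have "\<dots> = - qpow \<tau> (- 1/2) * theta_odd \<tau> 0"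
    by (simp add: infsum_cmult_right' theta_odd_eq_infsum infsum_uminus)
  finally show ?thesis by simp
qed

lemma abs_summable_on_times:
  fixes f g :: "_ \<Rightarrow> complex"
  assumes f: "(\<lambda>m. norm (f m)) summable_on A" and g: "(\<lambda>n. norm (g n)) summable_on B"
  shows "(\<lambda>(m, n). norm (f m * g n)) summable_on A \<times> B"
proof (rule summable_on_SigmaI)
  show "((\<lambda>n. case (m, n) of (m, n) \<Rightarrow> norm (f m * g n)) has_sum norm (f m) * (\<Sum>\<^sub>\<infinity>n\<in>B. norm (g n))) B" for m
    unfolding prod.case norm_mult by (intro has_sum_cmult_right has_sum_infsum g)
  show "(\<lambda>m. norm (f m) * (\<Sum>\<^sub>\<infinity>n\<in>B. norm (g n))) summable_on A"
    by (intro summable_on_cmult_left f)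
qed auto

lemma has_sum_times:
  fixes f g :: "_ \<Rightarrow> complex"
  assumes f: "(\<lambda>m. norm (f m)) summable_on A" and g: "(\<lambda>n. norm (g n)) summable_on B"
  shows "((\<lambda>(m, n). f m * g n) has_sum (\<Sum>\<^sub>\<infinity>m\<in>A. f m) * (\<Sum>\<^sub>\<infinity>n\<in>B. g n)) (A \<times> B)"
proof (rule has_sum_SigmaI)
  show "((\<lambda>n. case (m, n) of (m, n) \<Rightarrow> f m * g n) has_sum f m * (\<Sum>\<^sub>\<infinity>n\<in>B. g n)) B" for m
    unfolding prod.case by (intro has_sum_cmult_right has_sum_infsum abs_summable_summable[OF g])
  show "((\<lambda>m. f m * (\<Sum>\<^sub>\<infinity>n\<in>B. g n)) has_sum (\<Sum>\<^sub>\<infinity>m\<in>A. f m) * (\<Sum>\<^sub>\<infinity>n\<in>B. g n)) A"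
    by (intro has_sum_cmult_left has_sum_infsum abs_summable_summable[OF f])
  show "(\<lambda>(m, n). f m * g n) summable_on A \<times> B"
    using abs_summable_on_times[OF f g] abs_summable_summable[of "\<lambda>(m, n). f m * g n" "A \<times> B"]
    by (simp add: case_prod_unfold)
qed

text \<open>
  The part of the theta series with vanishing characteristics at \<open>\<tau> / 2\<close> whose indices lie in \<open>A\<close>; the sets that
  matter are the even and the odd numbers.
\<close>
definition theta_half :: "complex \<Rightarrow> int set \<Rightarrow> complex \<Rightarrow> complex" where
  "theta_half \<tau> A z = (\<Sum>\<^sub>\<infinity>p\<in>A. exp (\<i> * of_real pi * (of_int p)\<^sup>2 * \<tau> / 2 + of_int p * z))"

lemma theta_half_abs_summable:
  assumes "Im \<tau> > 0"
  shows "(\<lambda>p. norm (exp (\<i> * of_real pi * (of_int p)\<^sup>2 * \<tau> / 2 + of_int p * z))) summable_on (A :: int set)"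
proof -
  have "(\<lambda>p::int. exp (- (pi * Im \<tau> / 2) * (real_of_int p + 0)\<^sup>2 + \<bar>real_of_int p + 0\<bar> * \<bar>Re z\<bar>)) summable_on UNIV"
    using assms by (intro summable_on_gaussian) simp
  hence "(\<lambda>p. norm (exp (\<i> * of_real pi * (of_int p)\<^sup>2 * \<tau> / 2 + of_int p * z))) summable_on (UNIV :: int set)"
  proof (rule summable_on_comparison_test)
    fix p :: int
    have "of_int p * Re z \<le> \<bar>real_of_int p\<bar> * \<bar>Re z\<bar>"
      by (metis abs_ge_self abs_mult)
    moreover have "Re (\<i> * of_real pi * (of_int p)\<^sup>2 * \<tau> / 2 + of_int p * z) = - (pi * Im \<tau> / 2) * (real_of_int p)\<^sup>2 + of_int p * Re z"
    proof -
      have "(of_int p :: complex)\<^sup>2 = of_real ((real_of_int p)\<^sup>2)" by simp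
      thus ?thesis by (simp add: algebra_simps del: of_real_power)
    qed
    ultimately show "norm (exp (\<i> * of_real pi * (of_int p)\<^sup>2 * \<tau> / 2 + of_int p * z)) \<le>
        exp (- (pi * Im \<tau> / 2) * (real_of_int p + 0)\<^sup>2 + \<bar>real_of_int p + 0\<bar> * \<bar>Re z\<bar>)"
      unfolding norm_exp_eq_Re by (simp add: mult_ac)
  qed auto
  thus ?thesis by (rule summable_on_subset_banach) auto
qed

text \<open>
  In the double series over \<open>m\<close> and \<open>n\<close>, put \<open>p = m + n + 1\<close> and \<open>r = m - n\<close>.  Since
  \<open>(m + 1/2)\<^sup>2 + (n + 1/2)\<^sup>2 = (p\<^sup>2 + r\<^sup>2) / 2\<close>, the summands factor; the only remaining link between \<open>p\<close> and \<open>r\<close> is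
  that they have opposite parity.  The sign \<open>(-1)\<^sup>p\<close> distinguishes the two cases.
\<close>
lemma theta_odd_product_formula:
  assumes tau: "Im \<tau> > 0"
  shows "theta_odd \<tau> (u + v) * theta_odd \<tau> (u - v) =
    theta_half \<tau> {p. even p} u * theta_half \<tau> {p. odd p} v - theta_half \<tau> {p. odd p} u * theta_half \<tau> {p. even p} v"
proof -
  define g where "g = (\<lambda>(p::int) z. exp (\<i> * of_real pi * (of_int p)\<^sup>2 * \<tau> / 2 + of_int p * z))"
  define S where "S = (\<lambda>(p::int, r). (if even p then 1 else -1) * (g p u * g r v))"
  have prod: "((\<lambda>(p, r). g p u * g r v) has_sum theta_half \<tau> A u * theta_half \<tau> B v) (A \<times> B)" for A B
    unfolding theta_half_def g_def
    by (rule has_sum_times) (rule theta_half_abs_summable[OF tau])+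
  have "(S has_sum theta_half \<tau> {p. even p} u * theta_half \<tau> {p. odd p} v) ({p. even p} \<times> {p. odd p})"
    using prod[of "{p. even p}" "{p. odd p}"] by (rule has_sum_cong[THEN iffD1, rotated]) (auto simp: S_def)
  moreover have "(S has_sum - (theta_half \<tau> {p. odd p} u * theta_half \<tau> {p. even p} v)) ({p. odd p} \<times> {p. even p})"
    using has_sum_uminusI[OF prod[of "{p. odd p}" "{p. even p}"]]
    by (rule has_sum_cong[THEN iffD1, rotated]) (auto simp: S_def)
  ultimately have "(S has_sum theta_half \<tau> {p. even p} u * theta_half \<tau> {p. odd p} v +
      - (theta_half \<tau> {p. odd p} u * theta_half \<tau> {p. even p} v))
      ({p. even p} \<times> {p. odd p} \<union> {p. odd p} \<times> {p. even p})"
    by (rule has_sum_Un_disjoint) auto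
  moreover have "((\<lambda>(m, n). (theta_coeff \<tau> m * exp ((of_int m + 1/2) * (u + v))) *
       (theta_coeff \<tau> n * exp ((of_int n + 1/2) * (u - v)))) has_sum theta_odd \<tau> (u + v) * theta_odd \<tau> (u - v)) (UNIV \<times> UNIV)"
    unfolding theta_odd_eq_infsum by (rule has_sum_times) (rule theta_odd_abs_summable[OF tau])+
  hence "(S has_sum theta_odd \<tau> (u + v) * theta_odd \<tau> (u - v)) {(p, r). odd (p + r)}"
  proof (rule has_sum_reindex_bij_witness[of _ "\<lambda>(p, r). ((p + r - 1) div 2, (p - r - 1) div 2)"
        "\<lambda>(m, n). (m + n + 1, m - n)", THEN iffD1, rotated -1])
    fix mn :: "int \<times> int"
    obtain m n where mn: "mn = (m, n)" by (cases mn)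
    have sign: "exp ((of_int m + of_int n + 1) * (\<i> * of_real pi)) = (if even (m + n + 1) then 1 else -1 :: complex)"
    proof (cases "even (m + n + 1)")
      case True
      then obtain k where k: "m + n + 1 = 2 * k" by (rule evenE)
      have "(of_int m + of_int n + 1 :: complex) = of_int (m + n + 1)" by simp
      also have "\<dots> = 2 * of_int k" by (simp only: k) simp
      finally show ?thesis using True by (simp only: exp_even_pi if_True)
    next
      case False
      then obtain k where k: "m + n + 1 = 2 * k + 1" by (rule oddE)
      have "(of_int m + of_int n + 1 :: complex) = of_int (m + n + 1)" by simp
      also have "\<dots> = 2 * of_int k + 1" by (simp only: k) simp
      finally show ?thesis using False by (simp only: exp_odd_pi if_False)
    qed
    define a b :: complex where "a = of_int m + 1/2" and "b = of_int n + 1/2"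
    have ab: "of_int m + of_int n + 1 = a + b" "of_int (m + n + 1) = a + b" "of_int (m - n) = a - b"
      by (simp_all add: a_def b_def)
    have "theta_coeff \<tau> m * exp ((of_int m + 1/2) * (u + v)) * (theta_coeff \<tau> n * exp ((of_int n + 1/2) * (u - v))) =
       exp ((of_int m + of_int n + 1) * (\<i> * of_real pi)) * (g (m + n + 1) u * g (m - n) v)"
      unfolding theta_coeff_def g_def exp_add[symmetric] ab a_def[symmetric] b_def[symmetric]
      by (rule arg_cong[of _ _ exp]) (simp add: power2_eq_square field_simps)
    thus "S (case mn of (m, n) \<Rightarrow> (m + n + 1, m - n)) =
      (case mn of (m, n) \<Rightarrow> theta_coeff \<tau> m * exp ((of_int m + 1/2) * (u + v)) *
         (theta_coeff \<tau> n * exp ((of_int n + 1/2) * (u - v))))"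
      by (simp add: mn S_def sign)
  next
    fix pr :: "int \<times> int" assume "pr \<in> {(p, r). odd (p + r)}"
    then obtain p r where pr: "pr = (p, r)" "odd (p + r)" by auto
    have "(p + r - 1) div 2 + (p - r - 1) div 2 + 1 = p" "(p + r - 1) div 2 - (p - r - 1) div 2 = r"
      using pr(2) by presburger+
    thus "(case case pr of (p, r) \<Rightarrow> ((p + r - 1) div 2, (p - r - 1) div 2) of (m, n) \<Rightarrow> (m + n + 1, m - n)) = pr"
      by (simp add: pr)
  qed auto
  moreover have "{p. even p} \<times> {p. odd p} \<union> {p. odd p} \<times> {p. even p} = {(p :: int, r). odd (p + r)}"
    by auto
  ultimately show ?thesis
    using has_sum_unique by fastforce
qed

section \<open>The triple product and its consequences\<close>

lemma twice_choose_2: "2 * of_nat (n choose 2) = (of_nat n * (of_nat n - 1) :: complex)"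
proof (induction n)
  case (Suc n)
  have "Suc n choose 2 = n + (n choose 2)" by (simp add: numeral_2_eq_2)
  thus ?case using Suc by (simp add: algebra_simps)
qed (simp add: binomial_eq_0)

text \<open>
  This is the \<open>q\<close>-binomial theorem with \<open>2n\<close> factors, centred: for \<open>x = - q\<^sup>1\<^sup>-\<^sup>n exp z\<close> the upper half of the
  factors contains the positive powers of \<open>q\<close>, and the lower half becomes a product in \<open>exp (-z)\<close> after
  extracting monomials.
\<close>
lemma finite_triple_product:
  fixes \<tau> z :: complex
  defines "q \<equiv> qpow \<tau> 1"
  assumes tau: "Im \<tau> > 0"
  shows "exp (of_real pi * \<i> * \<tau> / 4 + (z + \<i> * of_real pi) / 2) * qpoch q (q * exp z) n * qpoch q (exp (- z)) n =
         (\<Sum>l\<in>{- int n..int n}. qbinomial q (2 * n) (nat (int n + l)) * (theta_coeff \<tau> l * exp ((of_int l + 1/2) * z)))"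
proof -
  have q: "norm q < 1" using norm_qpow_less_1[OF tau] by (simp add: q_def)
  have qp: "q ^ k = exp (2 * of_real pi * \<i> * \<tau> * of_nat k)" for k
    using qpow_of_nat[of \<tau> k] by (simp add: q_def qpow_def)
  define Z where "Z = z + \<i> * of_real pi"
  have neg: "- exp w = exp (w + \<i> * of_real pi)" for w :: complex
    by (simp add: exp_add)
  define x where "x = exp (2 * of_real pi * \<i> * \<tau> * (1 - of_nat n) + Z)"
  \<comment> \<open>the monomial that turns the summand with index n + l of the binomial theorem into the theta term with index l\<close>
  define A where "A = exp (2 * of_real pi * \<i> * \<tau> * (of_nat (n choose 2) + 1/8) + (1/2 - of_nat n) * Z)"
  have upper: "(\<Prod>i<n. 1 + x * q ^ (n + i)) = qpoch q (q * exp z) n"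
    unfolding qpoch_def
  proof (intro prod.cong refl)
    fix i
    have "x * q ^ (n + i) = - (q ^ Suc i * exp z)"
      unfolding x_def qp exp_add[symmetric] Z_def neg
      by (rule arg_cong[of _ _ exp]) (simp add: algebra_simps)
    thus "1 + x * q ^ (n + i) = 1 - q * exp z * q ^ i" by (simp add: mult_ac)
  qed
  have lower: "A * (\<Prod>i<n. 1 + x * q ^ (n - Suc i)) = exp (of_real pi * \<i> * \<tau> / 4 + Z / 2) * qpoch q (exp (- z)) n"
  proof -
    have "1 + x * q ^ (n - Suc i) = exp (Z - 2 * of_real pi * \<i> * \<tau> * of_nat i) * (1 - exp (- z) * q ^ i)" if "i < n" for i
    proof -
      have "x * q ^ (n - Suc i) = exp (Z - 2 * of_real pi * \<i> * \<tau> * of_nat i)"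
        unfolding x_def qp exp_add[symmetric] using that
        by (intro arg_cong[of _ _ exp]) (simp add: algebra_simps of_nat_diff)
      moreover have "exp (Z - 2 * of_real pi * \<i> * \<tau> * of_nat i) * (exp (- z) * q ^ i) = exp (0 + \<i> * of_real pi)"
        unfolding qp exp_add[symmetric] Z_def
        by (intro arg_cong[of _ _ exp]) (simp add: algebra_simps)
      ultimately show ?thesis by (simp add: algebra_simps)
    qed
    hence "(\<Prod>i<n. 1 + x * q ^ (n - Suc i)) = (\<Prod>i<n. exp (Z - 2 * of_real pi * \<i> * \<tau> * of_nat i) * (1 - exp (- z) * q ^ i))"
      by (intro prod.cong) auto
    also have "\<dots> = exp (\<Sum>i<n. Z - 2 * of_real pi * \<i> * \<tau> * of_nat i) * qpoch q (exp (- z)) n"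
      by (simp add: prod.distrib exp_sum qpoch_def)
    also have "(\<Sum>i<n. Z - 2 * of_real pi * \<i> * \<tau> * of_nat i) = of_nat n * Z - 2 * of_real pi * \<i> * \<tau> * of_nat (n choose 2)"
    proof -
      have "(\<Sum>i<n. of_nat i :: complex) = of_nat (n choose 2)"
      proof (induction n)
        case (Suc n)
        have "Suc n choose 2 = n + (n choose 2)" by (simp add: numeral_2_eq_2)
        thus ?case using Suc by simp
      qed (simp add: binomial_eq_0)
      thus ?thesis by (simp add: sum_subtractf flip: sum_distrib_left)
    qed
    also have "A * (exp (of_nat n * Z - 2 * of_real pi * \<i> * \<tau> * of_nat (n choose 2)) * qpoch q (exp (- z)) n) =
      (A * exp (of_nat n * Z - 2 * of_real pi * \<i> * \<tau> * of_nat (n choose 2))) * qpoch q (exp (- z)) n"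
      by (simp only: mult.assoc)
    also have "A * exp (of_nat n * Z - 2 * of_real pi * \<i> * \<tau> * of_nat (n choose 2)) = exp (of_real pi * \<i> * \<tau> / 4 + Z / 2)"
      unfolding A_def exp_add[symmetric] by (intro arg_cong[of _ _ exp]) (simp add: field_simps)
    finally show ?thesis .
  qed
  have "(\<Prod>j<2 * n. 1 + x * q ^ j) = (\<Prod>i<n. 1 + x * q ^ (n - Suc i)) * (\<Prod>i<n. 1 + x * q ^ (n + i))"
  proof -
    have "{..<2 * n} = {..<n} \<union> {n..<2 * n}" by auto
    hence "(\<Prod>j<2 * n. 1 + x * q ^ j) = (\<Prod>j<n. 1 + x * q ^ j) * (\<Prod>j\<in>{n..<2 * n}. 1 + x * q ^ j)"
      by (simp add: prod.union_disjoint[symmetric] ivl_disj_int)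
    also have "(\<Prod>j\<in>{n..<2 * n}. 1 + x * q ^ j) = (\<Prod>i<n. 1 + x * q ^ (n + i))"
      by (rule prod.reindex_bij_witness[of _ "\<lambda>i. n + i" "\<lambda>j. j - n"]) auto
    also have "(\<Prod>j<n. 1 + x * q ^ j) = (\<Prod>i<n. 1 + x * q ^ (n - Suc i))"
      by (rule prod.nat_diff_reindex[symmetric])
    finally show ?thesis .
  qed
  hence "A * (\<Prod>j<2 * n. 1 + x * q ^ j) =
     (A * (\<Prod>i<n. 1 + x * q ^ (n - Suc i))) * (\<Prod>i<n. 1 + x * q ^ (n + i))"
    by (simp only: mult.assoc)
  also have "\<dots> = exp (of_real pi * \<i> * \<tau> / 4 + Z / 2) * qpoch q (q * exp z) n * qpoch q (exp (- z)) n"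
    unfolding lower upper by (simp only: mult_ac)
  finally have "exp (of_real pi * \<i> * \<tau> / 4 + Z / 2) * qpoch q (q * exp z) n * qpoch q (exp (- z)) n =
      A * (\<Prod>j<2 * n. 1 + x * q ^ j)" ..
  also have "\<dots> = (\<Sum>k\<le>2 * n. qbinomial q (2 * n) k * (A * q ^ (k choose 2) * x ^ k))"
    unfolding qbinomial_theorem[OF q] sum_distrib_left by (simp only: mult_ac)
  also have "\<dots> = (\<Sum>l\<in>{- int n..int n}. qbinomial q (2 * n) (nat (int n + l)) * (theta_coeff \<tau> l * exp ((of_int l + 1/2) * z)))"
  proof (rule sum.reindex_bij_witness[of _ "\<lambda>l. nat (int n + l)" "\<lambda>k. int k - int n"])
    fix k assume "k \<in> {..2 * n}"
    have choose: "of_nat (m choose 2) = (of_nat m * (of_nat m - 1) / 2 :: complex)" for m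
      using twice_choose_2[of m] by (simp add: field_simps)
    have "A * q ^ (k choose 2) * x ^ k = theta_coeff \<tau> (int k - int n) * exp ((of_int (int k - int n) + 1/2) * z)"
      unfolding A_def qp x_def theta_coeff_def exp_of_nat_mult[symmetric] exp_add[symmetric] choose Z_def
      by (intro arg_cong[of _ _ exp]) (simp add: power2_eq_square field_simps)
    thus "qbinomial q (2 * n) (nat (int n + (int k - int n))) * (theta_coeff \<tau> (int k - int n) * exp ((of_int (int k - int n) + 1/2) * z)) =
       qbinomial q (2 * n) k * (A * q ^ (k choose 2) * x ^ k)"
      by simp
  qed auto
  finally show ?thesis by (simp add: Z_def)
qed

text \<open>
  In the finite identity the coefficients tend to \<open>1 / (q; q)\<^sub>\<infinity>\<close> and are bounded, so the limit can be taken
  termwise.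
\<close>
theorem jacobi_triple_product:
  fixes \<tau> z :: complex
  defines "q \<equiv> qpow \<tau> 1"
  assumes tau: "Im \<tau> > 0"
  shows "theta_odd \<tau> z = exp (of_real pi * \<i> * \<tau> / 4 + (z + \<i> * of_real pi) / 2) *
           qpoch_inf q q * qpoch_inf q (q * exp z) * qpoch_inf q (exp (- z))"
proof -
  have q: "norm q < 1" using norm_qpow_less_1[OF tau] by (simp add: q_def)
  define T where "T = (\<lambda>l. theta_coeff \<tau> l * exp ((of_int l + 1/2) * z))"
  define f where "f = (\<lambda>l n. (if l \<in> {- int n..int n} then qbinomial q (2 * n) (nat (int n + l)) else 0) * T l)"
  obtain C where C: "\<And>N k. norm (qbinomial q N k) \<le> C"
    using qbinomial_bounded[OF q] by blast
  have C0: "C \<ge> 0" using norm_ge_zero[of "qbinomial q 0 0"] C[of 0 0] by linarith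
  have "(\<lambda>n. \<Sum>\<^sub>\<infinity>l. f l n) \<longlonglongrightarrow> (\<Sum>\<^sub>\<infinity>l. inverse (qpoch_inf q q) * T l)"
  proof (rule tendsto_infsum_dominated)
    fix l
    have "eventually (\<lambda>n. qbinomial q (2 * n) (nat (int n + l)) * T l = f l n) sequentially"
      using eventually_ge_at_top[of "nat \<bar>l\<bar>"] by eventually_elim (auto simp: f_def)
    thus "(\<lambda>n. f l n) \<longlonglongrightarrow> inverse (qpoch_inf q q) * T l"
      by (rule Lim_transform_eventually[rotated]) (intro tendsto_intros qbinomial_central_tendsto q)
  next
    show "norm (f l n) \<le> C * norm (T l)" for l n
      using C C0 by (auto simp: f_def norm_mult intro!: mult_right_mono)
    show "(\<lambda>l. C * norm (T l)) summable_on UNIV"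
      unfolding T_def by (intro summable_on_cmult_right theta_odd_abs_summable tau)
  qed auto
  also have "(\<Sum>\<^sub>\<infinity>l. inverse (qpoch_inf q q) * T l) = inverse (qpoch_inf q q) * theta_odd \<tau> z"
    by (simp add: infsum_cmult_right' T_def theta_odd_eq_infsum)
  also have "(\<lambda>n. \<Sum>\<^sub>\<infinity>l. f l n) = (\<lambda>n. exp (of_real pi * \<i> * \<tau> / 4 + (z + \<i> * of_real pi) / 2) *
      qpoch q (q * exp z) n * qpoch q (exp (- z)) n)"
  proof
    fix n
    have "(\<Sum>\<^sub>\<infinity>l. f l n) = (\<Sum>\<^sub>\<infinity>l\<in>{- int n..int n}. f l n)"
      by (rule infsum_cong_neutral) (auto simp: f_def)
    also have "\<dots> = (\<Sum>l\<in>{- int n..int n}. qbinomial q (2 * n) (nat (int n + l)) * T l)"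
      by (simp add: f_def)
    finally show "(\<Sum>\<^sub>\<infinity>l. f l n) = exp (of_real pi * \<i> * \<tau> / 4 + (z + \<i> * of_real pi) / 2) *
      qpoch q (q * exp z) n * qpoch q (exp (- z)) n"
      using finite_triple_product[OF tau, of z n] by (simp add: T_def q_def)
  qed
  finally have "(\<lambda>n. exp (of_real pi * \<i> * \<tau> / 4 + (z + \<i> * of_real pi) / 2) *
      qpoch q (q * exp z) n * qpoch q (exp (- z)) n) \<longlonglongrightarrow> inverse (qpoch_inf q q) * theta_odd \<tau> z" .
  moreover have "(\<lambda>n. exp (of_real pi * \<i> * \<tau> / 4 + (z + \<i> * of_real pi) / 2) *
      qpoch q (q * exp z) n * qpoch q (exp (- z)) n) \<longlonglongrightarrow>
      exp (of_real pi * \<i> * \<tau> / 4 + (z + \<i> * of_real pi) / 2) * qpoch_inf q (q * exp z) * qpoch_inf q (exp (- z))"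
    by (intro tendsto_intros qpoch_tendsto q)
  ultimately have "inverse (qpoch_inf q q) * theta_odd \<tau> z =
      exp (of_real pi * \<i> * \<tau> / 4 + (z + \<i> * of_real pi) / 2) * qpoch_inf q (q * exp z) * qpoch_inf q (exp (- z))"
    by (rule LIMSEQ_unique)
  thus ?thesis
    using qpoch_self_nonzero(2)[OF q] by (simp add: field_simps)
qed

lemma period_latticeI:
  assumes "exp (w + 2 * of_real pi * \<i> * \<tau> * of_int n) = 1"
  shows "w \<in> period_lattice \<tau>"
proof -
  define W where "W = w + 2 * of_real pi * \<i> * \<tau> * of_int n"
  have "exp W = 1" using assms by (simp add: W_def)
  then obtain m :: int where m: "Re W = 0" "Im W = of_int (2 * m) * pi"
    unfolding exp_eq_1 by blast
  hence "W = of_int (2 * m) * of_real pi * \<i>"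
    by (simp add: complex_eq_iff)
  moreover have "w = W - 2 * of_real pi * \<i> * \<tau> * of_int n"
    by (simp add: W_def)
  ultimately have "w = 2 * of_real pi * \<i> * (of_int m + of_int (- n) * \<tau>)"
    by (simp add: algebra_simps)
  thus ?thesis unfolding period_lattice_def by blast
qed

text \<open>
  A convergent infinite product vanishes only if one of its factors does, and a vanishing factor says that \<open>exp z\<close>
  is an integral power of \<open>q\<close>.
\<close>
lemma theta_odd_eq_0_imp_period:
  assumes tau: "Im \<tau> > 0" and zero: "theta_odd \<tau> z = 0"
  shows "z \<in> period_lattice \<tau>"
proof -
  define q where "q = qpow \<tau> 1"
  have q: "norm q < 1" using norm_qpow_less_1[OF tau] by (simp add: q_def)
  have qp: "q ^ k = exp (2 * of_real pi * \<i> * \<tau> * of_nat k)" for k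
    using qpow_of_nat[of \<tau> k] by (simp add: q_def qpow_def)
  have "qpoch_inf q (q * exp z) = 0 \<or> qpoch_inf q (exp (- z)) = 0"
    using zero jacobi_triple_product[OF tau, of z] qpoch_self_nonzero(2)[OF q] by (auto simp: q_def)
  thus ?thesis
  proof
    assume "qpoch_inf q (q * exp z) = 0"
    then obtain m where "q * exp z * q ^ m = 1" using qpoch_inf_eq_0[OF q] by metis
    hence "exp z * q ^ Suc m = 1" by (simp add: mult_ac)
    hence "exp (z + 2 * of_real pi * \<i> * \<tau> * of_int (int (Suc m))) = 1"
      unfolding qp exp_add by simp
    thus ?thesis by (rule period_latticeI)
  next
    assume "qpoch_inf q (exp (- z)) = 0"
    then obtain m where "exp (- z) * q ^ m = 1" using qpoch_inf_eq_0[OF q] by metis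
    hence "inverse (exp (- z) * q ^ m) = 1" by simp
    hence "exp (z + 2 * of_real pi * \<i> * \<tau> * of_int (- int m)) = 1"
      unfolding qp exp_add[symmetric] exp_minus[symmetric] by simp
    thus ?thesis by (rule period_latticeI)
  qed
qed

text \<open>
  The factor \<open>1 - exp (-z)\<close> of the triple product has a simple zero at \<open>0\<close> with derivative \<open>1\<close>.  The remaining
  factors are continuous there, and their value is \<open>i q\<^sup>1\<^sup>/\<^sup>8\<close> times the cube of \<open>(q; q)\<^sub>\<infinity>\<close>.
\<close>
lemma theta_odd_deriv_0:
  assumes tau: "Im \<tau> > 0"
  shows "theta_odd_deriv \<tau> 0 = \<i> * dedekind_eta \<tau> ^ 3"
proof -
  define q where "q = qpow \<tau> 1"
  have q: "norm q < 1" using norm_qpow_less_1[OF tau] by (simp add: q_def)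
  define G where "G = (\<lambda>z. exp (of_real pi * \<i> * \<tau> / 4 + (z + \<i> * of_real pi) / 2) *
           qpoch_inf q q * qpoch_inf q (q * exp z) * qpoch_inf q (exp (- z) * q))"
  have factor: "theta_odd \<tau> z = (1 - exp (- z)) * G z" for z
    using jacobi_triple_product[OF tau, of z] qpoch_inf_shift[OF q, of "exp (- z)"]
    by (simp add: G_def q_def)
  have isC: "isCont (\<lambda>z. qpoch_inf q (h z)) 0" if "isCont h 0" for h :: "complex \<Rightarrow> complex"
    by (rule isCont_o2[OF that isCont_qpoch_inf[OF q]])
  have "isCont G 0"
    unfolding G_def by (intro continuous_intros isC) auto
  hence G_lim: "G \<midarrow>0\<rightarrow> G 0" by (simp add: isCont_def)
  have "((\<lambda>z. 1 - exp (- z)) has_field_derivative 1) (at (0 :: complex))"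
    by (auto intro!: derivative_eq_intros)
  hence "(\<lambda>z. (1 - exp (- z)) / z) \<midarrow>0\<rightarrow> (1 :: complex)"
    by (simp add: DERIV_def)
  hence "(\<lambda>z. (1 - exp (- z)) / z * G z) \<midarrow>0\<rightarrow> 1 * G 0"
    by (intro tendsto_mult G_lim)
  hence "(\<lambda>z. theta_odd \<tau> z / z) \<midarrow>0\<rightarrow> G 0"
    by (simp add: factor)
  moreover have "(\<lambda>z. theta_odd \<tau> z / z) \<midarrow>0\<rightarrow> theta_odd_deriv \<tau> 0"
    using theta_odd_has_field_derivative[OF tau, of 0] by (simp add: DERIV_def)
  ultimately have "theta_odd_deriv \<tau> 0 = G 0"
    using LIM_unique by blast
  also have "\<dots> = exp (of_real pi * \<i> * \<tau> / 4 + \<i> * of_real pi / 2) * qpoch_inf q q ^ 3"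
    by (simp add: G_def power3_eq_cube)
  also have "exp (of_real pi * \<i> * \<tau> / 4 + \<i> * of_real pi / 2) = \<i> * exp (of_real pi * \<i> * \<tau> / 4)"
  proof -
    have "exp (\<i> * of_real pi / 2) = \<i>"
      using cis_pi_half by (simp add: cis_conv_exp)
    thus ?thesis by (simp add: exp_add)
  qed
  also have "exp (of_real pi * \<i> * \<tau> / 4) = exp (2 * of_real pi * \<i> * \<tau> / 24) ^ 3"
    by (simp add: mult_ac flip: exp_of_nat_mult)
  also have "qpoch_inf q q = (\<Prod>m. 1 - exp (2 * of_real pi * \<i> * \<tau>) ^ (m + 1))"
    by (simp add: qpoch_inf_def q_def qpow_def)
  finally show ?thesis
    by (simp add: dedekind_eta_def power_mult_distrib)
qed

lemma theta_odd_deriv_0_nonzero: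
  assumes tau: "Im \<tau> > 0"
  shows "theta_odd_deriv \<tau> 0 \<noteq> 0"
proof -
  have "qpoch_inf (qpow \<tau> 1) (qpow \<tau> 1) = (\<Prod>m. 1 - exp (2 * of_real pi * \<i> * \<tau>) ^ (m + 1))"
    by (simp add: qpoch_inf_def qpow_def)
  thus ?thesis
    using qpoch_self_nonzero(2)[OF norm_qpow_less_1[OF tau]]
    by (simp add: theta_odd_deriv_0[OF tau] dedekind_eta_def)
qed

lemma strip_not_period:
  assumes tau: "Im \<tau> > 0" and z: "- (2 * pi * Im \<tau>) < Re z" "Re z < 0"
  shows "z \<notin> period_lattice \<tau>"
proof
  assume "z \<in> period_lattice \<tau>"
  then obtain m n :: int where "z = 2 * of_real pi * \<i> * (of_int m + of_int n * \<tau>)"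
    by (auto simp: period_lattice_def)
  hence Re: "Re z = - (2 * pi * Im \<tau> * real_of_int n)" by simp
  define c where "c = 2 * pi * Im \<tau>"
  have c: "c > 0" using tau by (simp add: c_def)
  have "c * real_of_int n > 0" "c * real_of_int n < c * 1"
    using z unfolding Re c_def by simp_all
  hence "real_of_int n > 0" "real_of_int n < 1"
    using c by (simp_all add: zero_less_mult_iff)
  thus False by simp
qed

lemma theta_odd_isolated_zeros:
  assumes tau: "Im \<tau> > 0"
  shows "eventually (\<lambda>w. theta_odd \<tau> w \<noteq> 0) (at z)"
proof -
  define z0 where "z0 = complex_of_real (- (pi * Im \<tau>))"
  have "theta_odd \<tau> z0 \<noteq> 0"
    using strip_not_period[OF tau, of z0] theta_odd_eq_0_imp_period[OF tau, of z0] tau by (auto simp: z0_def)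
  thus ?thesis
    using non_zero_neighbour_alt[OF theta_odd_holomorphic[OF tau], of UNIV z z0] connected_UNIV by simp
qed

section \<open>Kronecker's series in its strip of convergence\<close>

lemma has_sum_int_convolution:
  fixes a b :: "int \<Rightarrow> complex"
  assumes a: "(\<lambda>m. norm (a m)) summable_on UNIV" and b: "(\<lambda>p. norm (b p)) summable_on UNIV"
  shows "(\<lambda>p. a (k - p) * b p) summable_on UNIV"
    and "((\<lambda>k. \<Sum>\<^sub>\<infinity>p. a (k - p) * b p) has_sum (\<Sum>\<^sub>\<infinity>m. a m) * (\<Sum>\<^sub>\<infinity>p. b p)) UNIV"
proof -
  have sum: "((\<lambda>(k, p). a (k - p) * b p) has_sum (\<Sum>\<^sub>\<infinity>m. a m) * (\<Sum>\<^sub>\<infinity>p. b p)) (UNIV \<times> UNIV)"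
    using has_sum_times[OF a b]
    by (rule has_sum_reindex_bij_witness[of _ "\<lambda>(k, p). (k - p, p)" "\<lambda>(m, p). (m + p, p)", THEN iffD1, rotated -1]) auto
  show inner: "(\<lambda>p. a (k - p) * b p) summable_on UNIV" for k
    using summable_on_SigmaD1[of "\<lambda>k p. a (k - p) * b p" UNIV "\<lambda>_. UNIV" k] has_sum_imp_summable[OF sum] by simp
  show "((\<lambda>k. \<Sum>\<^sub>\<infinity>p. a (k - p) * b p) has_sum (\<Sum>\<^sub>\<infinity>m. a m) * (\<Sum>\<^sub>\<infinity>p. b p)) UNIV"
    by (rule has_sum_SigmaD[OF sum]) (auto intro: has_sum_infsum inner)
qed

text \<open>
  A summand with denominator \<open>0\<close> has the value \<open>0\<close>, so for \<open>u = 1\<close> and \<open>l = 0\<close> this is the series in which the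
  index \<open>0\<close> is omitted.
\<close>
definition kronecker_series :: "complex \<Rightarrow> complex \<Rightarrow> real \<Rightarrow> complex \<Rightarrow> complex" where
  "kronecker_series \<tau> u l z = - (\<Sum>\<^sub>\<infinity>k::int. exp ((of_int k + of_real l) * z) / (1 - u * qpow \<tau> (of_int k + of_real l)))"

text \<open>
  The ratios \<open>w / (1 - w)\<close> in which \<open>w\<close> is the term \<open>u q\<^sup>n\<^sup>+\<^sup>l\<close>, respectively the inverse of the term with index
  \<open>-1 - n\<close>.  In both families \<open>w\<close> decays geometrically.
\<close>
definition lambert_pos :: "complex \<Rightarrow> complex \<Rightarrow> real \<Rightarrow> nat \<Rightarrow> complex" where
  "lambert_pos \<tau> u l n = u * qpow \<tau> (of_nat n + of_real l) / (1 - u * qpow \<tau> (of_nat n + of_real l))"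

definition lambert_neg :: "complex \<Rightarrow> complex \<Rightarrow> real \<Rightarrow> nat \<Rightarrow> complex" where
  "lambert_neg \<tau> u l n =
     inverse u * qpow \<tau> (of_nat (Suc n) - of_real l) / (1 - inverse u * qpow \<tau> (of_nat (Suc n) - of_real l))"

text \<open>
  The denominators tend to \<open>1\<close>, so their inverses are bounded and the numerators decide.
\<close>
lemma lambert_exp_summable:
  fixes v :: complex
  assumes tau: "Im \<tau> > 0" and c: "c \<ge> 0" and R: "R < 2 * pi * Im \<tau>"
  shows "summable (\<lambda>n. norm (v * qpow \<tau> (of_nat n + of_real c) / (1 - v * qpow \<tau> (of_nat n + of_real c))) * exp ((real n + c) * R))"
proof -
  define w where "w = (\<lambda>n. v * qpow \<tau> (of_nat n + of_real c))"
  have w: "w n = v * qpow \<tau> (of_real c) * qpow \<tau> 1 ^ n" for n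
    by (simp add: w_def qpow_add qpow_of_nat mult_ac)
  have "w \<longlonglongrightarrow> v * qpow \<tau> (of_real c) * 0"
    unfolding w using norm_qpow_less_1[OF tau] by (intro tendsto_intros LIMSEQ_power_zero)
  hence "(\<lambda>n. 1 / (1 - w n)) \<longlonglongrightarrow> 1 / (1 - 0)"
    by (intro tendsto_intros) auto
  hence "Bseq (\<lambda>n. 1 / (1 - w n))"
    by (rule convergent_imp_Bseq[OF convergentI])
  then obtain C where C: "C > 0" "\<And>n. norm (1 / (1 - w n)) \<le> C"
    by (auto simp: Bseq_def)
  define r where "r = exp (R - 2 * pi * Im \<tau>)"
  have "summable (\<lambda>n. norm v * C * exp (c * (R - 2 * pi * Im \<tau>)) * r ^ n)"
    using R by (intro summable_mult[OF summable_geometric]) (simp add: r_def)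
  thus ?thesis
  proof (rule summable_comparison_test[rotated], intro exI allI impI)
    fix n
    have "norm (w n) * exp ((real n + c) * R) = norm v * (exp (c * (R - 2 * pi * Im \<tau>)) * r ^ n)"
    proof -
      have "norm (w n) = norm v * exp (- (2 * pi * Im \<tau> * (real n + c)))"
        using norm_qpow_real[of \<tau> "real n + c"] by (simp add: w_def norm_mult)
      moreover have "exp (- (2 * pi * Im \<tau> * (real n + c))) * exp ((real n + c) * R) = exp (c * (R - 2 * pi * Im \<tau>)) * r ^ n"
        unfolding r_def exp_of_nat_mult[symmetric] exp_add[symmetric]
        by (rule arg_cong[of _ _ exp]) (simp add: algebra_simps)
      ultimately show ?thesis by (simp only: mult.assoc)
    qed
    hence "norm (w n / (1 - w n)) * exp ((real n + c) * R) = norm (1 / (1 - w n)) * (norm v * (exp (c * (R - 2 * pi * Im \<tau>)) * r ^ n))"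
      by (simp add: norm_divide divide_simps)
    also have "\<dots> \<le> C * (norm v * (exp (c * (R - 2 * pi * Im \<tau>)) * r ^ n))"
      by (intro mult_right_mono C) (auto simp: r_def)
    finally show "norm (norm (v * qpow \<tau> (of_nat n + of_real c) / (1 - v * qpow \<tau> (of_nat n + of_real c))) * exp ((real n + c) * R)) \<le>
        norm v * C * exp (c * (R - 2 * pi * Im \<tau>)) * r ^ n"
      by (simp add: w_def mult_ac)
  qed
qed

lemma lambert_pos_summable:
  assumes "Im \<tau> > 0" "l \<ge> 0" "R < 2 * pi * Im \<tau>"
  shows "(\<lambda>n. norm (lambert_pos \<tau> u l n) * exp (norm (of_nat n + of_real l :: complex) * R)) summable_on UNIV"
proof -
  have "norm (of_nat n + of_real l :: complex) = real n + l" for n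
    using assms(2) norm_of_real[of "real n + l", where 'a = complex] by simp
  thus ?thesis
    using lambert_exp_summable[OF assms, of u]
    by (subst summable_on_UNIV_nonneg_real_iff) (auto simp: lambert_pos_def)
qed

lemma lambert_neg_summable:
  assumes "Im \<tau> > 0" "l < 1" "R < 2 * pi * Im \<tau>"
  shows "(\<lambda>n. norm (lambert_neg \<tau> u l n) * exp (norm (- (of_nat (Suc n) - of_real l) :: complex) * R)) summable_on UNIV"
proof -
  have n: "norm (- (of_nat (Suc n) - of_real l) :: complex) = real n + (1 - l)" for n
  proof -
    have "of_nat (Suc n) - of_real l = complex_of_real (real n + (1 - l))" by simp
    thus ?thesis
      unfolding norm_minus_cancel using assms(2) by (simp only: norm_of_real)
  qed
  have eq: "of_nat (Suc n) - of_real l = of_nat n + complex_of_real (1 - l)" for n by simp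
  have "summable (\<lambda>n. norm (lambert_neg \<tau> u l n) * exp ((real n + (1 - l)) * R))"
    unfolding lambert_neg_def eq by (rule lambert_exp_summable) (use assms in auto)
  thus ?thesis
    unfolding n by (subst summable_on_UNIV_nonneg_real_iff) auto
qed

text \<open>
  What remains of the Kronecker series once the geometric series \<open>exp (l * z) / (exp z - 1)\<close> is split off.  It
  converges in a neighbourhood of \<open>0\<close>, whereas the Kronecker series itself only converges to the left of it.
\<close>
definition lambert_part :: "complex \<Rightarrow> complex \<Rightarrow> real \<Rightarrow> complex \<Rightarrow> complex" where
  "lambert_part \<tau> u l z =
     - (\<Sum>\<^sub>\<infinity>n. lambert_pos \<tau> u l n * exp ((of_nat n + of_real l) * z)) +
       (\<Sum>\<^sub>\<infinity>n. lambert_neg \<tau> u l n * exp (- (of_nat (Suc n) - of_real l) * z))"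

text \<open>
  For the indices \<open>k \<ge> 0\<close> use \<open>1 / (1 - w) = 1 + w / (1 - w)\<close>, which splits off the geometric series; for \<open>k < 0\<close>
  use \<open>1 / (1 - w) = - v / (1 - v)\<close> where \<open>v\<close> is the inverse of \<open>w\<close>.
\<close>
lemma
  assumes tau: "Im \<tau> > 0" and l: "0 \<le> l" "l < 1" and u: "u \<noteq> 0"
    and z: "- (2 * pi * Im \<tau>) < Re z" "Re z < 0"
  shows kronecker_terms_abs_summable:
      "(\<lambda>k::int. norm (exp ((of_int k + of_real l) * z) / (1 - u * qpow \<tau> (of_int k + of_real l)))) summable_on UNIV"
    and kronecker_series_conv_lambert_part: "(\<And>k::int. u * qpow \<tau> (of_int k + of_real l) \<noteq> 1) \<Longrightarrow>
      kronecker_series \<tau> u l z = exp (of_real l * z) / (exp z - 1) + lambert_part \<tau> u l z"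
proof -
  define f where "f = (\<lambda>k::int. exp ((of_int k + of_real l) * z) / (1 - u * qpow \<tau> (of_int k + of_real l)))"
  have geo_norm: "norm (exp z) < 1" using z by simp
  have f_neg: "f (- 1 - int n) = - (lambert_neg \<tau> u l n * exp (- (of_nat (Suc n) - of_real l) * z))" for n
  proof -
    have eq: "of_int (- 1 - int n) + complex_of_real l = - (of_nat (Suc n) - of_real l)" by simp
    define v where "v = inverse u * qpow \<tau> (of_nat (Suc n) - of_real l)"
    have v: "v \<noteq> 0" "u * qpow \<tau> (- (of_nat (Suc n) - of_real l)) = inverse v"
      using u unfolding v_def qpow_minus by simp_all
    have "1 - inverse v = - ((1 - v) / v)"
      using v(1) by (simp add: diff_divide_distrib inverse_eq_divide)
    hence "1 / (1 - inverse v) = - (v / (1 - v))"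
      by simp
    thus ?thesis
      unfolding f_def eq v(2) lambert_neg_def v_def[symmetric]
      by (metis (no_types, lifting) minus_mult_left mult.commute times_divide_eq_right mult.right_neutral)
  qed
  have sum_neg: "(\<lambda>n. norm (lambert_neg \<tau> u l n * exp (- (of_nat (Suc n) - of_real l) * z))) summable_on UNIV"
  proof (rule exp_weighted_summable[OF lambert_neg_summable[OF tau l(2)]])
    show "- Re z < 2 * pi * Im \<tau>" using z by simp
    fix n
    have norm_neg: "norm (- (of_nat (Suc n) - of_real l) :: complex) = real (Suc n) - l"
    proof -
      have "of_nat (Suc n) - of_real l = complex_of_real (real (Suc n) - l)" by simp
      thus ?thesis
        unfolding norm_minus_cancel using l(2) by (simp only: norm_of_real)
    qed
    show "Re (- (of_nat (Suc n) - of_real l) * z) \<le> norm (- (of_nat (Suc n) - of_real l) :: complex) * - Re z"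
      unfolding norm_neg by (simp add: algebra_simps)
  qed
  have norm_pos: "norm (of_nat n + of_real l :: complex) = real n + l" for n
    using l norm_of_real[of "real n + l", where 'a = complex] by simp
  have sum_pos: "(\<lambda>n. norm (lambert_pos \<tau> u l n * exp ((of_nat n + of_real l) * z))) summable_on UNIV"
  proof (rule exp_weighted_summable[OF lambert_pos_summable[OF tau l(1)]])
    show "(0 :: real) < 2 * pi * Im \<tau>" using tau by simp
    fix n
    have "(real n + l) * Re z \<le> 0"
      using l z by (intro mult_nonneg_nonpos) auto
    thus "Re ((of_nat n + of_real l) * z) \<le> norm (of_nat n + of_real l :: complex) * 0"
      by (simp add: algebra_simps)
  qed
  have geo: "((\<lambda>n. exp ((of_nat n + of_real l) * z)) has_sum exp (of_real l * z) / (1 - exp z)) UNIV"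
    and geo_summable: "(\<lambda>n. norm (exp ((of_nat n + of_real l) * z))) summable_on UNIV"
  proof -
    have e: "exp ((of_nat n + of_real l) * z) = exp (of_real l * z) * exp z ^ n" for n
      unfolding distrib_right exp_add exp_of_nat_mult by (rule mult.commute)
    have "summable (\<lambda>n. norm (exp (of_real l * z)) * norm (exp z) ^ n)"
      using geo_norm by (intro summable_mult summable_geometric) simp
    hence summ: "summable (\<lambda>n. norm (exp (of_real l * z) * exp z ^ n))"
      by (simp add: norm_mult norm_power)
    show "(\<lambda>n. norm (exp ((of_nat n + of_real l) * z))) summable_on UNIV"
      unfolding e using summ by (subst summable_on_UNIV_nonneg_real_iff) auto
    have "(\<lambda>n. exp (of_real l * z) * exp z ^ n) sums (exp (of_real l * z) * (1 / (1 - exp z)))"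
      by (intro sums_mult geometric_sums geo_norm)
    thus "((\<lambda>n. exp ((of_nat n + of_real l) * z)) has_sum exp (of_real l * z) / (1 - exp z)) UNIV"
      unfolding e using norm_summable_imp_has_sum[OF summ] by simp
  qed
  have f_pos: "f (int n) = exp ((of_nat n + of_real l) * z) + lambert_pos \<tau> u l n * exp ((of_nat n + of_real l) * z)"
    if "u * qpow \<tau> (of_int (int n) + of_real l) \<noteq> 1" for n
    using that by (simp add: f_def lambert_pos_def field_simps)
  show "(\<lambda>k. norm (f k)) summable_on UNIV"
  proof (rule summable_on_int_split)
    show "(\<lambda>n. norm (f (- 1 - int n))) summable_on UNIV"
      unfolding f_neg norm_minus_cancel by (rule sum_neg)
    have "(\<lambda>n. norm (exp ((of_nat n + of_real l) * z)) +
        norm (lambert_pos \<tau> u l n * exp ((of_nat n + of_real l) * z))) summable_on UNIV"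
      by (intro summable_on_add geo_summable sum_pos)
    thus "(\<lambda>n. norm (f (int n))) summable_on UNIV"
    proof (rule summable_on_comparison_test)
      fix n
      show "norm (f (int n)) \<le> norm (exp ((of_nat n + of_real l) * z)) +
        norm (lambert_pos \<tau> u l n * exp ((of_nat n + of_real l) * z))"
      proof (cases "u * qpow \<tau> (of_int (int n) + of_real l) = 1")
        case True
        thus ?thesis by (simp add: f_def)
      next
        case False
        show ?thesis unfolding f_pos[OF False] by (rule norm_triangle_ineq)
      qed
    qed auto
  qed
  assume nonres: "\<And>k::int. u * qpow \<tau> (of_int k + of_real l) \<noteq> 1"
  have "(f has_sum (exp (of_real l * z) / (1 - exp z) + (\<Sum>\<^sub>\<infinity>n. lambert_pos \<tau> u l n * exp ((of_nat n + of_real l) * z))) +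
     - (\<Sum>\<^sub>\<infinity>n. lambert_neg \<tau> u l n * exp (- (of_nat (Suc n) - of_real l) * z))) UNIV"
  proof (rule has_sum_int_split)
    show "((\<lambda>n. f (int n)) has_sum exp (of_real l * z) / (1 - exp z) +
        (\<Sum>\<^sub>\<infinity>n. lambert_pos \<tau> u l n * exp ((of_nat n + of_real l) * z))) UNIV"
      unfolding f_pos[OF nonres] by (intro has_sum_add geo has_sum_infsum abs_summable_summable[OF sum_pos])
    show "((\<lambda>n. f (- 1 - int n)) has_sum
        - (\<Sum>\<^sub>\<infinity>n. lambert_neg \<tau> u l n * exp (- (of_nat (Suc n) - of_real l) * z))) UNIV"
      unfolding f_neg by (intro has_sum_uminusI has_sum_infsum abs_summable_summable[OF sum_neg])
  qed
  hence "kronecker_series \<tau> u l z = - ((exp (of_real l * z) / (1 - exp z) + (\<Sum>\<^sub>\<infinity>n. lambert_pos \<tau> u l n * exp ((of_nat n + of_real l) * z))) +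
     - (\<Sum>\<^sub>\<infinity>n. lambert_neg \<tau> u l n * exp (- (of_nat (Suc n) - of_real l) * z)))"
    unfolding kronecker_series_def f_def by (simp only: infsumI)
  also have "\<dots> = exp (of_real l * z) / (exp z - 1) + lambert_part \<tau> u l z"
  proof -
    have "- (exp (of_real l * z) / (1 - exp z)) = exp (of_real l * z) / (exp z - 1)"
      by (metis minus_diff_eq minus_divide_right)
    thus ?thesis by (simp add: lambert_part_def)
  qed
  finally show "kronecker_series \<tau> u l z = exp (of_real l * z) / (exp z - 1) + lambert_part \<tau> u l z" .
qed

section \<open>Kronecker's formula\<close>

text \<open>
  The Fourier coefficients of the product of the Kronecker series with \<open>theta_odd\<close>.
\<close>
definition kronecker_coeff :: "complex \<Rightarrow> complex \<Rightarrow> real \<Rightarrow> int \<Rightarrow> complex" where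
  "kronecker_coeff \<tau> u l k =
     - (\<Sum>\<^sub>\<infinity>p::int. theta_coeff \<tau> p / (1 - u * qpow \<tau> (of_int (k - p) + of_real l)))"

lemma kronecker_product:
  assumes tau: "Im \<tau> > 0" and l: "0 \<le> l" "l < 1" and u: "u \<noteq> 0"
    and z: "- (2 * pi * Im \<tau>) < Re z" "Re z < 0"
  shows "(\<lambda>p. theta_coeff \<tau> p / (1 - u * qpow \<tau> (of_int (k - p) + of_real l))) summable_on UNIV"
    and "((\<lambda>k. kronecker_coeff \<tau> u l k * exp ((of_int k + of_real l + 1/2) * z)) has_sum
           kronecker_series \<tau> u l z * theta_odd \<tau> z) UNIV"
proof -
  define a where "a = (\<lambda>m::int. - (exp ((of_int m + of_real l) * z) / (1 - u * qpow \<tau> (of_int m + of_real l))))"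
  define b where "b = (\<lambda>p. theta_coeff \<tau> p * exp ((of_int p + 1/2) * z))"
  define g where "g = (\<lambda>k p. theta_coeff \<tau> p / (1 - u * qpow \<tau> (of_int (k - p) + of_real l)))"
  have a: "(\<lambda>m. norm (a m)) summable_on UNIV"
    unfolding a_def norm_minus_cancel by (rule kronecker_terms_abs_summable[OF tau l u z])
  have b: "(\<lambda>p. norm (b p)) summable_on UNIV"
    unfolding b_def by (rule theta_odd_abs_summable[OF tau])
  have ab: "a (k - p) * b p = - g k p * exp ((of_int k + of_real l + 1/2) * z)" for k p
  proof -
    have "exp ((of_int (k - p) + of_real l) * z) * exp ((of_int p + 1/2) * z) = exp ((of_int k + of_real l + 1/2) * z)"
      unfolding exp_add[symmetric] by (rule arg_cong[of _ _ exp]) (simp add: algebra_simps)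
    moreover have "a (k - p) * b p = - g k p * (exp ((of_int (k - p) + of_real l) * z) * exp ((of_int p + 1/2) * z))"
      unfolding a_def b_def g_def by (simp only: divide_inverse mult_minus_left mult_minus_right mult_ac)
    ultimately show ?thesis by (simp only:)
  qed
  have summ: "(\<lambda>p. - g k p * exp ((of_int k + of_real l + 1/2) * z)) summable_on UNIV" for k
    using has_sum_int_convolution(1)[OF a b, of k] unfolding ab .
  hence "(\<lambda>p. (- g k p * exp ((of_int k + of_real l + 1/2) * z)) * (- exp (- ((of_int k + of_real l + 1/2) * z)))) summable_on UNIV" for k
    by (rule summable_on_cmult_left)
  moreover have "(- g k p * exp w) * (- exp (- w)) = g k p" for k p w
    by (simp add: exp_minus)
  ultimately show "g k summable_on UNIV"
    by (simp only:)
  have "(\<Sum>\<^sub>\<infinity>p. a (k - p) * b p) = kronecker_coeff \<tau> u l k * exp ((of_int k + of_real l + 1/2) * z)" for k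
    unfolding ab infsum_cmult_left' infsum_uminus kronecker_coeff_def g_def ..
  moreover have "(\<Sum>\<^sub>\<infinity>m. a m) = kronecker_series \<tau> u l z"
    unfolding a_def infsum_uminus kronecker_series_def ..
  ultimately show "((\<lambda>k. kronecker_coeff \<tau> u l k * exp ((of_int k + of_real l + 1/2) * z)) has_sum
           kronecker_series \<tau> u l z * theta_odd \<tau> z) UNIV"
    using has_sum_int_convolution(2)[OF a b] unfolding theta_odd_eq_infsum b_def[symmetric] by (simp only:)
qed

lemma has_sum_minus:
  fixes f g :: "'i \<Rightarrow> complex"
  assumes "(f has_sum a) A" "(g has_sum b) A"
  shows "((\<lambda>x. f x - g x) has_sum a - b) A"
  using has_sum_add[OF assms(1) has_sum_uminusI[OF assms(2)]] by simp

lemma theta_coeff_abs_summable: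
  assumes tau: "Im \<tau> > 0"
  shows "(\<lambda>p. norm (theta_coeff \<tau> p)) summable_on UNIV"
  using theta_odd_abs_summable[OF tau, of 0] by simp

text \<open>
  Shift the summation index by one, and let \<open>w\<close> be the term \<open>u q\<^sup>k\<^sup>-\<^sup>p\<^sup>+\<^sup>l\<close>.  The recursion of the theta coefficients
  produces a factor \<open>1 / w\<close>, and \<open>1 / (w (1 - w)) = 1 / w + 1 / (1 - w)\<close>.  The sum belonging to \<open>1 / w\<close> is a multiple of
  the value of \<open>theta_odd\<close> at a period, hence \<open>0\<close>.  With division by zero yielding \<open>0\<close>, the partial fraction
  decomposition is off by \<open>1\<close> where \<open>w = 1\<close>; this gives the additional sum.
\<close>
lemma kronecker_coeff_step:
  assumes tau: "Im \<tau> > 0" and l: "0 \<le> l" "l < 1" and u: "u \<noteq> 0"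
  shows "kronecker_coeff \<tau> u l (k + 1) = - (u * qpow \<tau> (of_int (k + 1) + of_real l)) * (kronecker_coeff \<tau> u l k +
     (\<Sum>\<^sub>\<infinity>p. if u * qpow \<tau> (of_int (k - p) + of_real l) = 1 then theta_coeff \<tau> p else 0))"
proof -
  define w where "w = (\<lambda>p. u * qpow \<tau> (of_int (k - p) + of_real l))"
  define c where "c = u * qpow \<tau> (of_int (k + 1) + of_real l)"
  define e where "e = (\<lambda>p. if w p = 1 then theta_coeff \<tau> p else 0)"
  define g where "g = (\<lambda>p. theta_coeff \<tau> p / (1 - w p))"
  define h where "h = (\<lambda>p. theta_coeff \<tau> p / w p)"
  have w: "w p \<noteq> 0" for p using u by (simp add: w_def)
  have "g summable_on UNIV"
    unfolding g_def w_def
    by (rule kronecker_product(1)[OF tau l u, of "of_real (- (pi * Im \<tau>))"]) (use tau in auto)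
  hence g: "(g has_sum - kronecker_coeff \<tau> u l k) UNIV"
    by (simp add: kronecker_coeff_def has_sum_infsum g_def w_def)
  have "(\<lambda>p. norm (e p)) summable_on UNIV"
    by (rule summable_on_comparison_test[OF theta_coeff_abs_summable[OF tau]]) (auto simp: e_def)
  hence e: "(e has_sum (\<Sum>\<^sub>\<infinity>p. e p)) UNIV"
    by (rule has_sum_infsum[OF abs_summable_summable])
  have h: "(h has_sum 0) UNIV"
  proof -
    \<comment> \<open>up to a constant, 1 / w p is the exponential that evaluates the theta series at the period\<close>
    define K where "K = inverse u * qpow \<tau> (- of_int k - of_real l - 1/2)"
    have "h p = K * (theta_coeff \<tau> p * exp ((of_int p + 1/2) * (2 * of_real pi * \<i> * \<tau>)))" for p
    proof -
      have "inverse (w p) = inverse u * qpow \<tau> (- (of_int (k - p) + of_real l))"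
        unfolding w_def qpow_minus by simp
      also have "- (of_int (k - p) + of_real l) = (- of_int k - of_real l - 1/2) + (of_int p + 1/2 :: complex)"
        by simp
      also have "qpow \<tau> \<dots> = qpow \<tau> (- of_int k - of_real l - 1/2) * exp ((of_int p + 1/2) * (2 * of_real pi * \<i> * \<tau>))"
      proof -
        have "qpow \<tau> (of_int p + 1/2) = exp ((of_int p + 1/2) * (2 * of_real pi * \<i> * \<tau>))"
          unfolding qpow_def by (rule arg_cong[of _ _ exp]) (rule mult.commute)
        thus ?thesis by (simp only: qpow_add[of _ "- of_int k - of_real l - 1/2"])
      qed
      finally have inv: "inverse (w p) = inverse u * (qpow \<tau> (- of_int k - of_real l - 1/2) *
          exp ((of_int p + 1/2) * (2 * of_real pi * \<i> * \<tau>)))" .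
      show ?thesis
        unfolding h_def divide_inverse[of "theta_coeff \<tau> p"] inv K_def by (simp only: mult_ac)
    qed
    moreover have "((\<lambda>p. K * (theta_coeff \<tau> p * exp ((of_int p + 1/2) * (2 * of_real pi * \<i> * \<tau>)))) has_sum K * 0) UNIV"
      using theta_odd_has_sum[OF tau, of "2 * of_real pi * \<i> * \<tau>"] unfolding theta_odd_period_tau_0
      by (rule has_sum_cmult_right)
    ultimately show ?thesis by (simp add: has_sum_cong[of UNIV h])
  qed
  have shifted: "theta_coeff \<tau> (p + 1) / (1 - w p) = - c * (h p + g p - e p)" for p
  proof -
    have "w p * qpow \<tau> (of_int p + 1) = c"
      unfolding w_def c_def mult.assoc qpow_add[symmetric] by (rule arg_cong[of _ _ "\<lambda>s. u * qpow \<tau> s"]) simp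
    hence "qpow \<tau> (of_int p + 1) = c / w p"
      using w[of p] by (simp add: field_simps)
    hence "theta_coeff \<tau> (p + 1) = - c * (theta_coeff \<tau> p / w p)"
      by (simp add: theta_coeff_add_1)
    thus ?thesis
      using w[of p] by (cases "w p = 1") (auto simp: h_def g_def e_def divide_simps, simp_all add: algebra_simps)
  qed
  have "((\<lambda>p. - c * (h p + g p - e p)) has_sum - c * (0 + - kronecker_coeff \<tau> u l k - (\<Sum>\<^sub>\<infinity>p. e p))) UNIV"
    by (intro has_sum_cmult_right has_sum_minus has_sum_add h g e)
  hence "(\<Sum>\<^sub>\<infinity>p. theta_coeff \<tau> (p + 1) / (1 - w p)) = - c * (0 + - kronecker_coeff \<tau> u l k - (\<Sum>\<^sub>\<infinity>p. e p))"
    unfolding shifted by (rule infsumI)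
  moreover have "(\<Sum>\<^sub>\<infinity>p. theta_coeff \<tau> p / (1 - u * qpow \<tau> (of_int (k + 1 - p) + of_real l))) =
      (\<Sum>\<^sub>\<infinity>p. theta_coeff \<tau> (p + 1) / (1 - w p))"
    by (rule infsum_reindex_bij_witness[of _ "\<lambda>p. p + 1" "\<lambda>p. p - 1"]) (simp_all add: w_def algebra_simps)
  ultimately have "kronecker_coeff \<tau> u l (k + 1) = - (- c * (0 + - kronecker_coeff \<tau> u l k - (\<Sum>\<^sub>\<infinity>p. e p)))"
    unfolding kronecker_coeff_def by (simp only:)
  thus ?thesis
    unfolding c_def e_def w_def by (simp add: algebra_simps)
qed

lemma int_shift_invariant:
  fixes f :: "int \<Rightarrow> 'a"
  assumes "\<And>k. f (k + 1) = f k"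
  shows "f k = f 0"
proof (induction k rule: int_induct[of _ 0])
  case (step2 i)
  thus ?case using assms[of "i - 1"] by simp
qed (use assms in auto)

text \<open>
  If no \<open>w\<close> equals \<open>1\<close>, the recursion is the one satisfied by the Fourier coefficients of
  \<open>exp (l * z) * theta_odd \<tau> (z + t)\<close>, so the two sequences are proportional.
\<close>
lemma kronecker_product_generic:
  assumes tau: "Im \<tau> > 0" and l: "0 \<le> l" "l < 1" and u: "u \<noteq> 0"
    and nonres: "\<And>k::int. u * qpow \<tau> (of_int k + of_real l) \<noteq> 1"
    and t: "exp t = u * qpow \<tau> (of_real l)"
  obtains C where "\<And>z. - (2 * pi * Im \<tau>) < Re z \<Longrightarrow> Re z < 0 \<Longrightarrow>
     kronecker_series \<tau> u l z * theta_odd \<tau> z = C * (exp (of_real l * z) * theta_odd \<tau> (z + t))"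
proof -
  define r where "r = (\<lambda>k. kronecker_coeff \<tau> u l k / (theta_coeff \<tau> k * exp ((of_int k + 1/2) * t)))"
  have "r (k + 1) = r k" for k
  proof -
    have "kronecker_coeff \<tau> u l (k + 1) = - (u * qpow \<tau> (of_int (k + 1) + of_real l)) * kronecker_coeff \<tau> u l k"
      using kronecker_coeff_step[OF tau l u, of k] nonres[of "k - p" for p] by simp
    also have "u * qpow \<tau> (of_int (k + 1) + of_real l) = exp t * qpow \<tau> (of_int k + 1)"
      unfolding t qpow_add[of _ "of_int (k + 1)"] by simp
    finally have 1: "kronecker_coeff \<tau> u l (k + 1) = - (exp t * qpow \<tau> (of_int k + 1)) * kronecker_coeff \<tau> u l k" .
    have "exp ((of_int (k + 1) + 1/2) * t) = exp t * exp ((of_int k + 1/2) * t)"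
      unfolding exp_add[symmetric] by (rule arg_cong[of _ _ exp]) (simp add: algebra_simps)
    thus ?thesis unfolding r_def theta_coeff_add_1 1 by (simp add: divide_simps)
  qed
  hence r: "r k = r 0" for k by (rule int_shift_invariant)
  have coeff: "kronecker_coeff \<tau> u l k = r 0 * (theta_coeff \<tau> k * exp ((of_int k + 1/2) * t))" for k
    using r[of k] by (simp add: r_def divide_simps)
  show ?thesis
  proof (rule that)
    fix z assume z: "- (2 * pi * Im \<tau>) < Re z" "Re z < 0"
    have "kronecker_coeff \<tau> u l k * exp ((of_int k + of_real l + 1/2) * z) =
        r 0 * exp (of_real l * z) * (theta_coeff \<tau> k * exp ((of_int k + 1/2) * (z + t)))" for k
    proof -
      have "exp ((of_int k + 1/2) * t) * exp ((of_int k + of_real l + 1/2) * z) =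
          exp (of_real l * z) * exp ((of_int k + 1/2) * (z + t))"
        unfolding exp_add[symmetric] by (rule arg_cong[of _ _ exp]) (simp add: algebra_simps)
      thus ?thesis unfolding coeff by (simp only: mult_ac)
    qed
    moreover have "((\<lambda>k. r 0 * exp (of_real l * z) * (theta_coeff \<tau> k * exp ((of_int k + 1/2) * (z + t)))) has_sum
        r 0 * exp (of_real l * z) * theta_odd \<tau> (z + t)) UNIV"
      by (intro has_sum_cmult_right theta_odd_has_sum tau)
    ultimately show "kronecker_series \<tau> u l z * theta_odd \<tau> z = r 0 * (exp (of_real l * z) * theta_odd \<tau> (z + t))"
      using has_sum_unique[OF kronecker_product(2)[OF tau l u z]] by (simp only: mult.assoc)
  qed
qed

lemma qpow_int_eq_1_iff:
  assumes "Im \<tau> > 0"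
  shows "qpow \<tau> (of_int k) = 1 \<longleftrightarrow> k = 0"
proof
  assume "qpow \<tau> (of_int k) = 1"
  hence "exp (- (2 * pi * Im \<tau> * of_int k)) = 1"
    using norm_qpow_real[of \<tau> "of_int k"] by simp
  thus "k = 0" using assms by simp
qed simp

text \<open>
  For \<open>u = 1\<close> and \<open>l = 0\<close> the additional sum in the recursion is a single theta coefficient.  The quotient by the
  theta coefficients therefore increases by \<open>1\<close> in each step, and multiplication of Fourier coefficients by the index is
  differentiation.
\<close>
lemma kronecker_product_resonant:
  assumes tau: "Im \<tau> > 0"
  obtains c where "\<And>z. - (2 * pi * Im \<tau>) < Re z \<Longrightarrow> Re z < 0 \<Longrightarrow>
     kronecker_series \<tau> 1 0 z * theta_odd \<tau> z = theta_odd_deriv \<tau> z + c * theta_odd \<tau> z"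
proof -
  define r where "r = (\<lambda>k. kronecker_coeff \<tau> 1 0 k / theta_coeff \<tau> k - of_int k)"
  have "r (k + 1) = r k" for k
  proof -
    have iff: "qpow \<tau> (of_int k - of_int p) = 1 \<longleftrightarrow> p = k" for p
      using qpow_int_eq_1_iff[OF tau, of "k - p"] by auto
    have "(\<Sum>\<^sub>\<infinity>p. if p = k then theta_coeff \<tau> p else 0) = (\<Sum>\<^sub>\<infinity>p\<in>{k}. theta_coeff \<tau> p)"
      by (rule infsum_cong_neutral) auto
    hence step: "kronecker_coeff \<tau> 1 0 (k + 1) = - qpow \<tau> (of_int k + 1) * (kronecker_coeff \<tau> 1 0 k + theta_coeff \<tau> k)"
      using kronecker_coeff_step[OF tau, of 0 1 k] by (simp add: iff)
    have "kronecker_coeff \<tau> 1 0 (k + 1) / theta_coeff \<tau> (k + 1) =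
        (kronecker_coeff \<tau> 1 0 k + theta_coeff \<tau> k) / theta_coeff \<tau> k"
      unfolding step theta_coeff_add_1 by simp
    thus ?thesis by (simp add: r_def add_divide_distrib)
  qed
  hence "r k = r 0" for k by (rule int_shift_invariant)
  then obtain R where R: "\<And>k. r k = R" by blast
  have coeff: "kronecker_coeff \<tau> 1 0 k = (R + of_int k) * theta_coeff \<tau> k" for k
    using R[of k] by (simp add: r_def field_simps)
  show ?thesis
  proof (rule that)
    fix z assume z: "- (2 * pi * Im \<tau>) < Re z" "Re z < 0"
    have "((\<lambda>k. (R + of_int k) * theta_coeff \<tau> k * exp ((of_int k + of_real 0 + 1/2) * z)) has_sum
           kronecker_series \<tau> 1 0 z * theta_odd \<tau> z) UNIV"
      using kronecker_product(2)[OF tau _ _ _ z, of 0 1] unfolding coeff by simp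
    moreover have "((\<lambda>k. (R - 1/2) * (theta_coeff \<tau> k * exp ((of_int k + 1/2) * z))) has_sum (R - 1/2) * theta_odd \<tau> z) UNIV"
      by (intro has_sum_cmult_right theta_odd_has_sum tau)
    ultimately have "((\<lambda>k. (R + of_int k) * theta_coeff \<tau> k * exp ((of_int k + of_real 0 + 1/2) * z) -
        (R - 1/2) * (theta_coeff \<tau> k * exp ((of_int k + 1/2) * z))) has_sum
        kronecker_series \<tau> 1 0 z * theta_odd \<tau> z - (R - 1/2) * theta_odd \<tau> z) UNIV"
      by (rule has_sum_minus)
    moreover have "(R + of_int k) * theta_coeff \<tau> k * exp ((of_int k + of_real 0 + 1/2) * z) -
        (R - 1/2) * (theta_coeff \<tau> k * exp ((of_int k + 1/2) * z)) =
        theta_coeff \<tau> k * (of_int k + 1/2) * exp ((of_int k + 1/2) * z)" for k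
    proof -
      have "of_int k + of_real 0 + 1/2 = (of_int k + 1/2 :: complex)" by simp
      thus ?thesis by (simp only:) (simp add: ring_distribs)
    qed
    ultimately have "theta_odd_deriv \<tau> z = kronecker_series \<tau> 1 0 z * theta_odd \<tau> z - (R - 1/2) * theta_odd \<tau> z"
      unfolding theta_odd_deriv_def by (simp only: infsumI)
    thus "kronecker_series \<tau> 1 0 z * theta_odd \<tau> z = theta_odd_deriv \<tau> z + (R - 1/2) * theta_odd \<tau> z"
      by simp
  qed
qed

definition lambert_taylor :: "complex \<Rightarrow> complex \<Rightarrow> real \<Rightarrow> nat \<Rightarrow> complex" where
  "lambert_taylor \<tau> u l k = (- (\<Sum>\<^sub>\<infinity>n. lambert_pos \<tau> u l n * (of_nat n + of_real l) ^ k) +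
       (\<Sum>\<^sub>\<infinity>n. lambert_neg \<tau> u l n * (- (of_nat (Suc n) - of_real l)) ^ k)) / fact k"

lemma lambert_part_power_series:
  assumes tau: "Im \<tau> > 0" and l: "0 \<le> l" "l < 1" and z: "norm z < 2 * pi * Im \<tau>"
  shows "(\<lambda>k. lambert_taylor \<tau> u l k * z ^ k) sums lambert_part \<tau> u l z"
proof -
  have "(\<lambda>k. - ((\<Sum>\<^sub>\<infinity>n. lambert_pos \<tau> u l n * (of_nat n + of_real l) ^ k) / fact k * z ^ k) +
        (\<Sum>\<^sub>\<infinity>n. lambert_neg \<tau> u l n * (- (of_nat (Suc n) - of_real l)) ^ k) / fact k * z ^ k) sums lambert_part \<tau> u l z"
    unfolding lambert_part_def
    by (intro sums_add sums_minus exp_sum_power_series[OF lambert_pos_summable[OF tau l(1) z]]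
        exp_sum_power_series[OF lambert_neg_summable[OF tau l(2) z]] order_refl)
  moreover have "- (A / F * Z) + B / F * Z = (- A + B) / F * Z" for A B F Z :: complex
    by (simp add: diff_divide_distrib left_diff_distrib)
  ultimately show ?thesis unfolding lambert_taylor_def by (simp only:)
qed

lemma lambert_part_holomorphic:
  assumes tau: "Im \<tau> > 0" and l: "0 \<le> l" "l < 1"
  shows "lambert_part \<tau> u l holomorphic_on ball 0 (2 * pi * Im \<tau>)"
proof (rule power_series_holomorphic)
  fix z :: complex assume "z \<in> ball 0 (2 * pi * Im \<tau>)"
  hence z: "norm z < 2 * pi * Im \<tau>" by simp
  show "(\<lambda>k. lambert_taylor \<tau> u l k * (z - 0) ^ k) sums lambert_part \<tau> u l z"
    unfolding diff_zero by (rule lambert_part_power_series[OF tau l z])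
qed

text \<open>
  The constant of proportionality is found by multiplying with \<open>z\<close> and letting \<open>z\<close> tend to \<open>0\<close> through the
  negative reals, where the Kronecker series behaves like \<open>1 / z\<close>.
\<close>
lemma kronecker_formula:
  assumes tau: "Im \<tau> > 0" and l: "0 \<le> l" "l < 1" and u: "u = exp (2 * of_real pi * \<i> * of_real \<alpha>)"
    and t: "t = 2 * of_real pi * \<i> * (of_real \<alpha> + of_real l * \<tau>)" and generic: "t \<notin> period_lattice \<tau>"
  shows "\<And>k::int. u * qpow \<tau> (of_int k + of_real l) \<noteq> 1"
    and "\<And>z. - (2 * pi * Im \<tau>) < Re z \<Longrightarrow> Re z < 0 \<Longrightarrow>
      kronecker_series \<tau> u l z = theta_odd_deriv \<tau> 0 / theta_odd \<tau> t * (exp (of_real l * z) * theta_odd \<tau> (z + t)) / theta_odd \<tau> z"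
proof -
  show nonres: "u * qpow \<tau> (of_int k + of_real l) \<noteq> 1" for k :: int
  proof
    assume "u * qpow \<tau> (of_int k + of_real l) = 1"
    moreover have "u * qpow \<tau> (of_int k + of_real l) = exp (t + 2 * of_real pi * \<i> * \<tau> * of_int k)"
      unfolding u t qpow_def exp_add[symmetric] by (rule arg_cong[of _ _ exp]) (simp add: algebra_simps)
    ultimately show False using generic period_latticeI by metis
  qed
  have u0: "u \<noteq> 0" by (simp add: u)
  have et: "exp t = u * qpow \<tau> (of_real l)"
    unfolding u t qpow_def exp_add[symmetric] by (rule arg_cong[of _ _ exp]) (simp add: algebra_simps)
  obtain C where C: "\<And>z. - (2 * pi * Im \<tau>) < Re z \<Longrightarrow> Re z < 0 \<Longrightarrow>
     kronecker_series \<tau> u l z * theta_odd \<tau> z = C * (exp (of_real l * z) * theta_odd \<tau> (z + t))"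
    using kronecker_product_generic[OF tau l u0 nonres et] by blast
  have t0: "theta_odd \<tau> t \<noteq> 0"
    using generic theta_odd_eq_0_imp_period[OF tau] by blast
  have "theta_odd_deriv \<tau> 0 = C * theta_odd \<tau> t"
  proof -
    \<comment> \<open>a sequence in the strip that approaches 0\<close>
    define zs where "zs = (\<lambda>n. of_real (- inverse (real (Suc n))) :: complex)"
    have "(\<lambda>n. - inverse (real (Suc n))) \<longlonglongrightarrow> - 0"
      by (intro tendsto_intros LIMSEQ_inverse_real_of_nat)
    hence zs_lim: "zs \<longlonglongrightarrow> 0"
      unfolding zs_def by (metis minus_zero of_real_0 tendsto_of_real)
    have zs0: "zs n \<noteq> 0" for n unfolding zs_def by (simp del: of_nat_Suc)
    have zs: "filterlim zs (at 0) sequentially"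
      using zs_lim zs0 by (simp add: filterlim_at)
    have 1: "(\<lambda>z. theta_odd \<tau> z / z) \<midarrow>0\<rightarrow> theta_odd_deriv \<tau> 0"
      using theta_odd_has_field_derivative[OF tau, of 0] by (simp add: DERIV_def)
    have 2: "(\<lambda>z. (exp z - 1) / z) \<midarrow>0\<rightarrow> (1 :: complex)"
    proof -
      have "((\<lambda>z. exp z - 1) has_field_derivative 1) (at (0 :: complex))"
        by (auto intro!: derivative_eq_intros)
      thus ?thesis by (simp add: DERIV_def)
    qed
    have "isCont (lambert_part \<tau> u l) 0"
      using holomorphic_on_imp_continuous_on[OF lambert_part_holomorphic[OF tau l]] tau
      by (simp add: continuous_on_eq_continuous_at)
    hence 3: "lambert_part \<tau> u l \<midarrow>0\<rightarrow> lambert_part \<tau> u l 0"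
      by (simp add: isCont_def)
    define L where "L = (\<lambda>z. (exp (of_real l * z) / ((exp z - 1) / z) + z * lambert_part \<tau> u l z) * (theta_odd \<tau> z / z))"
    define R where "R = (\<lambda>z. C * (exp (of_real l * z) * theta_odd \<tau> (z + t)))"
    have lhs: "L \<midarrow>0\<rightarrow> (exp (of_real l * 0) / 1 + 0 * lambert_part \<tau> u l 0) * theta_odd_deriv \<tau> 0"
      unfolding L_def by (intro tendsto_intros 1 2 3) simp
    have rhs: "R \<midarrow>0\<rightarrow> C * (exp (of_real l * 0) * theta_odd \<tau> (0 + t))"
      unfolding R_def by (intro tendsto_intros isCont_tendsto_compose[OF isCont_theta_odd[OF tau]])
    have "eventually (\<lambda>n. zs n \<in> ball 0 (2 * pi * Im \<tau>)) sequentially"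
      using tau by (intro topological_tendstoD[OF zs_lim]) auto
    hence ev: "eventually (\<lambda>n. L (zs n) = R (zs n)) sequentially"
    proof eventually_elim
      case (elim n)
      have Re: "Re (zs n) < 0" by (simp add: zs_def)
      have "- (2 * pi * Im \<tau>) < Re (zs n)"
        using elim abs_Re_le_cmod[of "zs n"] by simp
      note strip = this Re
      have "L (zs n) = kronecker_series \<tau> u l (zs n) * theta_odd \<tau> (zs n)"
        using zs0[of n] unfolding L_def kronecker_series_conv_lambert_part[OF tau l u0 strip nonres] by (simp add: field_simps)
      thus ?case using C[OF strip] by (simp add: R_def)
    qed
    have "(\<lambda>n. R (zs n)) \<longlonglongrightarrow> (exp (of_real l * 0) / 1 + 0 * lambert_part \<tau> u l 0) * theta_odd_deriv \<tau> 0"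
      using filterlim_compose[OF lhs zs] tendsto_cong[OF ev] by blast
    hence "(exp (of_real l * 0) / 1 + 0 * lambert_part \<tau> u l 0) * theta_odd_deriv \<tau> 0 = C * (exp (of_real l * 0) * theta_odd \<tau> (0 + t))"
      using filterlim_compose[OF rhs zs] by (rule LIMSEQ_unique)
    thus ?thesis by simp
  qed
  hence C_eq: "C = theta_odd_deriv \<tau> 0 / theta_odd \<tau> t" using t0 by simp
  fix z assume z: "- (2 * pi * Im \<tau>) < Re z" "Re z < 0"
  have "theta_odd \<tau> z \<noteq> 0"
    using strip_not_period[OF tau z] theta_odd_eq_0_imp_period[OF tau] by blast
  thus "kronecker_series \<tau> u l z = theta_odd_deriv \<tau> 0 / theta_odd \<tau> t * (exp (of_real l * z) * theta_odd \<tau> (z + t)) / theta_odd \<tau> z"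
    using C[OF z] unfolding C_eq by (metis nonzero_mult_div_cancel_right)
qed

text \<open>
  The difference, with its removable singularities removed, vanishes on an open set and hence everywhere.  So \<open>f\<close>
  and \<open>g\<close> agree near every point except perhaps at the point itself, and there the value of a nicely meromorphic
  function is determined by its behaviour nearby.
\<close>
lemma nicely_meromorphic_identity:
  assumes f: "f nicely_meromorphic_on UNIV" and g: "g nicely_meromorphic_on UNIV"
    and A: "open A" "A \<noteq> {}" and eq: "\<And>z. z \<in> A \<Longrightarrow> f z = g z"
  shows "f = g"
proof
  fix z
  define h where "h = remove_sings (\<lambda>z. f z - g z)"
  have mero: "(\<lambda>z. f z - g z) meromorphic_on UNIV"
    using f g by (intro meromorphic_intros) (auto simp: nicely_meromorphic_on_def)
  have h: "h nicely_meromorphic_on UNIV"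
    unfolding h_def by (rule remove_sings_nicely_meromorphic[OF mero])
  have h0: "h w = 0" if "w \<in> A" for w
  proof -
    have "eventually (\<lambda>x. f x - g x = 0) (at w)"
      using eventually_at_in_open'[OF A(1) that] by eventually_elim (simp add: eq)
    hence "(\<lambda>x. f x - g x) \<midarrow>w\<rightarrow> 0"
      by (rule tendsto_eventually)
    thus ?thesis unfolding h_def by (rule remove_sings_eqI)
  qed
  hence "h constant_on A" by (auto simp: constant_on_def)
  hence "h constant_on UNIV"
    using A by (intro constant_on_extend_nicely_meromorphic_on[OF h]) auto
  then obtain c where "\<And>w. h w = c" by (auto simp: constant_on_def)
  hence h_zero: "h w = 0" for w using h0 A(2) by (metis all_not_in_conv)
  have "eventually (\<lambda>w. h w = f w - g w) (at z)"
    unfolding h_def using mero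
    by (intro eventually_remove_sings_eq_at) (auto intro: meromorphic_on_isolated_singularity meromorphic_on_subset)
  hence ev: "eventually (\<lambda>w. f w = g w) (at z)"
    by eventually_elim (simp add: h_zero)
  have pole: "is_pole f z \<longleftrightarrow> is_pole g z"
    by (rule is_pole_cong[OF ev refl])
  show "f z = g z"
  proof (cases "is_pole f z")
    case True
    \<comment> \<open>both functions take the value 0 at a pole\<close>
    have no_lim: "\<not> k \<midarrow>z\<rightarrow> c" if "is_pole k z" for k :: "complex \<Rightarrow> complex" and c
      using that by (metis at_neq_bot is_pole_def not_tendsto_and_filterlim_at_infinity)
    show ?thesis
      using f g True pole no_lim unfolding nicely_meromorphic_on_def by (metis UNIV_I)
  next
    case False
    hence "f \<midarrow>z\<rightarrow> f z" "g \<midarrow>z\<rightarrow> g z"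
      using f g pole unfolding nicely_meromorphic_on_def by blast+
    moreover have "f \<midarrow>z\<rightarrow> g z"
      using \<open>g \<midarrow>z\<rightarrow> g z\<close> tendsto_cong[OF ev] by blast
    ultimately show ?thesis using LIM_unique by blast
  qed
qed

text \<open>
  A quotient of an entire function by \<open>theta_odd\<close> that agrees with the series in the strip is, after its removable
  singularities are removed, the continuation described by the definition.  Outside the period lattice the
  quotient is analytic, so its values are not affected.
\<close>
lemma deformed_P1_eqI:
  assumes tau: "Im \<tau> > 0" and f: "f holomorphic_on UNIV"
    and strip: "\<And>z. - (2 * pi * Im \<tau>) < Re z \<Longrightarrow> Re z < 0 \<Longrightarrow> deformed_P1_series \<theta> \<phi> \<tau> z = f z / theta_odd \<tau> z"
    and z: "z \<notin> period_lattice \<tau>"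
  shows "deformed_P1 \<theta> \<phi> \<tau> z = f z / theta_odd \<tau> z"
proof -
  define K where "K = (\<lambda>z. f z / theta_odd \<tau> z)"
  have theta: "theta_odd \<tau> holomorphic_on UNIV"
    by (rule theta_odd_holomorphic[OF tau])
  have "K meromorphic_on UNIV"
    unfolding K_def using f theta
    by (intro meromorphic_intros analytic_on_imp_meromorphic_on) (auto simp: analytic_on_open)
  hence nice: "remove_sings K nicely_meromorphic_on UNIV"
    by (rule remove_sings_nicely_meromorphic)
  have K: "remove_sings K w = K w" if "w \<notin> period_lattice \<tau>" for w
  proof (rule remove_sings_at_analytic)
    have "theta_odd \<tau> w \<noteq> 0"
      using that theta_odd_eq_0_imp_period[OF tau] by blast
    moreover have "f analytic_on {w}" "theta_odd \<tau> analytic_on {w}"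
      using f theta by (auto simp: analytic_on_open intro: analytic_on_subset[of _ UNIV])
    ultimately show "K analytic_on {w}"
      unfolding K_def by (intro analytic_intros) auto
  qed
  define A where "A = {z. - (2 * pi * Im \<tau>) < Re z \<and> Re z < 0}"
  have A: "open A"
    unfolding A_def by (intro open_Collect_conj open_Collect_less continuous_intros)
  have "of_real (- (pi * Im \<tau>)) \<in> A"
    using tau by (simp add: A_def)
  hence A': "A \<noteq> {}" by blast
  have cond: "norm (exp (2 * of_real pi * \<i> * \<tau>)) < norm (exp z) \<and> norm (exp z) < 1 \<longleftrightarrow> z \<in> A" for z
    by (simp add: A_def)
  have K_strip: "remove_sings K z = deformed_P1_series \<theta> \<phi> \<tau> z" if "z \<in> A" for z
    using that strip[of z] K[OF strip_not_period[OF tau, of z]] by (simp add: A_def K_def)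
  have "deformed_P1 \<theta> \<phi> \<tau> = remove_sings K"
    unfolding deformed_P1_def cond
  proof (rule the_equality)
    show "remove_sings K nicely_meromorphic_on UNIV \<and>
      (\<forall>z. z \<in> A \<longrightarrow> remove_sings K z = deformed_P1_series \<theta> \<phi> \<tau> z)"
      using nice K_strip by blast
    fix g assume g: "g nicely_meromorphic_on UNIV \<and> (\<forall>z. z \<in> A \<longrightarrow> g z = deformed_P1_series \<theta> \<phi> \<tau> z)"
    show "g = remove_sings K"
      by (rule nicely_meromorphic_identity[OF _ nice A A']) (use g K_strip in auto)
  qed
  thus ?thesis using K[OF z] by (simp add: K_def)
qed

lemma char_exponent_eqI:
  assumes "0 \<le> l" "l < 1" "\<phi> = exp (2 * of_real pi * \<i> * of_real l)"
  shows "char_exponent \<phi> = l"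
  unfolding char_exponent_def
proof (rule the_equality)
  fix k assume k: "0 \<le> k \<and> k < 1 \<and> \<phi> = exp (2 * of_real pi * \<i> * of_real k)"
  have "exp (2 * of_real pi * \<i> * of_real k) = exp (2 * of_real pi * \<i> * of_real l)"
    using k assms by simp
  then obtain n :: int where n: "2 * of_real pi * \<i> * of_real k = 2 * of_real pi * \<i> * of_real l + of_int (2 * n) * of_real pi * \<i>"
    unfolding exp_eq by auto
  have "2 * pi * k = 2 * pi * l + 2 * of_int n * pi"
    using arg_cong[OF n, of Im] by simp
  hence "2 * pi * (k - l - of_int n) = 0" by (simp add: algebra_simps)
  hence "k - l = of_int n" by simp
  moreover have "\<bar>k - l\<bar> < 1" using k assms by linarith
  ultimately have "n = 0" by linarith
  thus "k = l" using \<open>k - l = of_int n\<close> by simp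
qed (use assms in auto)

lemma deformed_P1_series_eq_kronecker_series:
  assumes l: "char_exponent \<phi> = l" and l1: "\<phi> = 1 \<Longrightarrow> l = 0"
  shows "deformed_P1_series \<theta> \<phi> \<tau> z = kronecker_series \<tau> (inverse \<theta>) l z"
proof -
  define F where "F = (\<lambda>m::real. exp (of_real m * z) / (1 - inverse \<theta> * exp (2 * of_real pi * \<i> * \<tau> * of_real m)))"
  have "infsum F ({real_of_int k + l | k. True} - (if (\<theta>, \<phi>) = (1, 1) then {0} else {})) = infsum F {real_of_int k + l | k. True}"
    by (rule infsum_cong_neutral) (auto simp: F_def split: if_splits)
  also have "\<dots> = infsum F (range (\<lambda>k. real_of_int k + l))"
    by (rule arg_cong[of _ _ "infsum F"]) auto
  also have "\<dots> = (\<Sum>\<^sub>\<infinity>k. F (real_of_int k + l))"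
    by (subst infsum_reindex) (auto simp: inj_on_def o_def)
  finally show ?thesis
    unfolding deformed_P1_series_def kronecker_series_def l F_def qpow_def by simp
qed

section \<open>Determinants of deformed Weierstrass functions\<close>

lemma theta_char_shift_int: "theta_char (a + of_int k) b z \<tau> = theta_char a b z \<tau>"
  unfolding theta_char_def
  by (rule infsum_reindex_bij_witness[of _ "\<lambda>m. m - k" "\<lambda>m. m + k"]) (simp_all add: add_ac)

text \<open>
  Changing the characteristics amounts to completing the square: \<open>(m + 1/2 + l)\<^sup>2\<close> differs from
  \<open>(m + 1/2)\<^sup>2\<close> by a term linear in \<open>m + 1/2\<close>, which shifts the argument, and a constant.
\<close>
lemma theta_char_conv_theta_odd:
  assumes t: "t = 2 * of_real pi * \<i> * (of_real \<alpha> + of_real l * \<tau>)"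
  shows "theta_char (1/2 + l) (1/2 + \<alpha>) z \<tau> =
     exp (\<i> * of_real pi * (of_real l)\<^sup>2 * \<tau> + of_real l * (2 * of_real pi * \<i> * of_real (1/2 + \<alpha>))) *
     (exp (of_real l * z) * theta_odd \<tau> (z + t))"
proof -
  define h :: complex where "h = 1/2"
  have h: "of_real (1/2 + l) = h + of_real l" "of_real (1/2 + \<alpha>) = h + of_real \<alpha>" "1/2 = h" "2 * h = 1"
    by (simp_all add: h_def)
  have "exp (\<i> * of_real pi * (of_int m + (h + of_real l))\<^sup>2 * \<tau> + (of_int m + (h + of_real l)) * (z + 2 * of_real pi * \<i> * (h + of_real \<alpha>))) =
    exp (\<i> * of_real pi * (of_real l)\<^sup>2 * \<tau> + of_real l * (2 * of_real pi * \<i> * (h + of_real \<alpha>))) * exp (of_real l * z) *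
    (theta_coeff \<tau> m * exp ((of_int m + h) * (z + t)))" for m
  proof -
    define s where "s = of_int m + h"
    have s: "of_int m + (h + of_real l) = s + of_real l" by (simp add: s_def add_ac)
    have pih: "2 * of_real pi * \<i> * (h + of_real \<alpha>) = \<i> * of_real pi * (2 * h) + 2 * of_real pi * \<i> * of_real \<alpha>"
      by (simp add: algebra_simps)
    show ?thesis
      unfolding theta_coeff_def h(3) s s_def[symmetric] exp_add[symmetric] t pih h(4)
      by (rule arg_cong[of _ _ exp]) (simp add: power2_eq_square algebra_simps)
  qed
  hence "theta_char (1/2 + l) (1/2 + \<alpha>) z \<tau> = (\<Sum>\<^sub>\<infinity>m. exp (\<i> * of_real pi * (of_real l)\<^sup>2 * \<tau> + of_real l * (2 * of_real pi * \<i> * (h + of_real \<alpha>))) * exp (of_real l * z) *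
    (theta_coeff \<tau> m * exp ((of_int m + h) * (z + t))))"
    unfolding theta_char_def h by simp
  thus ?thesis
    unfolding infsum_cmult_right' theta_odd_eq_infsum h by (simp only: mult.assoc)
qed

lemma prod_triangle_minus_1: "(\<Prod>i<N. \<Prod>k\<in>{i<..<N}. - 1 :: complex) = (- 1) ^ (N choose 2)"
proof (induction N)
  case (Suc N)
  have "Suc N choose 2 = N + (N choose 2)" by (simp add: numeral_2_eq_2)
  thus ?case unfolding prod_triangle_Suc Suc by (simp add: power_add)
qed (simp add: binomial_eq_0)

lemma cauchy_factor_conv_big_theta:
  "cauchy_factor (theta_odd \<tau>) N x y = (- 1) ^ (N choose 2) * inverse (big_theta N x y \<tau>)"
proof -
  have "theta_odd \<tau> (x i - x k) * theta_odd \<tau> (y k - y i) =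
      - 1 * (theta_odd \<tau> (x i - x k) * theta_odd \<tau> (y i - y k))" for i k
    using theta_odd_minus[of \<tau> "y i - y k"] by simp
  thus ?thesis
    unfolding cauchy_factor_def big_theta_def theta_odd_def[symmetric]
    by (simp only: prod.distrib prod_triangle_minus_1 inverse_divide times_divide_eq_right)
qed

lemma big_theta_nonzero:
  assumes tau: "Im \<tau> > 0" and gen: "generic_points N x y \<tau>"
  shows "big_theta N x y \<tau> \<noteq> 0"
proof -
  have "theta_odd \<tau> (x i - y j) \<noteq> 0" if "i < N" "j < N" for i j
    using gen that theta_odd_eq_0_imp_period[OF tau, of "x i - y j"] by (auto simp: generic_points_def)
  thus ?thesis
    using gen by (auto simp: big_theta_def generic_points_def theta_odd_def)
qed

lemma theta_odd_three_term:
  assumes "Im \<tau> > 0"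
  shows "theta_odd \<tau> (x - y + t) * theta_odd \<tau> (x' - y' + t) * (theta_odd \<tau> (x - y') * theta_odd \<tau> (x' - y)) -
         theta_odd \<tau> (x - y' + t) * theta_odd \<tau> (x' - y + t) * (theta_odd \<tau> (x - y) * theta_odd \<tau> (x' - y')) =
         theta_odd \<tau> t * theta_odd \<tau> (t + (x - y) + (x' - y')) * (theta_odd \<tau> (x - x') * theta_odd \<tau> (y' - y))"
  by (rule three_term_identity) (rule theta_odd_product_formula[OF assms])

text \<open>
  The exponential \<open>exp (l * (x\<^sub>i - y\<^sub>j))\<close> splits into a row factor and a column factor, so Frobenius' formula applies.
\<close>
lemma det_P_matrix:
  assumes tau: "Im \<tau> > 0" and N: "N > 0" and gen: "generic_points N x y \<tau>"
    and P: "\<And>z. z \<notin> period_lattice \<tau> \<Longrightarrow> deformed_P1 \<theta> \<phi> \<tau> z =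
       theta_odd_deriv \<tau> 0 / theta_odd \<tau> t * (exp (of_real l * z) * theta_odd \<tau> (z + t)) / theta_odd \<tau> z"
    and t: "theta_odd \<tau> t \<noteq> 0"
  shows "Determinant.det (P_matrix N \<theta> \<phi> x y \<tau>) = theta_odd_deriv \<tau> 0 ^ N *
     (exp (of_real l * (\<Sum>i<N. x i - y i)) * theta_odd \<tau> ((\<Sum>i<N. x i - y i) + t) / theta_odd \<tau> t) *
     ((- 1) ^ (N choose 2) * inverse (big_theta N x y \<tau>))"
proof -
  define S where "S = (\<Sum>i<N. x i - y i)"
  define c where "c = theta_odd_deriv \<tau> 0 / theta_odd \<tau> t"
  obtain M where M: "N = Suc M" using N by (cases N) auto
  have "P_matrix N \<theta> \<phi> x y \<tau> = Matrix.mat N N (\<lambda>(i, j).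
      (c * exp (of_real l * x i)) * exp (- (of_real l * y j)) * (theta_odd \<tau> (x i - y j + t) / theta_odd \<tau> (x i - y j)))"
  proof (rule eq_matI)
    fix i j assume "i < dim_row (Matrix.mat N N (\<lambda>(i, j).
      (c * exp (of_real l * x i)) * exp (- (of_real l * y j)) * (theta_odd \<tau> (x i - y j + t) / theta_odd \<tau> (x i - y j))))"
      "j < dim_col (Matrix.mat N N (\<lambda>(i, j).
      (c * exp (of_real l * x i)) * exp (- (of_real l * y j)) * (theta_odd \<tau> (x i - y j + t) / theta_odd \<tau> (x i - y j))))"
    hence ij: "i < N" "j < N" by simp_all
    have "exp (of_real l * (x i - y j)) = exp (of_real l * x i) * exp (- (of_real l * y j))"
      unfolding exp_add[symmetric] by (simp add: algebra_simps)
    moreover have "x i - y j \<notin> period_lattice \<tau>"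
      using gen ij by (simp add: generic_points_def)
    ultimately show "P_matrix N \<theta> \<phi> x y \<tau> $$ (i, j) = Matrix.mat N N (\<lambda>(i, j).
      (c * exp (of_real l * x i)) * exp (- (of_real l * y j)) * (theta_odd \<tau> (x i - y j + t) / theta_odd \<tau> (x i - y j))) $$ (i, j)"
      using ij by (simp add: P_matrix_def P c_def)
  qed (simp_all add: P_matrix_def)
  hence "Determinant.det (P_matrix N \<theta> \<phi> x y \<tau>) =
     (\<Prod>i<N. c * exp (of_real l * x i)) * (\<Prod>j<N. exp (- (of_real l * y j))) *
     Determinant.det (Matrix.mat N N (\<lambda>(i, j). theta_odd \<tau> (x i - y j + t) / theta_odd \<tau> (x i - y j)))"
    by (simp only: det_scale_rows_cols)
  also have "(\<Prod>i<N. c * exp (of_real l * x i)) * (\<Prod>j<N. exp (- (of_real l * y j))) = c ^ N * exp (of_real l * S)"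
  proof -
    have "(\<Prod>i<N. c * exp (of_real l * x i)) * (\<Prod>j<N. exp (- (of_real l * y j))) =
       c ^ N * (\<Prod>i<N. exp (of_real l * x i) * exp (- (of_real l * y i)))"
      by (simp add: prod.distrib)
    also have "(\<Prod>i<N. exp (of_real l * x i) * exp (- (of_real l * y i))) = (\<Prod>i<N. exp (of_real l * (x i - y i)))"
      unfolding exp_add[symmetric] by (simp add: algebra_simps)
    also have "\<dots> = exp (of_real l * S)"
      by (simp add: S_def sum_distrib_left exp_sum)
    finally show ?thesis .
  qed
  also have "Determinant.det (Matrix.mat N N (\<lambda>(i, j). theta_odd \<tau> (x i - y j + t) / theta_odd \<tau> (x i - y j))) =
      theta_odd \<tau> t ^ M * theta_odd \<tau> (t + S) * cauchy_factor (theta_odd \<tau>) N x y"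
    unfolding M S_def
  proof (rule frobenius_determinant[OF theta_odd_three_term[OF tau] _ theta_odd_isolated_zeros[OF tau]])
    show "isCont (theta_odd \<tau>) z" for z
      by (rule isCont_theta_odd[OF tau])
    show "theta_odd \<tau> (x i - y j) \<noteq> 0" if "i \<le> M" "j \<le> M" for i j
      using gen that theta_odd_eq_0_imp_period[OF tau, of "x i - y j"] by (auto simp: generic_points_def M)
  qed
  also have "c ^ N * exp (of_real l * S) * (theta_odd \<tau> t ^ M * theta_odd \<tau> (t + S) * cauchy_factor (theta_odd \<tau>) N x y) =
    (c ^ N * theta_odd \<tau> t ^ M) * (exp (of_real l * S) * theta_odd \<tau> (S + t) * cauchy_factor (theta_odd \<tau>) N x y)"
    by (simp only: mult_ac add.commute)
  also have "c ^ N * theta_odd \<tau> t ^ M = theta_odd_deriv \<tau> 0 ^ N / theta_odd \<tau> t"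
    using t by (simp add: c_def M power_divide)
  finally show ?thesis
    by (simp add: cauchy_factor_conv_big_theta S_def)
qed

lemma det_Q_matrix:
  assumes tau: "Im \<tau> > 0" and gen: "generic_points (Suc N) x y \<tau>"
  shows "Determinant.det (Q_matrix (Suc N) x y \<tau>) =
     - (theta_odd_deriv \<tau> 0 ^ N * theta_odd \<tau> (\<Sum>i<Suc N. x i - y i) * ((- 1) ^ (Suc N choose 2) * inverse (big_theta (Suc N) x y \<tau>)))"
proof -
  have deriv: "(theta_odd \<tau> has_field_derivative theta_odd_deriv \<tau> z) (at z)" for z
    by (rule theta_odd_has_field_derivative[OF tau])
  obtain c where c: "\<And>z. - (2 * pi * Im \<tau>) < Re z \<Longrightarrow> Re z < 0 \<Longrightarrow>
     kronecker_series \<tau> 1 0 z * theta_odd \<tau> z = theta_odd_deriv \<tau> z + c * theta_odd \<tau> z"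
    using kronecker_product_resonant[OF tau] by blast
  have nz: "theta_odd \<tau> z \<noteq> 0" if "z \<notin> period_lattice \<tau>" for z
    using that theta_odd_eq_0_imp_period[OF tau] by blast
  have char: "char_exponent 1 = 0" by (rule char_exponent_eqI) auto
  have P: "deformed_P1 1 1 \<tau> z = theta_odd_deriv \<tau> z / theta_odd \<tau> z + c" if z: "z \<notin> period_lattice \<tau>" for z
  proof -
    have "deriv (theta_odd \<tau>) holomorphic_on UNIV"
      by (intro holomorphic_deriv theta_odd_holomorphic[OF tau]) auto
    moreover have "deriv (theta_odd \<tau>) = theta_odd_deriv \<tau>"
      using deriv by (auto intro: DERIV_imp_deriv)
    ultimately have holo: "(\<lambda>z. theta_odd_deriv \<tau> z + c * theta_odd \<tau> z) holomorphic_on UNIV"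
      by (intro holomorphic_intros theta_odd_holomorphic[OF tau]) auto
    have "deformed_P1 1 1 \<tau> z = (theta_odd_deriv \<tau> z + c * theta_odd \<tau> z) / theta_odd \<tau> z"
    proof (rule deformed_P1_eqI[OF tau holo _ z])
      fix w assume w: "- (2 * pi * Im \<tau>) < Re w" "Re w < 0"
      have "deformed_P1_series 1 1 \<tau> w = kronecker_series \<tau> 1 0 w"
        using deformed_P1_series_eq_kronecker_series[OF char, of 1 \<tau> w] by simp
      thus "deformed_P1_series 1 1 \<tau> w = (theta_odd_deriv \<tau> w + c * theta_odd \<tau> w) / theta_odd \<tau> w"
        using c[OF w] nz[OF strip_not_period[OF tau w]] by (simp add: field_simps)
    qed
    thus ?thesis using nz[OF z] by (simp add: add_divide_distrib)
  qed
  have "P_matrix (Suc N) 1 1 x y \<tau> = Matrix.mat (Suc N) (Suc N) (\<lambda>(i, j). theta_odd_deriv \<tau> (x i - y j) / theta_odd \<tau> (x i - y j) + c)"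
    using gen by (auto simp: P_matrix_def generic_points_def P intro!: eq_matI)
  hence "Determinant.det (Q_matrix (Suc N) x y \<tau>) = Determinant.det (four_block_mat
           (Matrix.mat (Suc N) (Suc N) (\<lambda>(i, j). theta_odd_deriv \<tau> (x i - y j) / theta_odd \<tau> (x i - y j) + c))
           (Matrix.mat (Suc N) 1 (\<lambda>_. 1)) (Matrix.mat 1 (Suc N) (\<lambda>_. 1)) (0\<^sub>m 1 1))"
    by (simp only: Q_matrix_def)
  also have "\<dots> = - (theta_odd_deriv \<tau> 0 ^ N * theta_odd \<tau> (\<Sum>i<Suc N. x i - y i) * cauchy_factor (theta_odd \<tau>) (Suc N) x y)"
  proof (rule frobenius_determinant_bordered[OF theta_odd_three_term[OF tau] deriv theta_odd_0
        theta_odd_deriv_0_nonzero[OF tau] theta_odd_isolated_zeros[OF tau]])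
    show "theta_odd \<tau> (x i - y j) \<noteq> 0" if "i \<le> N" "j \<le> N" for i j
      using gen that nz[of "x i - y j"] by (auto simp: generic_points_def)
  qed
  finally show ?thesis
    by (simp only: cauchy_factor_conv_big_theta)
qed

section \<open>Laurent expansion in terms of Eisenstein series\<close>

text \<open>
  Evaluating a Taylor series at \<open>z\<close> needs a disc around \<open>0\<close> of radius larger than \<open>\<bar>z\<bar>\<close>.  It exists because the closed disc of radius
  \<open>\<bar>z\<bar>\<close> is compact and contained in the open set of points where \<open>theta_odd\<close> does not vanish, extended by \<open>0\<close>, which is an isolated zero.
\<close>
lemma ball_avoiding_zeros:
  fixes z :: complex
  assumes tau: "Im \<tau> > 0" and dist: "\<And>w. w \<in> period_lattice \<tau> - {0} \<Longrightarrow> norm z < norm w"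
  obtains r where "norm z < r" "\<And>w. norm w < r \<Longrightarrow> w \<noteq> 0 \<Longrightarrow> theta_odd \<tau> w \<noteq> 0"
proof -
  obtain T where T: "open T" "0 \<in> T" "\<And>w. w \<in> T \<Longrightarrow> w \<noteq> 0 \<Longrightarrow> theta_odd \<tau> w \<noteq> 0"
    using theta_odd_isolated_zeros[OF tau, of 0] by (auto simp: eventually_at_topological)
  define S where "S = T \<union> {w. theta_odd \<tau> w \<noteq> 0}"
  have S: "open S"
    unfolding S_def
    by (intro open_Un T open_Collect_neq continuous_intros holomorphic_on_imp_continuous_on theta_odd_holomorphic[OF tau])
  have "cball 0 (norm z) \<subseteq> S"
    using dist theta_odd_eq_0_imp_period[OF tau] T(2) by (force simp: S_def)
  then obtain e where e: "e > 0" "(\<Union>w\<in>cball 0 (norm z). cball w e) \<subseteq> S"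
    using compact_subset_open_imp_cball_epsilon_subset[OF compact_cball S] by blast
  show ?thesis
  proof (rule that[of "norm z + e"])
    fix w :: complex assume w: "norm w < norm z + e" "w \<noteq> 0"
    have "w \<in> S"
    proof (cases "norm w \<le> norm z")
      case True
      thus ?thesis using \<open>cball 0 (norm z) \<subseteq> S\<close> by auto
    next
      case False
      define v where "v = of_real (norm z / norm w) * w"
      have v: "norm v = norm z" using w by (simp add: v_def norm_mult norm_divide)
      have "w - v = of_real (1 - norm z / norm w) * w" by (simp add: v_def algebra_simps)
      hence "norm (w - v) = \<bar>1 - norm z / norm w\<bar> * norm w"
        by (simp only: norm_mult norm_of_real)
      also have "\<bar>1 - norm z / norm w\<bar> = 1 - norm z / norm w"
        using False by (simp add: divide_le_eq)
      also have "(1 - norm z / norm w) * norm w = norm w - norm z"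
        using w(2) by (simp add: left_diff_distrib)
      also have "\<dots> \<le> e" using w(1) by simp
      finally have "w \<in> cball v e" by (simp add: dist_norm norm_minus_commute)
      thus ?thesis using e(2) v by force
    qed
    thus "theta_odd \<tau> w \<noteq> 0" using T(3) w(2) by (auto simp: S_def)
  qed (use e in simp)
qed

text \<open>
  The coefficients of \<open>b\<close> are compared with the formal Laurent series that defines the Bernoulli polynomials, by
  uniqueness of Laurent expansions.  The polar part of that series is the subtracted \<open>1 / w\<close>.
\<close>
lemma bernoulli_generating_function:
  obtains b where "b holomorphic_on ball 0 1"
    "\<And>w. norm w < 1 \<Longrightarrow> w \<noteq> 0 \<Longrightarrow> b w = exp (s * w) / (exp w - 1) - 1 / w"
    "\<And>k. fps_nth (fps_expansion b 0) k = bernoulli_poly (k + 1) s / fact (k + 1)"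
proof -
  define E where "E = (\<lambda>w::complex. if w = 0 then deriv exp 0 else (exp w - exp 0) / (w - 0))"
  define \<kappa> where "\<kappa> = (\<lambda>w. exp (s * w) / E w)"
  define b where "b = (\<lambda>w. if w = 0 then deriv \<kappa> 0 else (\<kappa> w - \<kappa> 0) / (w - 0))"
  have E0: "E 0 = 1" using DERIV_imp_deriv[OF DERIV_exp, of "0 :: complex"] by (simp add: E_def)
  have E: "E holomorphic_on ball 0 1"
    unfolding E_def by (rule pole_lemma_open) (auto intro: holomorphic_intros)
  have exp_ne: "exp w \<noteq> 1" if "norm w < 1" "w \<noteq> 0" for w :: complex
  proof
    assume "exp w = 1"
    then obtain n :: int where n: "Re w = 0" "Im w = of_int (2 * n) * pi"
      unfolding exp_eq_1 by blast
    have "\<bar>Im w\<bar> < 1" using that(1) abs_Im_le_cmod[of w] by simp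
    have "n = 0"
    proof (rule ccontr)
      assume "n \<noteq> 0"
      hence "1 \<le> \<bar>real_of_int (2 * n)\<bar>" by simp
      hence "1 * pi \<le> \<bar>real_of_int (2 * n)\<bar> * pi" by (intro mult_right_mono) auto
      hence "pi \<le> \<bar>Im w\<bar>" by (simp add: n(2) abs_mult)
      thus False using \<open>\<bar>Im w\<bar> < 1\<close> pi_gt3 by simp
    qed
    thus False using n that(2) by (simp add: complex_eq_iff)
  qed
  have E_nz: "E w \<noteq> 0" if "norm w < 1" for w
    using exp_ne[OF that] E0 by (cases "w = 0") (auto simp: E_def)
  have "\<kappa> holomorphic_on ball 0 1"
    unfolding \<kappa>_def using E_nz by (intro holomorphic_intros E) auto
  hence b: "b holomorphic_on ball 0 1"
    unfolding b_def by (rule pole_lemma_open) auto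
  have \<kappa>0: "\<kappa> 0 = 1" by (simp add: \<kappa>_def E0)
  have b_eq: "b w = exp (s * w) / (exp w - 1) - 1 / w" if "norm w < 1" "w \<noteq> 0" for w
    using exp_ne[OF that] that unfolding b_def \<kappa>0 by (simp add: \<kappa>_def E_def field_simps)
  define L where "L = fps_to_fls (fps_exp s) / (fps_to_fls (fps_exp 1) - 1)"
  have laurent: "(\<lambda>w. exp (s * w) / (exp (1 * w) - 1) - inverse w) has_laurent_expansion (L - fls_X_inv)"
    unfolding L_def
    by (intro has_laurent_expansion_diff has_laurent_expansion_divide has_laurent_expansion_fps
        has_laurent_expansion_1 has_fps_expansion_exp has_laurent_expansion_fls_X_inv)
  have "eventually (\<lambda>w. exp (s * w) / (exp (1 * w) - 1) - inverse w = b w) (at 0)"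
    unfolding eventually_at by (intro exI[of _ 1]) (auto simp: b_eq inverse_eq_divide)
  hence "b has_laurent_expansion (L - fls_X_inv)"
    using laurent by (rule has_laurent_expansion_cong[OF _ refl, THEN iffD1])
  moreover have "b has_laurent_expansion fps_to_fls (fps_expansion b 0)"
    by (intro has_laurent_expansion_fps has_fps_expansion_fps_expansion[of "ball 0 1"] b) auto
  ultimately have fls: "fps_to_fls (fps_expansion b 0) = L - fls_X_inv"
    using has_laurent_expansion_unique by blast
  have "fps_nth (fps_expansion b 0) k = bernoulli_poly (k + 1) s / fact (k + 1)" for k
  proof -
    have "fps_nth (fps_expansion b 0) k = fls_nth (fps_to_fls (fps_expansion b 0)) (int k)"
      by simp
    also have "\<dots> = fls_nth L (int k)"
      unfolding fls by simp
    also have "\<dots> = bernoulli_poly (k + 1) s / fact (k + 1)"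
      by (simp add: bernoulli_poly_def L_def del: fact_Suc)
    finally show ?thesis .
  qed
  thus ?thesis using that b b_eq by blast
qed

text \<open>
  The alternating sign in the Eisenstein series is that of the powers of the negative exponents \<open>- (r - l)\<close>.
\<close>
lemma deformed_eisenstein_conv_lambert:
  assumes l: "char_exponent \<phi> = l" and ne: "(\<theta>, \<phi>) \<noteq> (1, 1)"
  shows "deformed_eisenstein (k + 1) \<theta> \<phi> \<tau> =
     - (bernoulli_poly (k + 1) (of_real l) / fact (k + 1) + lambert_taylor \<tau> (inverse \<theta>) l k)"
proof -
  define q where "q = (\<lambda>s::real. exp (2 * of_real pi * \<i> * \<tau> * of_real s))"
  define A where "A = (\<Sum>\<^sub>\<infinity>r \<in> {0::nat..}. of_real ((real r + l) ^ k) * inverse \<theta> * q (real r + l) / (1 - inverse \<theta> * q (real r + l)))"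
  define B where "B = (\<Sum>\<^sub>\<infinity>r \<in> {1::nat..}. of_real ((real r - l) ^ k) * \<theta> * q (real r - l) / (1 - \<theta> * q (real r - l)))"
  have "deformed_eisenstein (k + 1) \<theta> \<phi> \<tau> = - bernoulli_poly (k + 1) (of_real l) / fact (k + 1) + 1 / fact k * A + (- 1) ^ (k + 1) / fact k * B"
    unfolding deformed_eisenstein_def Let_def l A_def B_def q_def if_not_P[OF ne] Diff_empty diff_add_inverse2 add_diff_cancel_right' ..
  also have "A = (\<Sum>\<^sub>\<infinity>n. lambert_pos \<tau> (inverse \<theta>) l n * (of_nat n + of_real l) ^ k)"
    unfolding A_def atLeast_0 by (intro infsum_cong) (simp add: lambert_pos_def q_def qpow_def mult_ac)
  also have "B = (\<Sum>\<^sub>\<infinity>n. lambert_neg \<tau> (inverse \<theta>) l n * (of_nat (Suc n) - of_real l) ^ k)"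
    unfolding B_def
    by (rule infsum_reindex_bij_witness[of _ Suc "\<lambda>r. r - 1"]) (auto simp: lambert_neg_def q_def qpow_def mult_ac)
  also have "(- 1) ^ (k + 1) / fact k * \<dots> = - ((\<Sum>\<^sub>\<infinity>n. lambert_neg \<tau> (inverse \<theta>) l n * (- (of_nat (Suc n) - of_real l)) ^ k) / fact k)"
  proof -
    have "(- (of_nat (Suc n) - of_real l)) ^ k = (- 1) ^ k * (of_nat (Suc n) - of_real l :: complex) ^ k" for n
      by (rule power_minus)
    hence "(\<Sum>\<^sub>\<infinity>n. lambert_neg \<tau> (inverse \<theta>) l n * (- (of_nat (Suc n) - of_real l)) ^ k) =
       (\<Sum>\<^sub>\<infinity>n. (- 1) ^ k * (lambert_neg \<tau> (inverse \<theta>) l n * (of_nat (Suc n) - of_real l) ^ k))"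
      by (simp only: mult.left_commute)
    thus ?thesis by (simp add: infsum_cmult_right')
  qed
  finally show ?thesis
    by (simp add: lambert_taylor_def add_divide_distrib diff_divide_distrib)
qed

text \<open>
  After removal of the pole at \<open>0\<close>, the quotient is holomorphic up to the nearest nonzero period and is the sum of its
  Taylor series there.  Its Taylor coefficients only depend on its values near \<open>0\<close>, and these are known to the left of
  \<open>0\<close> from the Kronecker series; by analytic continuation they are those of the Bernoulli generating function plus the
  Lambert part.
\<close>
lemma deformed_P1_power_series:
  assumes tau: "Im \<tau> > 0" and l: "0 \<le> l" "l < 1" and u: "u = exp (2 * of_real pi * \<i> * of_real \<alpha>)"
    and t: "t = 2 * of_real pi * \<i> * (of_real \<alpha> + of_real l * \<tau>)" and generic: "t \<notin> period_lattice \<tau>"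
    and z: "z \<noteq> 0" and dist: "\<And>w. w \<in> period_lattice \<tau> - {0} \<Longrightarrow> norm z < norm w"
  shows "(\<lambda>k. (bernoulli_poly (k + 1) (of_real l) / fact (k + 1) + lambert_taylor \<tau> u l k) * z ^ k) sums
     (theta_odd_deriv \<tau> 0 / theta_odd \<tau> t * (exp (of_real l * z) * theta_odd \<tau> (z + t)) / theta_odd \<tau> z - 1 / z)"
proof -
  have t0: "theta_odd \<tau> t \<noteq> 0"
    using generic theta_odd_eq_0_imp_period[OF tau] by blast
  define f where "f = (\<lambda>w. theta_odd_deriv \<tau> 0 / theta_odd \<tau> t * (exp (of_real l * w) * theta_odd \<tau> (w + t)))"
  \<comment> \<open>\<open>h\<close> is \<open>theta_odd\<close> without its zero at 0, \<open>\<kappa>\<close> is the quotient without its pole at 0, and \<open>g\<close> is the quotient minus \<open>1 / w\<close>\<close>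
  define h where "h = (\<lambda>w. if w = 0 then deriv (theta_odd \<tau>) 0 else (theta_odd \<tau> w - theta_odd \<tau> 0) / (w - 0))"
  define \<kappa> where "\<kappa> = (\<lambda>w. f w / h w)"
  define g where "g = (\<lambda>w. if w = 0 then deriv \<kappa> 0 else (\<kappa> w - \<kappa> 0) / (w - 0))"
  have h0: "h 0 = theta_odd_deriv \<tau> 0"
    using theta_odd_has_field_derivative[OF tau] by (simp add: h_def DERIV_imp_deriv)
  have D0: "theta_odd_deriv \<tau> 0 \<noteq> 0"
    by (rule theta_odd_deriv_0_nonzero[OF tau])
  have \<kappa>0: "\<kappa> 0 = 1"
    using t0 D0 by (simp add: \<kappa>_def f_def h0)
  obtain r where r: "norm z < r" "\<And>w. norm w < r \<Longrightarrow> w \<noteq> 0 \<Longrightarrow> theta_odd \<tau> w \<noteq> 0"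
    using ball_avoiding_zeros[OF tau dist] by blast
  have r0: "r > 0" using r(1) norm_ge_zero[of z] by linarith
  have "h holomorphic_on ball 0 r"
    unfolding h_def by (rule pole_lemma_open[OF theta_odd_holomorphic[OF tau]]) simp
  moreover have "f holomorphic_on ball 0 r"
    unfolding f_def by (intro holomorphic_intros theta_odd_shift_holomorphic[OF tau])
  moreover have "h w \<noteq> 0" if "w \<in> ball 0 r" for w
    using that r(2)[of w] D0 h0 by (cases "w = 0") (auto simp: h_def)
  ultimately have "\<kappa> holomorphic_on ball 0 r"
    unfolding \<kappa>_def by (intro holomorphic_intros) auto
  hence g: "g holomorphic_on ball 0 r"
    unfolding g_def by (rule pole_lemma_open) simp
  have g_eq: "g w = f w / theta_odd \<tau> w - 1 / w" if "norm w < r" "w \<noteq> 0" for w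
    using that r(2)[OF that] unfolding g_def \<kappa>0 by (simp add: \<kappa>_def h_def field_simps)
  obtain b where b: "b holomorphic_on ball 0 1"
      "\<And>w. norm w < 1 \<Longrightarrow> w \<noteq> 0 \<Longrightarrow> b w = exp (of_real l * w) / (exp w - 1) - 1 / w"
      "\<And>k. fps_nth (fps_expansion b 0) k = bernoulli_poly (k + 1) (of_real l) / fact (k + 1)"
    using bernoulli_generating_function by blast
  \<comment> \<open>a radius at which all three expansions are valid\<close>
  define \<rho> where "\<rho> = Min {r, 1, 2 * pi * Im \<tau>}"
  have \<rho>: "\<rho> > 0" "\<rho> \<le> r" "\<rho> \<le> 1" "\<rho> \<le> 2 * pi * Im \<tau>"
    using r0 tau by (auto simp: \<rho>_def)
  have eq: "g w = b w + lambert_part \<tau> u l w" if w: "w \<in> ball 0 \<rho>" for w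
  proof (rule analytic_continuation_open[where s = "ball 0 \<rho> \<inter> {w. Re w < 0}" and s' = "ball 0 \<rho>"
        and f = g and g = "\<lambda>w. b w + lambert_part \<tau> u l w"])
    show "open (ball 0 \<rho> \<inter> {w. Re w < 0})"
      by (intro open_Int open_ball open_Collect_less continuous_intros)
    have "of_real (- (\<rho> / 2)) \<in> ball 0 \<rho> \<inter> {w. Re w < 0}"
      using \<rho> by simp
    thus "ball 0 \<rho> \<inter> {w. Re w < 0} \<noteq> {}" by blast
    show "g holomorphic_on ball 0 \<rho>"
      using g by (rule holomorphic_on_subset) (use \<rho> in auto)
    show "(\<lambda>w. b w + lambert_part \<tau> u l w) holomorphic_on ball 0 \<rho>"
      by (intro holomorphic_on_add holomorphic_on_subset[OF b(1)]
          holomorphic_on_subset[OF lambert_part_holomorphic[OF tau l]]) (use \<rho> in auto)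
    fix v assume v: "v \<in> ball 0 \<rho> \<inter> {w. Re w < 0}"
    hence v': "norm v < r" "norm v < 1" "v \<noteq> 0" using \<rho> by auto
    have "norm v < 2 * pi * Im \<tau>" using v \<rho>(4) by auto
    hence strip: "- (2 * pi * Im \<tau>) < Re v" "Re v < 0"
      using v abs_Re_le_cmod[of v] by auto
    have "f v / theta_odd \<tau> v = kronecker_series \<tau> u l v"
      unfolding f_def using kronecker_formula(2)[OF tau l u t generic strip] by simp
    also have "\<dots> = exp (of_real l * v) / (exp v - 1) + lambert_part \<tau> u l v"
      by (rule kronecker_series_conv_lambert_part[OF tau l _ strip kronecker_formula(1)[OF tau l u t generic]]) (simp add: u)
    finally show "g v = b v + lambert_part \<tau> u l v"
      using g_eq[OF v'(1,3)] b(2)[OF v'(2,3)] by simp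
  qed (use w in auto)
  have "g has_fps_expansion fps_expansion g 0"
    using g r0 by (intro has_fps_expansion_fps_expansion[of "ball 0 r"]) auto
  moreover have "g has_fps_expansion fps_expansion b 0 + Abs_fps (lambert_taylor \<tau> u l)"
  proof -
    have "b has_fps_expansion fps_expansion b 0"
      using b(1) by (intro has_fps_expansion_fps_expansion[of "ball 0 1"]) auto
    moreover have "lambert_part \<tau> u l has_fps_expansion Abs_fps (lambert_taylor \<tau> u l)"
    proof (rule has_fps_expansionI)
      have "eventually (\<lambda>w. w \<in> ball 0 \<rho>) (nhds (0 :: complex))"
        using \<rho> by (intro eventually_nhds_in_open) auto
      thus "eventually (\<lambda>w. (\<lambda>n. fps_nth (Abs_fps (lambert_taylor \<tau> u l)) n * w ^ n) sums lambert_part \<tau> u l w) (nhds 0)"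
      proof eventually_elim
        case (elim w)
        thus ?case
          using lambert_part_power_series[OF tau l, of w u] \<rho>(4) by simp
      qed
    qed
    ultimately have sum: "(\<lambda>w. b w + lambert_part \<tau> u l w) has_fps_expansion fps_expansion b 0 + Abs_fps (lambert_taylor \<tau> u l)"
      by (rule has_fps_expansion_add)
    have "eventually (\<lambda>w. w \<in> ball 0 \<rho>) (nhds (0 :: complex))"
      using \<rho> by (intro eventually_nhds_in_open) auto
    hence "eventually (\<lambda>w. b w + lambert_part \<tau> u l w = g w) (nhds 0)"
      by eventually_elim (simp add: eq)
    thus ?thesis
      using sum by (rule has_fps_expansion_cong[OF _ refl, THEN iffD1])
  qed
  ultimately have fps: "fps_expansion g 0 = fps_expansion b 0 + Abs_fps (lambert_taylor \<tau> u l)"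
    by (rule fps_expansion_unique_complex)
  have coeff: "(deriv ^^ k) g 0 / fact k = bernoulli_poly (k + 1) (of_real l) / fact (k + 1) + lambert_taylor \<tau> u l k" for k
  proof -
    have "(deriv ^^ k) g 0 / fact k = fps_nth (fps_expansion g 0) k"
      by (simp add: fps_expansion_def)
    thus ?thesis unfolding fps by (simp only: fps_add_nth fps_nth_Abs_fps b(3))
  qed
  have "(\<lambda>k. (deriv ^^ k) g 0 / fact k * (z - 0) ^ k) sums g z"
    by (rule holomorphic_power_series[OF g]) (use r in simp)
  thus ?thesis
    unfolding coeff diff_zero g_eq[OF r(1) z] f_def .
qed

section \<open>Garvan's formula\<close>

lemma i_power_8n: "\<i> ^ (8 * n) = 1"
  by (simp add: power_mult)

lemma even_choose_2_8n: "even ((8 * n) choose 2)" "even ((8 * n + 1) choose 2)"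
  by (auto simp: choose_two)

theorem proposition1:
  fixes n :: nat and \<alpha> \<beta> :: real and \<theta> \<phi> \<tau> :: complex and x y :: "nat \<Rightarrow> complex"
  assumes "n > 0" and "Im \<tau> > 0"
    and "\<theta> = exp (- 2 * of_real pi * \<i> * of_real \<alpha>)"
    and "\<phi> = exp (- 2 * of_real pi * \<i> * of_real \<beta>)"
  shows
    "((\<theta>, \<phi>) \<noteq> (1, 1) \<and> generic_points (8*n) x y \<tau> \<and>
        theta_char (1/2 - \<beta>) (1/2 + \<alpha>) (\<Sum>i<8*n. x i - y i) \<tau> \<noteq> 0 \<longrightarrow>
      dedekind_eta \<tau> ^ (24*n) =
        theta_char (1/2 - \<beta>) (1/2 + \<alpha>) 0 \<tau> * big_theta (8*n) x y \<tau> /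
          theta_char (1/2 - \<beta>) (1/2 + \<alpha>) (\<Sum>i<8*n. x i - y i) \<tau> *
        Determinant.det (P_matrix (8*n) \<theta> \<phi> x y \<tau>))
     \<and>
     ((\<theta>, \<phi>) \<noteq> (1, 1) \<and> generic_points (8*n) x y \<tau> \<and>
        theta_char (1/2 - \<beta>) (1/2 + \<alpha>) (\<Sum>i<8*n. x i - y i) \<tau> \<noteq> 0 \<and>
        (\<forall>i<8*n. \<forall>j<8*n. \<forall>\<omega>\<in>period_lattice \<tau> - {0}. norm (x i - y j) < norm \<omega>) \<longrightarrow>
      dedekind_eta \<tau> ^ (24*n) =
        theta_char (1/2 - \<beta>) (1/2 + \<alpha>) 0 \<tau> * big_theta (8*n) x y \<tau> /
          theta_char (1/2 - \<beta>) (1/2 + \<alpha>) (\<Sum>i<8*n. x i - y i) \<tau> *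
        Determinant.det (Matrix.mat (8*n) (8*n) (\<lambda>(i, j). 1 / (x i - y j) -
          (\<Sum>k. deformed_eisenstein (k + 1) \<theta> \<phi> \<tau> * (x i - y j) ^ k))))
     \<and>
     ((\<theta>, \<phi>) = (1, 1) \<and> generic_points (8*n+1) x y \<tau> \<and>
        theta_char (1/2) (1/2) (\<Sum>i<8*n+1. x i - y i) \<tau> \<noteq> 0 \<longrightarrow>
      dedekind_eta \<tau> ^ (24*n) =
        - (big_theta (8*n+1) x y \<tau> /
             theta_char (1/2) (1/2) (\<Sum>i<8*n+1. x i - y i) \<tau>) *
        Determinant.det (Q_matrix (8*n+1) x y \<tau>))"
proof -
  note tau = assms(2)
  define l where "l = frac (- \<beta>)"
  \<comment> \<open>the exponent of \<phi> is the fractional part of -\<beta>; the integral part does not affect the theta function\<close>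
  define k where "k = \<lfloor>- \<beta>\<rfloor>"
  have beta: "1/2 - \<beta> = (1/2 + l) + of_int k"
    by (simp add: l_def k_def frac_def)
  have l: "0 \<le> l" "l < 1" by (simp_all add: l_def frac_lt_1)
  have \<phi>: "\<phi> = exp (2 * of_real pi * \<i> * of_real l)"
  proof -
    have "\<phi> = exp (2 * of_real pi * \<i> * of_real (l + of_int k))"
      unfolding assms(4) by (simp add: l_def k_def frac_def)
    also have "\<dots> = exp (2 * of_real pi * \<i> * of_real l) * exp ((2 * of_int k) * (\<i> * of_real pi))"
      unfolding exp_add[symmetric] by (rule arg_cong[of _ _ exp]) (simp add: algebra_simps)
    finally show ?thesis by (simp only: exp_even_pi mult_1_right)
  qed
  have char: "char_exponent \<phi> = l"
    by (rule char_exponent_eqI[OF l \<phi>])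
  define u where "u = exp (2 * of_real pi * \<i> * of_real \<alpha>)"
  have u: "inverse \<theta> = u"
    by (simp add: assms(3) u_def exp_minus)
  define t where "t = 2 * of_real pi * \<i> * (of_real \<alpha> + of_real l * \<tau>)"
  have eta: "theta_odd_deriv \<tau> 0 ^ (8 * n) = dedekind_eta \<tau> ^ (24 * n)"
    by (simp add: theta_odd_deriv_0[OF tau] power_mult_distrib i_power_8n flip: power_mult)
  have sign: "(- 1 :: complex) ^ ((8 * n) choose 2) = 1" "(- 1 :: complex) ^ (Suc (8 * n) choose 2) = 1"
    using even_choose_2_8n[of n] by simp_all

  have generic: "t \<notin> period_lattice \<tau>" if ne: "(\<theta>, \<phi>) \<noteq> (1, 1)"
  proof
    assume "t \<in> period_lattice \<tau>"
    then obtain a b :: int where "t = 2 * of_real pi * \<i> * (of_int a + of_int b * \<tau>)"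
      by (auto simp: period_lattice_def)
    hence eq: "of_real \<alpha> + of_real l * \<tau> = of_int a + of_int b * \<tau>"
      by (simp add: t_def)
    have "l * Im \<tau> = of_int b * Im \<tau>"
      using arg_cong[OF eq, of Im] by simp
    hence lb: "l = of_int b" using tau by simp
    with l have "b = 0" by linarith
    with lb have l0: "l = 0" by simp
    with \<open>b = 0\<close> eq have "complex_of_real \<alpha> = of_int a" by simp
    hence "u = exp ((2 * of_int a) * (\<i> * of_real pi))"
      unfolding u_def by (simp add: mult_ac)
    hence "u = 1" by (simp only: exp_even_pi)
    hence "\<theta> = 1" using u by simp
    moreover have "\<phi> = 1" using \<phi> l0 by simp
    ultimately show False using ne by simp
  qed
  have series: "deformed_P1_series \<theta> \<phi> \<tau> z = kronecker_series \<tau> u l z" for z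
  proof -
    have "l = 0" if "\<phi> = 1"
      using char char_exponent_eqI[of 0 \<phi>] that by simp
    thus ?thesis
      using deformed_P1_series_eq_kronecker_series[OF char, of \<theta> \<tau> z] u by simp
  qed
  define f where "f = (\<lambda>z. theta_odd_deriv \<tau> 0 / theta_odd \<tau> t * (exp (of_real l * z) * theta_odd \<tau> (z + t)))"
  have P: "deformed_P1 \<theta> \<phi> \<tau> z = f z / theta_odd \<tau> z"
    if ne: "(\<theta>, \<phi>) \<noteq> (1, 1)" and z: "z \<notin> period_lattice \<tau>" for z
  proof (rule deformed_P1_eqI[OF tau _ _ z])
    show "f holomorphic_on UNIV"
      unfolding f_def by (intro holomorphic_intros theta_odd_shift_holomorphic[OF tau])
    fix w assume "- (2 * pi * Im \<tau>) < Re w" "Re w < 0"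
    thus "deformed_P1_series \<theta> \<phi> \<tau> w = f w / theta_odd \<tau> w"
      unfolding series f_def by (rule kronecker_formula(2)[OF tau l u_def t_def generic[OF ne]])
  qed

  have i: "dedekind_eta \<tau> ^ (24*n) =
        theta_char (1/2 - \<beta>) (1/2 + \<alpha>) 0 \<tau> * big_theta (8*n) x y \<tau> /
          theta_char (1/2 - \<beta>) (1/2 + \<alpha>) (\<Sum>i<8*n. x i - y i) \<tau> *
        Determinant.det (P_matrix (8*n) \<theta> \<phi> x y \<tau>)"
    if ne: "(\<theta>, \<phi>) \<noteq> (1, 1)" and gen: "generic_points (8*n) x y \<tau>"
      and denom: "theta_char (1/2 - \<beta>) (1/2 + \<alpha>) (\<Sum>i<8*n. x i - y i) \<tau> \<noteq> 0"
  proof -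
    define S where "S = (\<Sum>i<8*n. x i - y i)"
    obtain c where c: "c \<noteq> 0"
      "\<And>z. theta_char (1/2 - \<beta>) (1/2 + \<alpha>) z \<tau> = c * (exp (of_real l * z) * theta_odd \<tau> (z + t))"
      unfolding beta theta_char_shift_int theta_char_conv_theta_odd[OF t_def] by (metis exp_not_eq_zero)
    have t0: "theta_odd \<tau> t \<noteq> 0"
      using generic[OF ne] theta_odd_eq_0_imp_period[OF tau] by blast
    have S0: "exp (of_real l * S) * theta_odd \<tau> (S + t) \<noteq> 0"
      using denom unfolding c S_def by simp
    have det: "Determinant.det (P_matrix (8*n) \<theta> \<phi> x y \<tau>) = dedekind_eta \<tau> ^ (24*n) *
        (exp (of_real l * S) * theta_odd \<tau> (S + t) / theta_odd \<tau> t) * inverse (big_theta (8*n) x y \<tau>)"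
      using det_P_matrix[OF tau _ gen _ t0, of \<theta> \<phi> l] P[OF ne] assms(1)
      by (simp add: f_def S_def eta sign)
    show ?thesis
      unfolding det c S_def[symmetric]
      using big_theta_nonzero[OF tau gen] c(1) t0 S0 by (simp add: field_simps)
  qed

  have ii: "Matrix.mat (8*n) (8*n) (\<lambda>(i, j). 1 / (x i - y j) -
          (\<Sum>k. deformed_eisenstein (k + 1) \<theta> \<phi> \<tau> * (x i - y j) ^ k)) = P_matrix (8*n) \<theta> \<phi> x y \<tau>"
    if ne: "(\<theta>, \<phi>) \<noteq> (1, 1)" and gen: "generic_points (8*n) x y \<tau>"
      and dist: "\<forall>i<8*n. \<forall>j<8*n. \<forall>\<omega>\<in>period_lattice \<tau> - {0}. norm (x i - y j) < norm \<omega>"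
  proof (rule eq_matI)
    fix i j assume "i < dim_row (P_matrix (8*n) \<theta> \<phi> x y \<tau>)" "j < dim_col (P_matrix (8*n) \<theta> \<phi> x y \<tau>)"
    hence ij: "i < 8 * n" "j < 8 * n" by (simp_all add: P_matrix_def)
    define z where "z = x i - y j"
    have z: "z \<notin> period_lattice \<tau>"
      using gen ij by (simp add: generic_points_def z_def)
    have "0 \<in> period_lattice \<tau>"
      unfolding period_lattice_def by (intro CollectI exI[of _ 0]) simp
    hence z0: "z \<noteq> 0" using z by blast
    have near: "norm z < norm w" if "w \<in> period_lattice \<tau> - {0}" for w
      using dist ij that by (simp add: z_def)
    have taylor: "(\<lambda>k. - deformed_eisenstein (k + 1) \<theta> \<phi> \<tau> * z ^ k) sums (f z / theta_odd \<tau> z - 1 / z)"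
      using deformed_P1_power_series[OF tau l u_def t_def generic[OF ne] z0 near]
      unfolding deformed_eisenstein_conv_lambert[OF char ne] u f_def minus_minus .
    have "(\<lambda>k. deformed_eisenstein (k + 1) \<theta> \<phi> \<tau> * z ^ k) sums - (f z / theta_odd \<tau> z - 1 / z)"
      using sums_minus[OF taylor] by simp
    hence "(\<Sum>k. deformed_eisenstein (k + 1) \<theta> \<phi> \<tau> * z ^ k) = - (f z / theta_odd \<tau> z - 1 / z)"
      by (rule sums_unique[symmetric])
    hence "1 / z - (\<Sum>k. deformed_eisenstein (k + 1) \<theta> \<phi> \<tau> * z ^ k) = deformed_P1 \<theta> \<phi> \<tau> z"
      using P[OF ne z] by simp
    thus "Matrix.mat (8*n) (8*n) (\<lambda>(i, j). 1 / (x i - y j) -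
          (\<Sum>k. deformed_eisenstein (k + 1) \<theta> \<phi> \<tau> * (x i - y j) ^ k)) $$ (i, j) =
        P_matrix (8*n) \<theta> \<phi> x y \<tau> $$ (i, j)"
      using ij by (simp add: P_matrix_def z_def)
  qed (simp_all add: P_matrix_def)

  have iii: "dedekind_eta \<tau> ^ (24*n) =
        - (big_theta (8*n+1) x y \<tau> /
             theta_char (1/2) (1/2) (\<Sum>i<8*n+1. x i - y i) \<tau>) *
        Determinant.det (Q_matrix (8*n+1) x y \<tau>)"
    if gen: "generic_points (8*n+1) x y \<tau>"
      and denom: "theta_char (1/2) (1/2) (\<Sum>i<8*n+1. x i - y i) \<tau> \<noteq> 0"
  proof -
    define S where "S = (\<Sum>i<Suc (8*n). x i - y i)"
    have S0: "theta_odd \<tau> S \<noteq> 0"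
      using denom by (simp add: theta_odd_def S_def)
    have "Determinant.det (Q_matrix (Suc (8*n)) x y \<tau>) =
        - (dedekind_eta \<tau> ^ (24*n) * theta_odd \<tau> S * inverse (big_theta (Suc (8*n)) x y \<tau>))"
      using det_Q_matrix[OF tau, of "8*n" x y] gen unfolding sign eta S_def by simp
    thus ?thesis
      using big_theta_nonzero[OF tau gen] S0
      unfolding Suc_eq_plus1[symmetric] theta_odd_def[symmetric] S_def[symmetric] by (simp add: field_simps)
  qed
  show ?thesis
    using i ii iii by simp
qed

end
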